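(* Let $(M^n,g_t,H_t,\phi_t)$ be a solution to generalized Ricci flow on a compact manifold (with $\phi_t$ a solution of the associated dilaton flow), with initial time $0$. Then for any smooth existence time $t$ one has $$\inf_{M\times\{t\}}R^{H,\phi}\ \ge\ \inf_{M\times\{0\}}R^{H,\phi}.$$
   Context: Conventions: inner products and norms of tensors and forms are full tensor contractions, e.g. $|H|^2=H_{ijk}H^{ijk}$. $\mathrm{Rc}$, $R$ are the Ricci tensor and scalar curvature of $g$; $\Delta=\mathrm{tr}_g\nabla^2$; $d^*_g$ is the codifferential; $H^2(X,Y)=\langle i_XH,i_YH\rangle$; $\square=\frac{\partial}{\partial t}-\Delta$. Generalized Ricci flow: a one-parameter family of Riemannian metrics $g_t$ and closed three-forms $H_t=H_0+db_t$ with $\frac{\partial}{\partial t}g=-2\mathrm{Rc}+\frac12H^2$, $\frac{\partial}{\partial t}b=-d^*_gH$. Dilaton flow: smooth functions $\phi_t$ with $\square\phi=\frac16|H|^2$. A triple $(g_t,H_t,\phi_t)$ is called a solution of generalized Ricci flow if both hold. The generalized scalar curvature is $$R^{H,\phi}=R-\tfrac1{12}|H|^2+2\Delta\phi-|\nabla\phi|^2 .$$ *)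

theory Defs
  imports "HOL-Analysis.Analysis"
begin

section \<open>Smooth functions\<close>

text \<open>
  Derivatives are taken within \<open>S\<close>, so that \<open>S\<close> may be an open set or a product \<open>I \<times> U\<close> of an
  interval and an open set; in the latter case this is smoothness up to the end points of \<open>I\<close>
  that belong to \<open>I\<close>.
\<close>

primrec Ck_on ::
  "nat \<Rightarrow> 'a::real_normed_vector set \<Rightarrow> ('a \<Rightarrow> 'b::real_normed_vector) \<Rightarrow> bool"
where
  "Ck_on 0 S f \<longleftrightarrow> continuous_on S f"
| "Ck_on (Suc k) S f \<longleftrightarrow>
     (\<exists>f'. (\<forall>x\<in>S. (f has_derivative f' x) (at x within S)) \<and> (\<forall>v. Ck_on k S (\<lambda>x. f' x v)))"

definition smooth_on ::
  "'a::real_normed_vector set \<Rightarrow> ('a \<Rightarrow> 'b::real_normed_vector) \<Rightarrow> bool"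
where
  "smooth_on S f \<longleftrightarrow> (\<forall>k. Ck_on k S f)"

definition pderiv_at :: "'n::finite \<Rightarrow> (real^'n \<Rightarrow> real) \<Rightarrow> real^'n \<Rightarrow> real" where
  "pderiv_at i f x = frechet_derivative f (at x) (axis i 1)"


section \<open>Smooth manifolds\<close>

type_synonym ('a, 'n) chart = "'a set \<times> ('a \<Rightarrow> real^'n)"

abbreviation chart_dom :: "('a, 'n) chart \<Rightarrow> 'a set" where
  "chart_dom \<equiv> fst"

abbreviation chart_map :: "('a, 'n) chart \<Rightarrow> 'a \<Rightarrow> real^'n" where
  "chart_map \<equiv> snd"

definition chart_im :: "('a, 'n) chart \<Rightarrow> (real^'n) set" where
  "chart_im c = chart_map c ` chart_dom c"

definition chart_inv :: "('a, 'n) chart \<Rightarrow> real^'n \<Rightarrow> 'a" where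
  "chart_inv c = inv_into (chart_dom c) (chart_map c)"

definition is_chart :: "'a topology \<Rightarrow> ('a, 'n::finite) chart \<Rightarrow> bool" where
  "is_chart X c \<longleftrightarrow>
     openin X (chart_dom c) \<and> open (chart_im c) \<and>
     homeomorphic_map (subtopology X (chart_dom c)) (top_of_set (chart_im c)) (chart_map c)"

definition overlap :: "('a, 'n) chart \<Rightarrow> ('a, 'n) chart \<Rightarrow> (real^'n) set" where
  "overlap c d = chart_map c ` (chart_dom c \<inter> chart_dom d)"

definition transition :: "('a, 'n) chart \<Rightarrow> ('a, 'n) chart \<Rightarrow> real^'n \<Rightarrow> real^'n" where
  "transition c d = chart_map d \<circ> chart_inv c"

definition smooth_manifold :: "'a topology \<Rightarrow> ('a, 'n::finite) chart set \<Rightarrow> bool" where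
  "smooth_manifold X A \<longleftrightarrow>
     Hausdorff_space X \<and> second_countable X \<and>
     (\<forall>c\<in>A. is_chart X c) \<and> (\<Union>c\<in>A. chart_dom c) = topspace X \<and>
     (\<forall>c\<in>A. \<forall>d\<in>A. smooth_on (overlap c d) (transition c d))"


section \<open>Covariant tensor fields\<close>

text \<open>
  A tensor field is given by its components in each chart \<open>c\<close> of the atlas, as functions of the
  coordinates \<open>x \<in> chart_im c\<close>, subject to the usual transformation law; \<open>J $ a $ i\<close> below is the
  partial derivative of the \<open>a\<close>-th \<open>d\<close>-coordinate with respect to the \<open>i\<close>-th \<open>c\<close>-coordinate.
  Component values outside \<open>chart_im c\<close> are irrelevant.
\<close>

type_synonym ('a, 'n) field2 = "('a, 'n) chart \<Rightarrow> real^'n \<Rightarrow> real^'n^'n"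
type_synonym ('a, 'n) field3 = "('a, 'n) chart \<Rightarrow> real^'n \<Rightarrow> real^'n^'n^'n"

definition tensor2 :: "('a, 'n::finite) chart set \<Rightarrow> ('a, 'n) field2 \<Rightarrow> bool" where
  "tensor2 A T \<longleftrightarrow>
     (\<forall>c\<in>A. \<forall>d\<in>A. \<forall>x\<in>overlap c d. \<forall>i j.
        let J = jacobian (transition c d) (at x); y = transition c d x in
        T c x $ i $ j = (\<Sum>a\<in>UNIV. \<Sum>b\<in>UNIV. J $ a $ i * J $ b $ j * T d y $ a $ b))"

definition tensor3 :: "('a, 'n::finite) chart set \<Rightarrow> ('a, 'n) field3 \<Rightarrow> bool" where
  "tensor3 A T \<longleftrightarrow>
     (\<forall>c\<in>A. \<forall>d\<in>A. \<forall>x\<in>overlap c d. \<forall>i j k.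
        let J = jacobian (transition c d) (at x); y = transition c d x in
        T c x $ i $ j $ k =
          (\<Sum>a\<in>UNIV. \<Sum>b\<in>UNIV. \<Sum>e\<in>UNIV.
             J $ a $ i * J $ b $ j * J $ e $ k * T d y $ a $ b $ e))"

definition smooth_family ::
  "('a, 'n::finite) chart set \<Rightarrow> real set \<Rightarrow>
   (real \<Rightarrow> ('a, 'n) chart \<Rightarrow> real^'n \<Rightarrow> 'b::real_normed_vector) \<Rightarrow> bool"
where
  "smooth_family A I T \<longleftrightarrow> (\<forall>c\<in>A. smooth_on (I \<times> chart_im c) (\<lambda>(t, x). T t c x))"

definition local_rep :: "('a \<Rightarrow> real) \<Rightarrow> ('a, 'n) chart \<Rightarrow> real^'n \<Rightarrow> real" where
  "local_rep f c = f \<circ> chart_inv c"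

definition riemannian_metric :: "('a, 'n::finite) chart set \<Rightarrow> ('a, 'n) field2 \<Rightarrow> bool" where
  "riemannian_metric A g \<longleftrightarrow>
     tensor2 A g \<and>
     (\<forall>c\<in>A. \<forall>x\<in>chart_im c.
        transpose (g c x) = g c x \<and> (\<forall>v. v \<noteq> 0 \<longrightarrow> v \<bullet> (g c x *v v) > 0))"

definition two_form :: "('a, 'n::finite) chart set \<Rightarrow> ('a, 'n) field2 \<Rightarrow> bool" where
  "two_form A b \<longleftrightarrow>
     tensor2 A b \<and> (\<forall>c\<in>A. \<forall>x\<in>chart_im c. \<forall>i j. b c x $ i $ j = - b c x $ j $ i)"

definition three_form :: "('a, 'n::finite) chart set \<Rightarrow> ('a, 'n) field3 \<Rightarrow> bool" where
  "three_form A H \<longleftrightarrow>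
     tensor3 A H \<and>
     (\<forall>c\<in>A. \<forall>x\<in>chart_im c. \<forall>i j k.
        H c x $ i $ j $ k = - H c x $ j $ i $ k \<and> H c x $ i $ j $ k = - H c x $ i $ k $ j)"

text \<open>Exterior derivatives of a two-form and of a three-form, in local coordinates.\<close>

definition ext_deriv2 :: "(real^'n::finite \<Rightarrow> real^'n^'n) \<Rightarrow> real^'n \<Rightarrow> real^'n^'n^'n" where
  "ext_deriv2 b x =
     (\<chi> i j k. pderiv_at i (\<lambda>y. b y $ j $ k) x - pderiv_at j (\<lambda>y. b y $ i $ k) x
             + pderiv_at k (\<lambda>y. b y $ i $ j) x)"

definition ext_deriv3 :: "(real^'n::finite \<Rightarrow> real^'n^'n^'n) \<Rightarrow> real^'n \<Rightarrow> real^'n^'n^'n^'n" where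
  "ext_deriv3 H x =
     (\<chi> i j k l. pderiv_at i (\<lambda>y. H y $ j $ k $ l) x - pderiv_at j (\<lambda>y. H y $ i $ k $ l) x
               + pderiv_at k (\<lambda>y. H y $ i $ j $ l) x - pderiv_at l (\<lambda>y. H y $ i $ j $ k) x)"

definition closed_three_form :: "('a, 'n::finite) chart set \<Rightarrow> ('a, 'n) field3 \<Rightarrow> bool" where
  "closed_three_form A H \<longleftrightarrow>
     three_form A H \<and> (\<forall>c\<in>A. \<forall>x\<in>chart_im c. ext_deriv3 (H c) x = 0)"


section \<open>Riemannian geometry in local coordinates\<close>

text \<open>In this section \<open>G\<close>, \<open>H\<close>, \<open>f\<close> are the local expressions of \<open>g\<close>, \<open>H\<close>, \<open>\<phi>\<close> in one chart.\<close>

definition ginv :: "(real^'n::finite \<Rightarrow> real^'n^'n) \<Rightarrow> real^'n \<Rightarrow> 'n \<Rightarrow> 'n \<Rightarrow> real" where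
  "ginv G x i j = matrix_inv (G x) $ i $ j"

text \<open>\<open>christoffel G l i j x\<close> is $\Gamma^l_{ij}(x)$ for the Levi-Civita connection.\<close>

definition christoffel ::
  "(real^'n::finite \<Rightarrow> real^'n^'n) \<Rightarrow> 'n \<Rightarrow> 'n \<Rightarrow> 'n \<Rightarrow> real^'n \<Rightarrow> real"
where
  "christoffel G l i j x =
     1/2 * (\<Sum>m\<in>UNIV. ginv G x l m *
       (pderiv_at i (\<lambda>y. G y $ j $ m) x + pderiv_at j (\<lambda>y. G y $ i $ m) x
        - pderiv_at m (\<lambda>y. G y $ i $ j) x))"

text \<open>
  \<open>riemann G i j k l x\<close> is the coefficient of $\partial_l$ in $R(\partial_i,\partial_j)\partial_k$,
  where $R(X,Y)Z = \nabla_X\nabla_Y Z - \nabla_Y\nabla_X Z - \nabla_{[X,Y]}Z$; the Ricci tensor is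
  the trace of $X \mapsto R(X,Y)Z$ (positive on round spheres).
\<close>

definition riemann ::
  "(real^'n::finite \<Rightarrow> real^'n^'n) \<Rightarrow> 'n \<Rightarrow> 'n \<Rightarrow> 'n \<Rightarrow> 'n \<Rightarrow> real^'n \<Rightarrow> real"
where
  "riemann G i j k l x =
     pderiv_at i (christoffel G l j k) x - pderiv_at j (christoffel G l i k) x
     + (\<Sum>m\<in>UNIV. christoffel G l i m x * christoffel G m j k x
                  - christoffel G l j m x * christoffel G m i k x)"

definition ricci :: "(real^'n::finite \<Rightarrow> real^'n^'n) \<Rightarrow> real^'n \<Rightarrow> real^'n^'n" where
  "ricci G x = (\<chi> j k. \<Sum>l\<in>UNIV. riemann G l j k l x)"

definition scalar_curv :: "(real^'n::finite \<Rightarrow> real^'n^'n) \<Rightarrow> real^'n \<Rightarrow> real" where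
  "scalar_curv G x = (\<Sum>j\<in>UNIV. \<Sum>k\<in>UNIV. ginv G x j k * ricci G x $ j $ k)"

definition hessian ::
  "(real^'n::finite \<Rightarrow> real^'n^'n) \<Rightarrow> (real^'n \<Rightarrow> real) \<Rightarrow> real^'n \<Rightarrow> real^'n^'n"
where
  "hessian G f x =
     (\<chi> i j. pderiv_at i (pderiv_at j f) x - (\<Sum>l\<in>UNIV. christoffel G l i j x * pderiv_at l f x))"

definition laplacian ::
  "(real^'n::finite \<Rightarrow> real^'n^'n) \<Rightarrow> (real^'n \<Rightarrow> real) \<Rightarrow> real^'n \<Rightarrow> real"
where
  "laplacian G f x = (\<Sum>i\<in>UNIV. \<Sum>j\<in>UNIV. ginv G x i j * hessian G f x $ i $ j)"

definition grad_norm_sq ::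
  "(real^'n::finite \<Rightarrow> real^'n^'n) \<Rightarrow> (real^'n \<Rightarrow> real) \<Rightarrow> real^'n \<Rightarrow> real"
where
  "grad_norm_sq G f x = (\<Sum>i\<in>UNIV. \<Sum>j\<in>UNIV. ginv G x i j * pderiv_at i f x * pderiv_at j f x)"

text \<open>\<open>cov_deriv3 G H p i j k x\<close> is $\nabla_p H_{ijk}$.\<close>

definition cov_deriv3 ::
  "(real^'n::finite \<Rightarrow> real^'n^'n) \<Rightarrow> (real^'n \<Rightarrow> real^'n^'n^'n) \<Rightarrow>
   'n \<Rightarrow> 'n \<Rightarrow> 'n \<Rightarrow> 'n \<Rightarrow> real^'n \<Rightarrow> real"
where
  "cov_deriv3 G H p i j k x =
     pderiv_at p (\<lambda>y. H y $ i $ j $ k) x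
     - (\<Sum>m\<in>UNIV. christoffel G m p i x * H x $ m $ j $ k
                  + christoffel G m p j x * H x $ i $ m $ k
                  + christoffel G m p k x * H x $ i $ j $ m)"

text \<open>
  The codifferential $(d^*_g H)_{ij} = -\nabla^k H_{kij}$: the standard one, adjoint to the exterior
  derivative with respect to the inner products of forms ($1/k!$ times the full contraction).
\<close>

definition codiff3 ::
  "(real^'n::finite \<Rightarrow> real^'n^'n) \<Rightarrow> (real^'n \<Rightarrow> real^'n^'n^'n) \<Rightarrow> real^'n \<Rightarrow> real^'n^'n"
where
  "codiff3 G H x =
     (\<chi> i j. - (\<Sum>p\<in>UNIV. \<Sum>k\<in>UNIV. ginv G x p k * cov_deriv3 G H p k i j x))"

text \<open>$H^2(X,Y) = \langle i_X H, i_Y H\rangle$.\<close>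

definition form_sq ::
  "(real^'n::finite \<Rightarrow> real^'n^'n) \<Rightarrow> (real^'n \<Rightarrow> real^'n^'n^'n) \<Rightarrow> real^'n \<Rightarrow> real^'n^'n"
where
  "form_sq G H x =
     (\<chi> i j. \<Sum>a\<in>UNIV. \<Sum>b\<in>UNIV. \<Sum>p\<in>UNIV. \<Sum>q\<in>UNIV.
        ginv G x a p * ginv G x b q * H x $ i $ a $ b * H x $ j $ p $ q)"

definition form_norm_sq ::
  "(real^'n::finite \<Rightarrow> real^'n^'n) \<Rightarrow> (real^'n \<Rightarrow> real^'n^'n^'n) \<Rightarrow> real^'n \<Rightarrow> real"
where
  "form_norm_sq G H x =
     (\<Sum>i\<in>UNIV. \<Sum>j\<in>UNIV. \<Sum>k\<in>UNIV. \<Sum>a\<in>UNIV. \<Sum>b\<in>UNIV. \<Sum>e\<in>UNIV.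
        ginv G x i a * ginv G x j b * ginv G x k e * H x $ i $ j $ k * H x $ a $ b $ e)"

definition gen_scalar_curv_local ::
  "(real^'n::finite \<Rightarrow> real^'n^'n) \<Rightarrow> (real^'n \<Rightarrow> real^'n^'n^'n) \<Rightarrow> (real^'n \<Rightarrow> real) \<Rightarrow>
   real^'n \<Rightarrow> real"
where
  "gen_scalar_curv_local G H f x =
     scalar_curv G x - 1/12 * form_norm_sq G H x + 2 * laplacian G f x - grad_norm_sq G f x"

text \<open>
  The generalized scalar curvature as a function on the manifold. The local expression does not
  depend on the chart, so its value at \<open>p\<close> is read off in an arbitrary chart around \<open>p\<close>.
\<close>

definition gen_scalar_curv ::
  "('a, 'n::finite) chart set \<Rightarrow> ('a, 'n) field2 \<Rightarrow> ('a, 'n) field3 \<Rightarrow> ('a \<Rightarrow> real) \<Rightarrow> 'a \<Rightarrow> real"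
where
  "gen_scalar_curv A g H f p =
     (let c = (SOME c. c \<in> A \<and> p \<in> chart_dom c)
      in gen_scalar_curv_local (g c) (H c) (local_rep f c) (chart_map c p))"


section \<open>Generalized Ricci flow\<close>

definition generalized_ricci_flow ::
  "('a, 'n::finite) chart set \<Rightarrow> real set \<Rightarrow>
   (real \<Rightarrow> ('a, 'n) field2) \<Rightarrow> (real \<Rightarrow> ('a, 'n) field3) \<Rightarrow> bool"
where
  "generalized_ricci_flow A I g H \<longleftrightarrow>
     smooth_family A I g \<and> (\<forall>t\<in>I. riemannian_metric A (g t)) \<and>
     smooth_family A I H \<and> (\<forall>t\<in>I. closed_three_form A (H t)) \<and>
     (\<forall>t\<in>I. \<forall>c\<in>A. \<forall>x\<in>chart_im c.
        ((\<lambda>s. g s c x) has_vector_derivative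
           (-2) *\<^sub>R ricci (g t c) x + (1/2) *\<^sub>R form_sq (g t c) (H t c) x) (at t within I)) \<and>
     (\<exists>b. smooth_family A I b \<and> (\<forall>t\<in>I. two_form A (b t)) \<and>
        (\<forall>t\<in>I. \<forall>c\<in>A. \<forall>x\<in>chart_im c.
           H t c x = H 0 c x + ext_deriv2 (b t c) x \<and>
           ((\<lambda>s. b s c x) has_vector_derivative - codiff3 (g t c) (H t c) x) (at t within I)))"

definition dilaton_flow ::
  "('a, 'n::finite) chart set \<Rightarrow> real set \<Rightarrow>
   (real \<Rightarrow> ('a, 'n) field2) \<Rightarrow> (real \<Rightarrow> ('a, 'n) field3) \<Rightarrow> (real \<Rightarrow> 'a \<Rightarrow> real) \<Rightarrow> bool"
where
  "dilaton_flow A I g H \<phi> \<longleftrightarrow>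
     smooth_family A I (\<lambda>t. local_rep (\<phi> t)) \<and>
     (\<forall>t\<in>I. \<forall>c\<in>A. \<forall>x\<in>chart_im c.
        ((\<lambda>s. local_rep (\<phi> s) c x) has_real_derivative
           laplacian (g t c) (local_rep (\<phi> t) c) x + 1/6 * form_norm_sq (g t c) (H t c) x)
          (at t within I))"

end

theory Submission
  imports Defs
begin

text \<open>
  Write \<open>u\<close> for the generalized scalar curvature. Along the flow \<open>u\<close> is a supersolution of the heat equation:
  $$(\partial_t - \Delta) u = 2\,|\mathrm{Rc} - \tfrac14 H^2 + \nabla^2\phi|^2
      + \tfrac12\,|d^*H + i_{\nabla\phi} H|^2 \ge 0,$$
  and the minimum of a supersolution on a compact manifold does not decrease.

  The identity (\<open>gen_scalar_evolution\<close>) comes from the first variation of the scalar curvature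
  (\<open>first_variation_R\<close>), the contracted Bianchi identity, the Bochner formula, and the consequence
  $\mathrm{div}\,H^2 = -\langle d^*H, H\rangle + \tfrac16 \nabla |H|^2$ of $dH = 0$. Since the divergence of
  $H^2$ is a gradient up to a term in $d^*H$, the variation of $R - \tfrac1{12}|H|^2$ is a sum of squares
  up to a multiple of $\Delta|H|^2$, which the source $\tfrac16|H|^2$ of the dilaton flow cancels; the
  remaining terms complete the two squares.

  The tensor calculus takes place in a commutative ring with commuting derivations, such as the
  ring of germs of smooth functions at a point of space-time, where no differentiability conditions
  have to be carried along. Tensoriality under a change of frame is proved once (\<open>metric_map\<close>) and
  used twice: it shows that the local formula for \<open>u\<close> is the same in all charts
  (\<open>gen_scalar_curv_transform\<close>), and it allows every computation at a point to be made in normal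
  coordinates (\<open>normal_coordinates\<close>), in which the first derivatives of the metric vanish at the
  point and covariant derivatives there become partial derivatives. The Bianchi identity and the
  formula for $\mathrm{div}\,H^2$ are differentiated once more and must therefore hold near the point:
  they are proved at every point in normal coordinates of its own, and \<open>coherent_zero\<close> turns
  identities at all points into identities of germs.

  For the maximum principle one minimises \<open>u + e t\<close> over \<open>[0, T] \<times> M\<close>. At a minimum the spatial
  second derivatives of \<open>u\<close> are nonnegative, so its time derivative is nonnegative
  (\<open>time_derivative_at_spatial_min\<close>) and \<open>u + e t\<close> was smaller just before, unless the minimum is
  attained at time \<open>0\<close>. Letting \<open>e\<close> tend to \<open>0\<close> gives the claim for times before the end of the
  interval, and continuity gives it for the last one.
\<close>

abbreviation sum_UNIV :: "('a \<Rightarrow> 'b::comm_monoid_add) \<Rightarrow> 'b"  (binder "\<Sum>\<^sub>U " 10) where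
  "sum_UNIV f \<equiv> sum f UNIV"

section \<open>Tensor calculus in a ring with commuting derivations\<close>

locale derivations =
  fixes D :: "'n::finite \<Rightarrow> 'f::{comm_ring_1,real_algebra_1} \<Rightarrow> 'f"
  assumes D_add: "D i (x + y) = D i x + D i y"
    and D_mult: "D i (x * y) = D i x * y + x * D i y"
    and D_scaleR: "D i (r *\<^sub>R x) = r *\<^sub>R D i x"
    and D_commute: "D i (D j x) = D j (D i x)"
begin

lemma D_zero [simp]: "D i 0 = 0"
  using D_scaleR[of i 0 0] by simp

lemma D_one [simp]: "D i 1 = 0"
  using D_mult[of i 1 1] by simp

lemma D_minus: "D i (- x) = - D i x"
  using D_scaleR[of i "-1" x] by simp

lemma D_diff: "D i (x - y) = D i x - D i y"
  using D_add[of i x "- y"] by (simp add: D_minus)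

lemma D_sum: "D i (sum f S) = (\<Sum>s\<in>S. D i (f s))"
  by (induction S rule: infinite_finite_induct) (simp_all add: D_add)

lemmas D_simps = D_add D_mult D_scaleR D_minus D_diff D_sum

end

text \<open>
  The coordinate formulas of Riemannian geometry, with the partial derivatives \<open>D\<close>, the metric \<open>G\<close>,
  the inverse metric \<open>Gi\<close> and the Christoffel symbols \<open>C\<close> as parameters, so that the same formula
  can be compared in two coordinate systems.
\<close>

type_synonym ('n, 'f) partials = "'n \<Rightarrow> 'f \<Rightarrow> 'f"
type_synonym ('n, 'f) rank2 = "'n \<Rightarrow> 'n \<Rightarrow> 'f"
type_synonym ('n, 'f) rank3 = "'n \<Rightarrow> 'n \<Rightarrow> 'n \<Rightarrow> 'f"

definition Chr :: "('n::finite, 'f) partials \<Rightarrow> ('n, 'f) rank2 \<Rightarrow> ('n, 'f) rank2 \<Rightarrow>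
    'n \<Rightarrow> 'n \<Rightarrow> 'n \<Rightarrow> 'f::{comm_ring_1,real_algebra_1}" where
  "Chr D G Gi l i j = (1/2) *\<^sub>R (\<Sum>\<^sub>U m. Gi l m * (D i (G j m) + D j (G i m) - D m (G i j)))"

definition Riem :: "('n::finite, 'f) partials \<Rightarrow> ('n, 'f) rank3 \<Rightarrow>
    'n \<Rightarrow> 'n \<Rightarrow> 'n \<Rightarrow> 'n \<Rightarrow> 'f::{comm_ring_1,real_algebra_1}" where
  "Riem D C i j k l = D i (C l j k) - D j (C l i k)
     + (\<Sum>\<^sub>U m. C l i m * C m j k - C l j m * C m i k)"

definition Ric :: "('n::finite, 'f) partials \<Rightarrow> ('n, 'f) rank3 \<Rightarrow>
    'n \<Rightarrow> 'n \<Rightarrow> 'f::{comm_ring_1,real_algebra_1}" where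
  "Ric D C j k = (\<Sum>\<^sub>U l. Riem D C l j k l)"

definition Contr :: "('n::finite, 'f) rank2 \<Rightarrow> ('n, 'f::{comm_ring_1,real_algebra_1}) rank2 \<Rightarrow> 'f" where
  "Contr Gi T = (\<Sum>\<^sub>U i j. Gi i j * T i j)"

definition Hess :: "('n::finite, 'f) partials \<Rightarrow> ('n, 'f) rank3 \<Rightarrow> 'f \<Rightarrow>
    'n \<Rightarrow> 'n \<Rightarrow> 'f::{comm_ring_1,real_algebra_1}" where
  "Hess D C f i j = D i (D j f) - (\<Sum>\<^sub>U l. C l i j * D l f)"

definition Cov2 :: "('n::finite, 'f) partials \<Rightarrow> ('n, 'f) rank3 \<Rightarrow> ('n, 'f) rank2 \<Rightarrow>
    'n \<Rightarrow> 'n \<Rightarrow> 'n \<Rightarrow> 'f::{comm_ring_1,real_algebra_1}" where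
  "Cov2 D C T p i j = D p (T i j) - (\<Sum>\<^sub>U m. C m p i * T m j + C m p j * T i m)"

definition Cov3 :: "('n::finite, 'f) partials \<Rightarrow> ('n, 'f) rank3 \<Rightarrow> ('n, 'f) rank3 \<Rightarrow>
    'n \<Rightarrow> 'n \<Rightarrow> 'n \<Rightarrow> 'n \<Rightarrow> 'f::{comm_ring_1,real_algebra_1}" where
  "Cov3 D C T p i j k = D p (T i j k)
     - (\<Sum>\<^sub>U m. C m p i * T m j k + C m p j * T i m k + C m p k * T i j m)"

definition Div2 :: "('n::finite, 'f) partials \<Rightarrow> ('n, 'f) rank3 \<Rightarrow> ('n, 'f) rank2 \<Rightarrow>
    ('n, 'f) rank2 \<Rightarrow> 'n \<Rightarrow> 'f::{comm_ring_1,real_algebra_1}" where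
  "Div2 D C Gi T j = Contr Gi (\<lambda>p q. Cov2 D C T p q j)"

definition Codiff :: "('n::finite, 'f) partials \<Rightarrow> ('n, 'f) rank3 \<Rightarrow> ('n, 'f) rank2 \<Rightarrow>
    ('n, 'f) rank3 \<Rightarrow> 'n \<Rightarrow> 'n \<Rightarrow> 'f::{comm_ring_1,real_algebra_1}" where
  "Codiff D C Gi H i j = - Contr Gi (\<lambda>p k. Cov3 D C H p k i j)"

definition FormSq :: "('n::finite, 'f) rank2 \<Rightarrow> ('n, 'f) rank3 \<Rightarrow>
    'n \<Rightarrow> 'n \<Rightarrow> 'f::{comm_ring_1,real_algebra_1}" where
  "FormSq Gi H i j = Contr Gi (\<lambda>a p. Contr Gi (\<lambda>b q. H i a b * H j p q))"

text \<open>
  The contraction of the last two indices of \<open>H\<close> with \<open>B\<close>. For \<open>B = d\<^sup>*H\<close> it is, up to sign, the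
  part of the divergence of \<open>H\<^sup>2\<close> that is not a gradient.
\<close>

definition FormPair :: "('n::finite, 'f) rank2 \<Rightarrow> ('n, 'f) rank2 \<Rightarrow> ('n, 'f) rank3 \<Rightarrow>
    'n \<Rightarrow> 'f::{comm_ring_1,real_algebra_1}" where
  "FormPair Gi B H j = Contr Gi (\<lambda>a p. Contr Gi (\<lambda>b q. B a b * H j p q))"

definition Ext2 :: "('n::finite, 'f) partials \<Rightarrow> ('n, 'f) rank2 \<Rightarrow>
    'n \<Rightarrow> 'n \<Rightarrow> 'n \<Rightarrow> 'f::{comm_ring_1,real_algebra_1}" where
  "Ext2 D B i j k = D i (B j k) - D j (B i k) + D k (B i j)"

definition Ext3 :: "('n::finite, 'f) partials \<Rightarrow> ('n, 'f) rank3 \<Rightarrow>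
    'n \<Rightarrow> 'n \<Rightarrow> 'n \<Rightarrow> 'n \<Rightarrow> 'f::{comm_ring_1,real_algebra_1}" where
  "Ext3 D H i j k l = D i (H j k l) - D j (H i k l) + D k (H i j l) - D l (H i j k)"

context derivations begin

lemma Chr_sym:
  assumes "\<And>i j. G i j = G j i"
  shows "Chr D G Gi l i j = Chr D G Gi l j i"
  unfolding Chr_def by (simp add: assms[of i j] algebra_simps)

text \<open>
  A torsion-free connection may replace the partial derivatives in an exterior derivative, because
  the Christoffel terms cancel in pairs. In this way the invariance of \<open>d\<close> follows from that of the
  covariant derivative.
\<close>

lemma Ext2_Cov2:
  assumes "\<And>l i j. C l i j = C l j i" and "\<And>i j. B i j = - B j i"
  shows "Ext2 D B i j k = Cov2 D C B i j k - Cov2 D C B j i k + Cov2 D C B k i j"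
proof -
  have "C m i j * B m k + C m i k * B j m - (C m j i * B m k + C m j k * B i m)
      + (C m k i * B m j + C m k j * B i m) = 0" for m
    using assms(1)[of m i j] assms(1)[of m i k] assms(1)[of m j k] assms(2)[of j m]
    by (simp add: algebra_simps)
  then have "(\<Sum>\<^sub>U m. C m i j * B m k + C m i k * B j m) - (\<Sum>\<^sub>U m. C m j i * B m k + C m j k * B i m)
      + (\<Sum>\<^sub>U m. C m k i * B m j + C m k j * B i m) = 0"
    unfolding sum.distrib[symmetric] sum_subtractf[symmetric] by simp
  then show ?thesis unfolding Ext2_def Cov2_def by (simp add: algebra_simps)
qed

lemma Ext3_Cov3:
  assumes "\<And>l i j. C l i j = C l j i"
    and H: "\<And>i j k. H i j k = - H j i k" "\<And>i j k. H i j k = - H i k j"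
  shows "Ext3 D H i j k l = Cov3 D C H i j k l - Cov3 D C H j i k l + Cov3 D C H k i j l - Cov3 D C H l i j k"
proof -
  have "C m i j * H m k l + C m i k * H j m l + C m i l * H j k m
      - (C m j i * H m k l + C m j k * H i m l + C m j l * H i k m)
      + (C m k i * H m j l + C m k j * H i m l + C m k l * H i j m)
      - (C m l i * H m j k + C m l j * H i m k + C m l k * H i j m) = 0" for m
    using assms(1)[of m i j] assms(1)[of m i k] assms(1)[of m j k] assms(1)[of m i l] assms(1)[of m j l]
      assms(1)[of m k l] H(1)[of m j l] H(2)[of i m k] H(2)[of j k m] H(1)[of j m k]
    by (simp add: algebra_simps)
  then have "(\<Sum>\<^sub>U m. C m i j * H m k l + C m i k * H j m l + C m i l * H j k m)
      - (\<Sum>\<^sub>U m. C m j i * H m k l + C m j k * H i m l + C m j l * H i k m)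
      + (\<Sum>\<^sub>U m. C m k i * H m j l + C m k j * H i m l + C m k l * H i j m)
      - (\<Sum>\<^sub>U m. C m l i * H m j k + C m l j * H i m k + C m l k * H i j m) = 0"
    unfolding sum.distrib[symmetric] sum_subtractf[symmetric] by simp
  then show ?thesis unfolding Ext3_def Cov3_def by (simp add: algebra_simps)
qed

end

lemma (in derivations) Codiff_skew:
  assumes "\<And>i j k. H i j k = - H j i k" and "\<And>i j k. H i j k = - H i k j"
  shows "Codiff D C Gi H i j = - Codiff D C Gi H j i"
proof -
  have "Cov3 D C H p k i j = - Cov3 D C H p k j i" for p k
  proof -
    have "D p (H k i j) = - D p (H k j i)" by (subst assms(2)) (simp add: D_minus)
    moreover have "C m p k * H m i j + C m p i * H k m j + C m p j * H k i m
        = - (C m p k * H m j i + C m p j * H k m i + C m p i * H k j m)" for m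
      using assms(2)[of m i j] assms(2)[of k m j] assms(2)[of k i m] by simp
    then have "(\<Sum>\<^sub>U m. C m p k * H m i j + C m p i * H k m j + C m p j * H k i m)
        = - (\<Sum>\<^sub>U m. C m p k * H m j i + C m p j * H k m i + C m p i * H k j m)"
      by (simp only: sum_negf)
    ultimately show ?thesis unfolding Cov3_def by simp
  qed
  then show ?thesis
    unfolding Codiff_def Contr_def by (simp only: mult_minus_right sum_negf)
qed

section \<open>Change of frame\<close>

lemma sum_mult_assoc:
  fixes P :: "'a \<Rightarrow> 'f::comm_ring_1"
  shows "(\<Sum>m\<in>M. (\<Sum>a\<in>A. P a * Q a m) * R m) = (\<Sum>a\<in>A. P a * (\<Sum>m\<in>M. Q a m * R m))"
  unfolding sum_distrib_left sum_distrib_right by (subst sum.swap) (simp add: mult.assoc)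

lemma sum_delta_mult [simp]:
  fixes R :: "'n::finite \<Rightarrow> 'f::comm_ring_1"
  shows "(\<Sum>\<^sub>U m. (if i = m then 1 else 0) * R m) = R i"
    and "(\<Sum>\<^sub>U m. (if m = i then 1 else 0) * R m) = R i"
    and "(\<Sum>\<^sub>U m. R m * (if i = m then 1 else 0)) = R i"
    and "(\<Sum>\<^sub>U m. R m * (if m = i then 1 else 0)) = R i"
  by (simp_all add: if_distrib[of "\<lambda>x. x * _"] if_distrib[of "\<lambda>x. _ * x"] cong: if_cong)

text \<open>
  A change of coordinates \<open>\<psi>\<close> as it acts on functions: \<open>\<theta>\<close> is composition with \<open>\<psi>\<close>, \<open>J\<close> its Jacobian
  matrix and \<open>K\<close> the inverse matrix. Then \<open>D_\<theta>'\<close> is the chain rule and \<open>D_J\<close> the symmetry of the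
  second derivatives of \<open>\<psi>\<close>.
\<close>

locale frame_map = S: derivations D + T: derivations D'
  for D :: "'n::finite \<Rightarrow> 'f::{comm_ring_1,real_algebra_1} \<Rightarrow> 'f"
    and D' :: "'n \<Rightarrow> 'g::{comm_ring_1,real_algebra_1} \<Rightarrow> 'g" +
  fixes \<theta> :: "'g \<Rightarrow> 'f" and J K :: "'n \<Rightarrow> 'n \<Rightarrow> 'f"
  assumes \<theta>_add: "\<theta> (x + y) = \<theta> x + \<theta> y"
    and \<theta>_mult: "\<theta> (x * y) = \<theta> x * \<theta> y"
    and \<theta>_scaleR: "\<theta> (r *\<^sub>R x) = r *\<^sub>R \<theta> x"
    and \<theta>_one: "\<theta> 1 = 1"
    and D_\<theta>': "D i (\<theta> x) = (\<Sum>\<^sub>U a. J a i * \<theta> (D' a x))"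
    and D_J: "D i (J a j) = D j (J a i)"
    and JK: "(\<Sum>\<^sub>U i. J a i * K i b) = (if a = b then 1 else 0)"
    and KJ: "(\<Sum>\<^sub>U a. K i a * J a j) = (if i = j then 1 else 0)"
begin

lemma \<theta>_zero [simp]: "\<theta> 0 = 0"
  using \<theta>_scaleR[of 0 0] by simp

lemma \<theta>_minus: "\<theta> (- x) = - \<theta> x"
  using \<theta>_scaleR[of "-1" x] by simp

lemma \<theta>_diff: "\<theta> (x - y) = \<theta> x - \<theta> y"
  using \<theta>_add[of x "- y"] by (simp add: \<theta>_minus)

lemma \<theta>_sum: "\<theta> (sum f S) = (\<Sum>s\<in>S. \<theta> (f s))"
  by (induction S rule: infinite_finite_induct) (simp_all add: \<theta>_add)

lemmas \<theta>_simps = \<theta>_add \<theta>_mult \<theta>_scaleR \<theta>_minus \<theta>_diff \<theta>_sum \<theta>_one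

text \<open>
  Pull-back in a single covariant slot. Tensors of higher rank are pulled back slot by slot;
  by \<open>pb_swap\<close> the order of the slots is immaterial.
\<close>

definition pb :: "'n \<Rightarrow> ('n \<Rightarrow> 'f) \<Rightarrow> 'f" where
  "pb i S = (\<Sum>\<^sub>U a. J a i * S a)"

lemma pb_add: "pb i S + pb i T = pb i (\<lambda>a. S a + T a)"
  by (simp add: pb_def sum.distrib algebra_simps)

lemma pb_diff: "pb i S - pb i T = pb i (\<lambda>a. S a - T a)"
  by (simp add: pb_def sum_subtractf algebra_simps)

lemma pb_minus: "- pb i S = pb i (\<lambda>a. - S a)"
  by (simp add: pb_def sum_negf)

lemma pb_scaleR: "r *\<^sub>R pb i S = pb i (\<lambda>a. r *\<^sub>R S a)"
  by (simp add: pb_def scaleR_sum_right)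

lemma pb_mult_left: "x * pb i S = pb i (\<lambda>a. x * S a)"
  unfolding pb_def sum_distrib_left by (simp add: mult.left_commute)

lemma pb_mult_right: "pb i S * x = pb i (\<lambda>a. S a * x)"
  unfolding pb_def sum_distrib_right by (simp add: mult.assoc)

lemma pb_sum: "(\<Sum>s\<in>A. pb i (S s)) = pb i (\<lambda>a. \<Sum>s\<in>A. S s a)"
  unfolding pb_def by (subst sum.swap) (simp add: sum_distrib_left)

lemma pb_zero: "pb i (\<lambda>a. 0) = 0"
  by (simp add: pb_def)

lemmas pb_in = pb_add pb_diff pb_minus pb_scaleR pb_mult_left pb_mult_right pb_sum

lemma pb_swap: "pb i (\<lambda>a. pb j (\<lambda>b. S a b)) = pb j (\<lambda>b. pb i (\<lambda>a. S a b))"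
  unfolding pb_def sum_distrib_left by (subst sum.swap) (simp add: algebra_simps)

lemma D_\<theta>: "D i (\<theta> x) = pb i (\<lambda>a. \<theta> (D' a x))"
  by (simp add: D_\<theta>' pb_def)

lemma D_pb: "D p (pb i S) = pb i (\<lambda>a. D p (S a)) + (\<Sum>\<^sub>U a. D p (J a i) * S a)"
  by (simp add: pb_def S.D_simps sum.distrib)

lemma K_pb: "(\<Sum>\<^sub>U i. K i c * pb i S) = S c"
proof -
  have "(\<Sum>\<^sub>U i. K i c * pb i S) = (\<Sum>\<^sub>U i. (\<Sum>\<^sub>U a. S a * J a i) * K i c)"
    by (simp add: pb_def mult.commute)
  then show ?thesis by (simp add: sum_mult_assoc JK)
qed

lemma J_K_sum: "(\<Sum>\<^sub>U l. J c l * (\<Sum>\<^sub>U a. K l a * S a)) = S c"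
  by (simp add: sum_mult_assoc[symmetric] JK)

end

text \<open>
  The metric \<open>G\<close> is the pull-back of \<open>G'\<close>. The lemmas \<open>Hess_map\<close> to \<open>Ext3_map\<close> show that everything
  built from it is a pull-back as well; the Christoffel symbols are one up to the usual
  inhomogeneous term (\<open>Chr_map\<close>).
\<close>

locale metric_map = frame_map D D' \<theta> J K
  for D :: "'n::finite \<Rightarrow> 'f::{comm_ring_1,real_algebra_1} \<Rightarrow> 'f"
    and D' :: "'n \<Rightarrow> 'g::{comm_ring_1,real_algebra_1} \<Rightarrow> 'g"
    and \<theta> J K +
  fixes G Gi :: "'n \<Rightarrow> 'n \<Rightarrow> 'f" and G' Gi' :: "'n \<Rightarrow> 'n \<Rightarrow> 'g"
  assumes G_pb: "G i j = pb i (\<lambda>a. pb j (\<lambda>b. \<theta> (G' a b)))"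
    and G'_sym: "G' a b = G' b a"
    and G_inv: "(\<Sum>\<^sub>U j. G i j * Gi j k) = (if i = k then 1 else 0)"
    and G'_inv: "(\<Sum>\<^sub>U j. Gi' a j * G' j b) = (if a = b then 1 else 0)"
begin

abbreviation "C \<equiv> Chr D G Gi"
abbreviation "C' \<equiv> Chr D' G' Gi'"

lemma Gi_eq: "Gi l m = (\<Sum>\<^sub>U a. K l a * (\<Sum>\<^sub>U b. \<theta> (Gi' a b) * K m b))"
proof -
  define N where "N l m = (\<Sum>\<^sub>U a. K l a * (\<Sum>\<^sub>U b. \<theta> (Gi' a b) * K m b))" for l m
  have G'i: "(\<Sum>\<^sub>U j. \<theta> (Gi' a j) * \<theta> (G' j b)) = (if a = b then 1 else 0)" for a b
    using arg_cong[OF G'_inv[of a b], of \<theta>] by (simp add: \<theta>_simps split: if_splits)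
  have NG: "(\<Sum>\<^sub>U m. N l m * G m k) = (if l = k then 1 else 0)" for l k
  proof -
    have "(\<Sum>\<^sub>U m. N l m * G m k)
        = (\<Sum>\<^sub>U a. K l a * (\<Sum>\<^sub>U b. \<theta> (Gi' a b) * (\<Sum>\<^sub>U m. K m b * G m k)))"
      unfolding N_def sum_mult_assoc ..
    also have "\<dots> = (\<Sum>\<^sub>U a. K l a * (\<Sum>\<^sub>U b. \<theta> (Gi' a b) * pb k (\<lambda>c. \<theta> (G' b c))))"
      unfolding G_pb K_pb ..
    also have "\<dots> = (\<Sum>\<^sub>U a. K l a * J a k)"
      by (simp add: pb_in G'i) (simp add: pb_def mult.commute)
    finally show ?thesis by (simp add: KJ)
  qed
  have "Gi l m = (\<Sum>\<^sub>U k. (\<Sum>\<^sub>U j. N l j * G j k) * Gi k m)"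
    by (simp add: NG)
  also have "\<dots> = N l m"
    by (simp add: sum_mult_assoc G_inv)
  finally show ?thesis by (simp add: N_def)
qed

lemma Gi_pb: "(\<Sum>\<^sub>U m. Gi l m * pb m S) = (\<Sum>\<^sub>U a. K l a * (\<Sum>\<^sub>U b. \<theta> (Gi' a b) * S b))"
  unfolding Gi_eq sum_mult_assoc K_pb ..

lemma Contr_pb: "Contr Gi (\<lambda>i j. pb i (\<lambda>a. pb j (S a))) = Contr (\<lambda>a b. \<theta> (Gi' a b)) S"
proof -
  have "Contr Gi (\<lambda>i j. pb i (\<lambda>a. pb j (S a)))
     = (\<Sum>\<^sub>U i a. K i a * (\<Sum>\<^sub>U b. \<theta> (Gi' a b) * pb i (\<lambda>c. S c b)))"
    unfolding Contr_def by (subst pb_swap) (simp add: Gi_pb)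
  also have "\<dots> = (\<Sum>\<^sub>U a i. K i a * pb i (\<lambda>c. \<Sum>\<^sub>U b. \<theta> (Gi' a b) * S c b))"
    by (subst sum.swap) (simp add: pb_in)
  finally show ?thesis by (simp add: K_pb Contr_def)
qed

lemma Contr_\<theta>: "Contr (\<lambda>a b. \<theta> (Gi' a b)) (\<lambda>a b. \<theta> (S a b)) = \<theta> (Contr Gi' S)"
  by (simp add: Contr_def \<theta>_simps)

lemma Contr_pb_out: "Contr X (\<lambda>a b. pb i (S a b)) = pb i (\<lambda>c. Contr X (\<lambda>a b. S a b c))"
  by (simp add: Contr_def pb_in)

text \<open>
  The product rule applied to the three terms of the Christoffel symbol yields six terms with
  derivatives of \<open>J\<close>. By the symmetry \<open>D_J\<close> four of them cancel (\<open>T11\<close>, \<open>T21\<close>) and the other two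
  agree; they form the inhomogeneous term.
\<close>

lemma Chr_map:
  "(\<Sum>\<^sub>U l. J c l * C l i j) = pb i (\<lambda>a. pb j (\<lambda>b. \<theta> (C' c a b))) + D i (J c j)"
proof -
  define A' where "A' a b e = D' a (G' b e) + D' b (G' a e) - D' e (G' a b)" for a b e
  define T1 where "T1 i j m = pb j (\<lambda>a. \<Sum>\<^sub>U e. D i (J e m) * \<theta> (G' a e))" for i j m
  define T2 where "T2 i j m = (\<Sum>\<^sub>U a. D i (J a j) * pb m (\<lambda>e. \<theta> (G' a e)))" for i j m
  define P where "P i j m = pb j (\<lambda>a. pb m (\<lambda>e. pb i (\<lambda>d. \<theta> (D' d (G' a e)))))" for i j m
  have DG: "D i (G j m) = P i j m + T1 i j m + T2 i j m" for i j m
    unfolding G_pb P_def T1_def T2_def D_pb D_\<theta> by (simp add: pb_add)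
  have T11: "T1 m i j = T1 j i m" for i j m
    by (simp add: T1_def D_J[of m])
  have T21: "T2 m i j = T1 i j m" for i j m
    unfolding T1_def T2_def
    by (simp add: D_J[of m] pb_in) (simp add: G'_sym)
  have PA: "P i j m + P j i m - P m i j = pb m (\<lambda>e. pb i (\<lambda>a. pb j (\<lambda>b. \<theta> (A' a b e))))" for m
    unfolding P_def A'_def
    by (simp add: \<theta>_simps pb_in[symmetric] pb_swap[of _ m] pb_swap[of j i] )
  have A: "D i (G j m) + D j (G i m) - D m (G i j)
     = pb m (\<lambda>e. pb i (\<lambda>a. pb j (\<lambda>b. \<theta> (A' a b e))) + 2 * (\<Sum>\<^sub>U a. D i (J a j) * \<theta> (G' a e)))" for m
  proof -
    have "T2 j i m = T2 i j m" by (simp add: T2_def D_J[of j])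
    then have "D i (G j m) + D j (G i m) - D m (G i j) = P i j m + P j i m - P m i j + 2 * T2 i j m"
      unfolding DG by (simp add: T21 T11 algebra_simps)
    moreover have "2 * T2 i j m = pb m (\<lambda>e. 2 * (\<Sum>\<^sub>U a. D i (J a j) * \<theta> (G' a e)))"
      by (simp add: T2_def pb_in)
    ultimately show ?thesis by (simp only: PA pb_add)
  qed
  have G'i: "(\<Sum>\<^sub>U j. \<theta> (Gi' a j) * \<theta> (G' j b)) = (if a = b then 1 else 0)" for a b
    using arg_cong[OF G'_inv[of a b], of \<theta>] by (simp add: \<theta>_simps split: if_splits)
  have "(\<Sum>\<^sub>U l. J c l * C l i j) = (1/2) *\<^sub>R (\<Sum>\<^sub>U b. \<theta> (Gi' c b) *
     (pb i (\<lambda>a. pb j (\<lambda>d. \<theta> (A' a d b))) + 2 * (\<Sum>\<^sub>U a. D i (J a j) * \<theta> (G' a b))))"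
    unfolding Chr_def A Gi_pb mult_scaleR_right scaleR_sum_right[symmetric] J_K_sum ..
  also have "\<dots> = (1/2) *\<^sub>R (\<Sum>\<^sub>U b. \<theta> (Gi' c b) * pb i (\<lambda>a. pb j (\<lambda>d. \<theta> (A' a d b))))
     + (1/2) *\<^sub>R (2 * (\<Sum>\<^sub>U a. D i (J a j) * (\<Sum>\<^sub>U b. \<theta> (Gi' c b) * \<theta> (G' b a))))"
    unfolding G'_sym[of _ c]
    apply (simp add: distrib_left sum.distrib scaleR_add_right sum_distrib_left)
    apply (subst (2) sum.swap)
    apply (simp add: G'_sym mult.left_commute)
    done
  finally show ?thesis
    by (simp add: G'i Chr_def A'_def \<theta>_simps pb_in)
qed

lemma Chr_contr_pb:
  "(\<Sum>\<^sub>U m. C m p i * pb m S)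
     = pb i (\<lambda>a. pb p (\<lambda>d. \<Sum>\<^sub>U e. \<theta> (C' e d a) * S e)) + (\<Sum>\<^sub>U a. D p (J a i) * S a)"
proof -
  have "(\<Sum>\<^sub>U m. C m p i * pb m S) = (\<Sum>\<^sub>U m. (\<Sum>\<^sub>U a. S a * J a m) * C m p i)"
    by (simp add: pb_def mult.commute)
  also have "\<dots> = (\<Sum>\<^sub>U a. S a * (pb p (\<lambda>d. pb i (\<lambda>b. \<theta> (C' a d b))) + D p (J a i)))"
    by (simp add: sum_mult_assoc Chr_map)
  also have "\<dots> = pb i (\<lambda>a. pb p (\<lambda>d. \<Sum>\<^sub>U e. \<theta> (C' e d a) * S e)) + (\<Sum>\<^sub>U a. D p (J a i) * S a)"
    by (simp add: distrib_left sum.distrib pb_swap[of p i] pb_in) (simp add: mult.commute)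
  finally show ?thesis .
qed

text \<open>
  The derivative of \<open>J\<close> that the product rule produces is the one that the inhomogeneous term of
  \<open>Chr_map\<close> removes. Covariant derivatives of any rank are treated by repeating this in each slot.
\<close>

lemma pb_covariant_slot:
  "D p (pb i S) - (\<Sum>\<^sub>U m. C m p i * pb m S)
     = pb i (\<lambda>a. D p (S a) - pb p (\<lambda>d. \<Sum>\<^sub>U e. \<theta> (C' e d a) * S e))"
  by (simp add: Chr_contr_pb D_pb pb_diff[symmetric])

lemma Hess_map: "Hess D C (\<theta> f) i j = pb i (\<lambda>a. pb j (\<lambda>b. \<theta> (Hess D' C' f a b)))"
  unfolding Hess_def D_\<theta> pb_covariant_slot by (simp add: D_\<theta> \<theta>_simps pb_diff pb_swap[of j i])

lemma pb_covariant_two_slots: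
  "D p (pb j (\<lambda>b. pb k (S b))) - (\<Sum>\<^sub>U m. C m p j * pb m (\<lambda>b. pb k (S b)))
      - (\<Sum>\<^sub>U m. C m p k * pb m (\<lambda>c. pb j (\<lambda>b. S b c)))
   = pb j (\<lambda>b. pb k (\<lambda>c. D p (S b c) - pb p (\<lambda>d. \<Sum>\<^sub>U e. \<theta> (C' e d b) * S e c)
                             - pb p (\<lambda>d. \<Sum>\<^sub>U e. \<theta> (C' e d c) * S b e)))"
proof -
  have "(\<Sum>\<^sub>U m. C m p k * pb m (\<lambda>c. pb j (\<lambda>b. S b c))) = pb j (\<lambda>b. \<Sum>\<^sub>U m. C m p k * pb m (S b))"
    by (simp add: pb_swap[of _ j] pb_mult_left pb_sum)
  moreover have "D p (pb j (\<lambda>b. pb k (S b))) - (\<Sum>\<^sub>U m. C m p j * pb m (\<lambda>b. pb k (S b)))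
      = pb j (\<lambda>b. D p (pb k (S b)) - pb k (\<lambda>c. pb p (\<lambda>d. \<Sum>\<^sub>U e. \<theta> (C' e d b) * S e c)))"
    unfolding pb_covariant_slot by (simp add: pb_in pb_swap[of p k])
  ultimately have "D p (pb j (\<lambda>b. pb k (S b))) - (\<Sum>\<^sub>U m. C m p j * pb m (\<lambda>b. pb k (S b)))
      - (\<Sum>\<^sub>U m. C m p k * pb m (\<lambda>c. pb j (\<lambda>b. S b c)))
    = pb j (\<lambda>b. (D p (pb k (S b)) - (\<Sum>\<^sub>U m. C m p k * pb m (S b)))
           - pb k (\<lambda>c. pb p (\<lambda>d. \<Sum>\<^sub>U e. \<theta> (C' e d b) * S e c)))"
    by (simp add: pb_diff[symmetric])
  then show ?thesis unfolding pb_covariant_slot by (simp add: pb_diff diff_diff_eq add.commute)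
qed

lemma Cov2_map:
  assumes "\<And>i j. T i j = pb i (\<lambda>a. pb j (\<lambda>b. \<theta> (T' a b)))"
  shows "Cov2 D C T p i j = pb p (\<lambda>d. pb i (\<lambda>a. pb j (\<lambda>b. \<theta> (Cov2 D' C' T' d a b))))"
proof -
  have "Cov2 D C T p i j = D p (pb i (\<lambda>a. pb j (\<lambda>b. \<theta> (T' a b))))
     - (\<Sum>\<^sub>U m. C m p i * pb m (\<lambda>a. pb j (\<lambda>b. \<theta> (T' a b))))
     - (\<Sum>\<^sub>U m. C m p j * pb m (\<lambda>b. pb i (\<lambda>a. \<theta> (T' a b))))"
    unfolding Cov2_def assms sum.distrib by (simp add: pb_swap[of i])
  also have "\<dots> = pb i (\<lambda>a. pb j (\<lambda>b. pb p (\<lambda>d. \<theta> (Cov2 D' C' T' d a b))))"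
    unfolding pb_covariant_two_slots by (simp add: D_\<theta> Cov2_def \<theta>_simps pb_diff sum.distrib diff_diff_eq)
  finally show ?thesis by (simp add: pb_swap[of p])
qed

lemma Cov3_map:
  assumes "\<And>i j k. T i j k = pb i (\<lambda>a. pb j (\<lambda>b. pb k (\<lambda>c. \<theta> (T' a b c))))"
  shows "Cov3 D C T p i j k =
     pb p (\<lambda>d. pb i (\<lambda>a. pb j (\<lambda>b. pb k (\<lambda>c. \<theta> (Cov3 D' C' T' d a b c)))))"
proof -
  let ?S = "\<lambda>a b c. \<theta> (T' a b c)"
  note 1 = pb_covariant_slot[of p i "\<lambda>a. pb j (\<lambda>b. pb k (?S a b))"]
  have 2: "(\<Sum>\<^sub>U m. C m p j * pb i (\<lambda>a. pb m (\<lambda>b. pb k (?S a b))))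
      = pb i (\<lambda>a. \<Sum>\<^sub>U m. C m p j * pb m (\<lambda>b. pb k (?S a b)))"
    by (simp only: pb_mult_left[of _ i] pb_sum)
  have 3: "(\<Sum>\<^sub>U m. C m p k * pb i (\<lambda>a. pb j (\<lambda>b. pb m (?S a b))))
      = pb i (\<lambda>a. \<Sum>\<^sub>U m. C m p k * pb m (\<lambda>c. pb j (\<lambda>b. ?S a b c)))"
    unfolding pb_swap[of j] by (simp only: pb_mult_left[of _ i] pb_sum)
  have 4: "pb p (\<lambda>d. \<Sum>\<^sub>U e. \<theta> (C' e d a) * pb j (\<lambda>b. pb k (?S e b)))
      = pb j (\<lambda>b. pb k (\<lambda>c. pb p (\<lambda>d. \<Sum>\<^sub>U e. \<theta> (C' e d a) * ?S e b c)))" for a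
    by (simp only: pb_mult_left pb_sum pb_swap[of p j] pb_swap[of p k])
  have "Cov3 D C T p i j k = (D p (pb i (\<lambda>a. pb j (\<lambda>b. pb k (?S a b))))
     - (\<Sum>\<^sub>U m. C m p i * pb m (\<lambda>a. pb j (\<lambda>b. pb k (?S a b)))))
     - (\<Sum>\<^sub>U m. C m p j * pb i (\<lambda>a. pb m (\<lambda>b. pb k (?S a b))))
     - (\<Sum>\<^sub>U m. C m p k * pb i (\<lambda>a. pb j (\<lambda>b. pb m (?S a b))))"
    unfolding Cov3_def assms sum.distrib by (simp add: diff_diff_eq)
  also have "\<dots> = pb i (\<lambda>a. (D p (pb j (\<lambda>b. pb k (?S a b)))
      - (\<Sum>\<^sub>U m. C m p j * pb m (\<lambda>b. pb k (?S a b)))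
      - (\<Sum>\<^sub>U m. C m p k * pb m (\<lambda>c. pb j (\<lambda>b. ?S a b c))))
      - pb p (\<lambda>d. \<Sum>\<^sub>U e. \<theta> (C' e d a) * pb j (\<lambda>b. pb k (?S e b))))"
    unfolding 1 2 3 pb_diff by (simp add: diff_diff_eq algebra_simps)
  also have "\<dots> = pb i (\<lambda>a. pb j (\<lambda>b. pb k (\<lambda>c. pb p (\<lambda>d. \<theta> (Cov3 D' C' T' d a b c)))))"
    unfolding pb_covariant_two_slots 4 pb_diff by (simp add: D_\<theta> Cov3_def \<theta>_simps pb_diff sum.distrib diff_diff_eq add.commute add.left_commute)
  finally show ?thesis by (simp add: pb_swap[of p])
qed

text \<open>
  Differentiate \<open>Chr_map\<close> and antisymmetrise in \<open>i\<close> and \<open>j\<close>. The second derivatives of \<open>J\<close> and the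
  terms \<open>V\<close> drop out by symmetry; the remaining terms \<open>U\<close> and \<open>W\<close> with first derivatives of \<open>J\<close>
  cancel against those in the quadratic part of the curvature.
\<close>

lemma Riem_map:
  "(\<Sum>\<^sub>U l. J c l * Riem D C i j k l)
     = pb i (\<lambda>a. pb j (\<lambda>b. pb k (\<lambda>e. \<theta> (Riem D' C' a b e c))))"
proof -
  define U where "U i j = pb j (\<lambda>a. \<Sum>\<^sub>U b. D i (J b k) * \<theta> (C' c a b))" for i j
  define V where "V i j = (\<Sum>\<^sub>U a. D i (J a j) * pb k (\<lambda>b. \<theta> (C' c a b)))" for i j
  define W where "W i j = (\<Sum>\<^sub>U l. D i (J c l) * C l j k)" for i j
  define P where "P i j = pb i (\<lambda>a. pb j (\<lambda>b. pb k (\<lambda>e. \<theta> (D' a (C' c b e)))))" for i j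
  define Q where "Q i j = pb i (\<lambda>a. pb j (\<lambda>b. pb k (\<lambda>e. \<theta> (\<Sum>\<^sub>U m. C' c a m * C' m b e))))" for i j
  have X: "(\<Sum>\<^sub>U l. J c l * D i (C l j k)) = P i j + U i j + V i j + D i (D j (J c k)) - W i j" for i j
  proof -
    have "W i j + (\<Sum>\<^sub>U l. J c l * D i (C l j k)) = D i (\<Sum>\<^sub>U l. J c l * C l j k)"
      by (simp add: S.D_simps sum.distrib W_def)
    also have "\<dots> = P i j + U i j + V i j + D i (D j (J c k))"
      unfolding Chr_map S.D_add D_pb D_\<theta> pb_add[symmetric] U_def V_def P_def
      by (simp add: pb_swap[of i])
    finally show ?thesis by (simp add: algebra_simps)
  qed
  have Y: "(\<Sum>\<^sub>U l. J c l * (\<Sum>\<^sub>U m. C l i m * C m j k)) = Q i j + U j i + W i j" for i j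
  proof -
    have "(\<Sum>\<^sub>U l. J c l * (\<Sum>\<^sub>U m. C l i m * C m j k))
       = W i j + pb i (\<lambda>a. \<Sum>\<^sub>U m. C m j k * pb m (\<lambda>b. \<theta> (C' c a b)))"
      unfolding sum_mult_assoc[symmetric] Chr_map distrib_right sum.distrib W_def
      by (simp add: pb_sum[symmetric] pb_mult_left[symmetric] mult.commute)
    also have "\<dots> = Q i j + U j i + W i j"
      unfolding Chr_contr_pb pb_add[symmetric] Q_def U_def
      by (simp add: pb_swap[of k] \<theta>_simps mult.commute)
    finally show ?thesis .
  qed
  have "V i j = V j i" by (simp add: V_def D_J[of i])
  moreover have "(\<Sum>\<^sub>U l. J c l * Riem D C i j k l)
    = (\<Sum>\<^sub>U l. J c l * D i (C l j k)) - (\<Sum>\<^sub>U l. J c l * D j (C l i k))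
      + (\<Sum>\<^sub>U l. J c l * (\<Sum>\<^sub>U m. C l i m * C m j k))
      - (\<Sum>\<^sub>U l. J c l * (\<Sum>\<^sub>U m. C l j m * C m i k))"
    by (simp add: Riem_def algebra_simps sum.distrib sum_subtractf)
  ultimately have "(\<Sum>\<^sub>U l. J c l * Riem D C i j k l) = P i j - P j i + Q i j - Q j i"
    unfolding X Y by (simp add: S.D_commute[of i j])
  then show ?thesis
    by (simp add: P_def Q_def pb_swap[of j i] pb_in Riem_def \<theta>_simps sum_subtractf algebra_simps)
qed

lemma Ric_map: "Ric D C j k = pb j (\<lambda>a. pb k (\<lambda>b. \<theta> (Ric D' C' a b)))"
proof -
  have Riem: "Riem D C i j k l = (\<Sum>\<^sub>U c. K l c * pb i (\<lambda>a. pb j (\<lambda>b. pb k (\<lambda>e. \<theta> (Riem D' C' a b e c)))))"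
    for i l
    unfolding Riem_map[symmetric] by (simp add: sum_mult_assoc[symmetric] KJ)
  have "Ric D C j k = (\<Sum>\<^sub>U c l. K l c * pb l (\<lambda>a. pb j (\<lambda>b. pb k (\<lambda>e. \<theta> (Riem D' C' a b e c)))))"
    unfolding Ric_def Riem by (rule sum.swap)
  then show ?thesis unfolding K_pb by (simp add: pb_in Ric_def \<theta>_simps)
qed

lemma Div2_map:
  assumes "\<And>i j. T i j = pb i (\<lambda>a. pb j (\<lambda>b. \<theta> (T' a b)))"
  shows "Div2 D C Gi T j = pb j (\<lambda>b. \<theta> (Div2 D' C' Gi' T' b))"
  unfolding Div2_def Cov2_map[OF assms] Contr_pb Contr_pb_out Contr_\<theta> ..

lemma Codiff_map:
  assumes "\<And>i j k. H i j k = pb i (\<lambda>a. pb j (\<lambda>b. pb k (\<lambda>c. \<theta> (H' a b c))))"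
  shows "Codiff D C Gi H i j = pb i (\<lambda>a. pb j (\<lambda>b. \<theta> (Codiff D' C' Gi' H' a b)))"
  unfolding Codiff_def Cov3_map[OF assms] Contr_pb Contr_pb_out Contr_\<theta> pb_minus \<theta>_minus ..

lemma FormSq_map:
  assumes H: "\<And>i j k. H i j k = pb i (\<lambda>a. pb j (\<lambda>b. pb k (\<lambda>c. \<theta> (H' a b c))))"
  shows "FormSq Gi H i j = pb i (\<lambda>a. pb j (\<lambda>b. \<theta> (FormSq Gi' H' a b)))"
proof -
  have "H i a b * H j p q = pb b (\<lambda>b'. pb q (\<lambda>q'. pb a (\<lambda>a'. pb p (\<lambda>p'.
     pb i (\<lambda>i'. pb j (\<lambda>j'. \<theta> (H' i' a' b' * H' j' p' q')))))))" for a b p q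
    unfolding H by (simp add: pb_in \<theta>_mult)
      (simp only: mult.commute pb_swap[of q b] pb_swap[of a b] pb_swap[of p b] pb_swap[of i b] pb_swap[of j b]
        pb_swap[of a q] pb_swap[of p q] pb_swap[of i q] pb_swap[of j q] pb_swap[of p a]
        pb_swap[of i a] pb_swap[of j a] pb_swap[of i p] pb_swap[of j p] pb_swap[of j i])
  then show ?thesis
    unfolding FormSq_def
    by (simp add: Contr_pb Contr_pb_out Contr_\<theta>)
qed

lemma FormPair_map:
  assumes B: "\<And>i j. B i j = pb i (\<lambda>a. pb j (\<lambda>b. \<theta> (B' a b)))"
    and H: "\<And>i j k. H i j k = pb i (\<lambda>a. pb j (\<lambda>b. pb k (\<lambda>c. \<theta> (H' a b c))))"
  shows "FormPair Gi B H j = pb j (\<lambda>b. \<theta> (FormPair Gi' B' H' b))"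
proof -
  have "B a b * H j p q = pb b (\<lambda>b'. pb q (\<lambda>q'. pb a (\<lambda>a'. pb p (\<lambda>p'.
     pb j (\<lambda>j'. \<theta> (B' a' b' * H' j' p' q'))))))" for a b p q
    unfolding H B by (simp add: pb_in \<theta>_mult)
      (simp only: mult.commute pb_swap[of q b] pb_swap[of a b] pb_swap[of p b] pb_swap[of j b]
        pb_swap[of a q] pb_swap[of p q] pb_swap[of j q] pb_swap[of p a] pb_swap[of j a] pb_swap[of j p])
  then show ?thesis
    unfolding FormPair_def
    by (simp add: Contr_pb Contr_pb_out Contr_\<theta>)
qed

lemma G_sym: "G i j = G j i"
  unfolding G_pb by (subst pb_swap) (simp add: G'_sym)

lemma skew1_map:
  assumes "\<And>i j k. H i j k = pb i (\<lambda>a. pb j (\<lambda>b. pb k (\<lambda>c. \<theta> (H' a b c))))"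
    and "\<And>a b c. H' a b c = - H' b a c"
  shows "H i j k = - H j i k"
  unfolding assms(1) pb_swap[of j i] pb_minus by (simp only: \<theta>_minus[symmetric] assms(2)[symmetric])

lemma skew2_map:
  assumes "\<And>i j k. H i j k = pb i (\<lambda>a. pb j (\<lambda>b. pb k (\<lambda>c. \<theta> (H' a b c))))"
    and "\<And>a b c. H' a b c = - H' a c b"
  shows "H i j k = - H i k j"
  unfolding assms(1) pb_swap[of k j] pb_minus by (simp only: \<theta>_minus[symmetric] assms(2)[symmetric])

lemma Ext2_map:
  assumes B: "\<And>i j. B i j = pb i (\<lambda>a. pb j (\<lambda>b. \<theta> (B' a b)))"
    and skew': "\<And>a b. B' a b = - B' b a"
  shows "Ext2 D B i j k = pb i (\<lambda>a. pb j (\<lambda>b. pb k (\<lambda>c. \<theta> (Ext2 D' B' a b c))))"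
proof -
  have skew: "B i j = - B j i" for i j
    unfolding B pb_swap[of j i] pb_minus by (simp only: \<theta>_minus[symmetric] skew'[symmetric])
  have e: "Cov2 D' C' B' a b c - Cov2 D' C' B' b a c + Cov2 D' C' B' c a b = Ext2 D' B' a b c" for a b c
    by (rule T.Ext2_Cov2[OF T.Chr_sym[OF G'_sym] skew', symmetric])
  have "Ext2 D B i j k = Cov2 D C B i j k - Cov2 D C B j i k + Cov2 D C B k i j"
    by (rule S.Ext2_Cov2[OF S.Chr_sym[OF G_sym] skew])
  also have "\<dots> = pb i (\<lambda>a. pb j (\<lambda>b. pb k (\<lambda>c.
      \<theta> (Cov2 D' C' B' a b c - Cov2 D' C' B' b a c + Cov2 D' C' B' c a b))))"
    unfolding Cov2_map[OF B] by (simp add: pb_swap[of j i] pb_swap[of k] pb_in \<theta>_simps)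
  finally show ?thesis by (simp only: e)
qed

lemma Ext3_map:
  assumes H: "\<And>i j k. H i j k = pb i (\<lambda>a. pb j (\<lambda>b. pb k (\<lambda>c. \<theta> (H' a b c))))"
    and skew': "\<And>a b c. H' a b c = - H' b a c" "\<And>a b c. H' a b c = - H' a c b"
  shows "Ext3 D H i j k l = pb i (\<lambda>a. pb j (\<lambda>b. pb k (\<lambda>c. pb l (\<lambda>d. \<theta> (Ext3 D' H' a b c d)))))"
proof -
  note skew1 = skew1_map[OF H skew'(1)] and skew2 = skew2_map[OF H skew'(2)]
  have e: "Cov3 D' C' H' a b c d - Cov3 D' C' H' b a c d + Cov3 D' C' H' c a b d - Cov3 D' C' H' d a b c
      = Ext3 D' H' a b c d" for a b c d
    by (rule T.Ext3_Cov3[OF T.Chr_sym[OF G'_sym] skew', symmetric])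
  have "Ext3 D H i j k l = Cov3 D C H i j k l - Cov3 D C H j i k l + Cov3 D C H k i j l - Cov3 D C H l i j k"
    by (rule S.Ext3_Cov3[OF S.Chr_sym[OF G_sym] skew1 skew2])
  also have "\<dots> = pb i (\<lambda>a. pb j (\<lambda>b. pb k (\<lambda>c. pb l (\<lambda>d.
      \<theta> (Cov3 D' C' H' a b c d - Cov3 D' C' H' b a c d + Cov3 D' C' H' c a b d - Cov3 D' C' H' d a b c)))))"
    unfolding Cov3_map[OF H] by (simp add: pb_swap[of j i] pb_swap[of k i] pb_swap[of k j]
      pb_swap[of l i] pb_swap[of l j] pb_swap[of l k] pb_in \<theta>_simps)
  finally show ?thesis by (simp only: e)
qed

end

section \<open>Identities at the centre of normal coordinates\<close>

text \<open>
  The map \<open>ev\<close> evaluates at the centre of a normal coordinate system: there the metric is the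
  identity matrix and its first derivatives vanish. The results are about values at this point.
\<close>

locale normal_point = derivations D
  for D :: "'n::finite \<Rightarrow> 'f::{comm_ring_1,real_algebra_1} \<Rightarrow> 'f" +
  fixes ev :: "'f \<Rightarrow> real" and G Gi :: "'n \<Rightarrow> 'n \<Rightarrow> 'f"
  assumes ev_add: "ev (x + y) = ev x + ev y"
    and ev_mult: "ev (x * y) = ev x * ev y"
    and ev_scaleR: "ev (r *\<^sub>R x) = r * ev x"
    and ev_one: "ev 1 = 1"
    and G_sym: "G i j = G j i"
    and Gi_inv: "(\<Sum>\<^sub>U j. Gi i j * G j k) = (if i = k then 1 else 0)"
    and ev_G: "ev (G i j) = (if i = j then 1 else 0)"
    and ev_DG: "ev (D p (G i j)) = 0"
begin

lemma ev_zero [simp]: "ev 0 = 0"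
  using ev_scaleR[of 0 0] by simp

lemma ev_two: "ev 2 = 2"
  using ev_add[of 1 1] by (simp add: ev_one)

lemma D_two: "D i 2 = 0"
  using D_add[of i 1 1] by simp

lemma ev_minus: "ev (- x) = - ev x"
  using ev_scaleR[of "-1" x] by simp

lemma ev_diff: "ev (x - y) = ev x - ev y"
  using ev_add[of x "- y"] by (simp add: ev_minus)

lemma ev_sum: "ev (sum f S) = (\<Sum>s\<in>S. ev (f s))"
  by (induction S rule: infinite_finite_induct) (simp_all add: ev_add)

lemmas ev_simps = ev_add ev_mult ev_scaleR ev_one ev_minus ev_diff ev_sum

abbreviation "C \<equiv> Chr D G Gi"
abbreviation "Rc \<equiv> Ric D C"
abbreviation "R \<equiv> Contr Gi Rc"

definition g2 where "g2 p q i j = ev (D p (D q (G i j)))"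
definition g3 where "g3 p q r i j = ev (D p (D q (D r (G i j))))"

lemma g2_sym: "g2 p q i j = g2 p q j i" "g2 p q i j = g2 q p i j"
  unfolding g2_def by (simp_all add: G_sym[of i j] D_commute[of p q])

lemma g3_sym: "g3 p q r i j = g3 p q r j i" "g3 p q r i j = g3 q p r i j" "g3 p q r i j = g3 p r q i j"
  unfolding g3_def
    apply (simp add: G_sym[of i j])
   apply (simp add: D_commute[of p q])
  apply (simp add: D_commute[of q r])
  done

lemma ev_Gi: "ev (Gi i j) = (if i = j then 1 else 0)"
  using arg_cong[OF Gi_inv[of i j], of ev] by (simp add: ev_simps ev_G split: if_splits)

text \<open>
  The derivation is arbitrary because the time derivative is needed too.
\<close>

lemma ev_derivation_Gi:
  assumes add: "\<And>x y. E (x + y) = E x + E y" and mult: "\<And>x y. E (x * y) = E x * y + x * E y"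
  shows "ev (E (Gi i j)) = - ev (E (G i j))"
proof -
  have E0: "E 0 = 0" using add[of 0 0] by simp
  have E1: "E 1 = 0" using mult[of 1 1] by simp
  have Esum: "E (sum f S) = (\<Sum>s\<in>S. E (f s))" for f :: "'n \<Rightarrow> 'f" and S
    by (induction S rule: infinite_finite_induct) (simp_all add: add E0)
  have "E (\<Sum>\<^sub>U k. Gi i k * G k j) = 0" unfolding Gi_inv by (simp add: E0 E1)
  then have "ev (\<Sum>\<^sub>U k. E (Gi i k) * G k j + Gi i k * E (G k j)) = 0"
    by (simp add: Esum mult)
  then show ?thesis by (simp add: ev_simps ev_G ev_Gi sum.distrib)
qed

lemma ev_DGi: "ev (D p (Gi i j)) = 0"
  using ev_derivation_Gi[of "D p" i j] by (simp add: D_add D_mult ev_DG)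

lemma ev_DDGi: "ev (D q (D p (Gi i j))) = - g2 q p i j"
proof -
  have "D q (D p (\<Sum>\<^sub>U k. Gi i k * G k j)) = 0" unfolding Gi_inv by simp
  then have "ev (\<Sum>\<^sub>U k. D q (D p (Gi i k)) * G k j + D p (Gi i k) * D q (G k j)
      + (D q (Gi i k) * D p (G k j) + Gi i k * D q (D p (G k j)))) = 0"
    by (simp add: D_simps)
  then show ?thesis by (simp add: ev_simps ev_G ev_Gi ev_DG ev_DGi sum.distrib g2_def)
qed

lemmas ev_normal = ev_G ev_Gi ev_DG ev_DGi ev_DDGi

lemma ev_Contr: "ev (Contr Gi T) = (\<Sum>\<^sub>U i. ev (T i i))"
  by (simp add: Contr_def ev_simps ev_normal)

lemma ev_D_Contr: "ev (D p (Contr Gi T)) = (\<Sum>\<^sub>U i. ev (D p (T i i)))"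
  by (simp add: Contr_def D_simps ev_simps ev_normal)

text \<open>
  The second derivatives of the inverse metric do not vanish at the centre; this is how curvature
  enters the Laplacian of a trace.
\<close>

lemma ev_DD_Contr: "ev (D q (D p (Contr Gi T)))
    = (\<Sum>\<^sub>U i. ev (D q (D p (T i i)))) - (\<Sum>\<^sub>U i j. g2 q p i j * ev (T i j))"
  by (simp add: Contr_def D_simps ev_simps ev_normal sum.distrib sum_negf)

lemma ev_C: "ev (C l i j) = 0"
  by (simp add: Chr_def ev_simps ev_normal)

lemma ev_DC: "ev (D p (C l i j)) = (g2 p i j l + g2 p j i l - g2 p l i j) / 2"
  by (simp add: Chr_def D_simps ev_simps ev_normal sum.distrib g2_def)

lemma ev_DDC: "ev (D q (D p (C l i j))) = (g3 q p i j l + g3 q p j i l - g3 q p l i j) / 2"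
  by (simp add: Chr_def D_simps ev_simps ev_normal sum.distrib g3_def)

lemma ev_Rc: "ev (Rc j k) = (\<Sum>\<^sub>U l. ev (D l (C l j k)) - ev (D j (C l l k)))"
  by (simp add: Ric_def Riem_def ev_simps ev_C)

lemma ev_D_Rc: "ev (D p (Rc j k)) = (\<Sum>\<^sub>U l. ev (D p (D l (C l j k))) - ev (D p (D j (C l l k))))"
  by (simp add: Ric_def Riem_def D_simps ev_simps ev_C)

lemma ev_Hess: "ev (Hess D C f i j) = ev (D i (D j f))"
  by (simp add: Hess_def ev_simps ev_C)

lemma ev_Div2: "ev (Div2 D C Gi T j) = (\<Sum>\<^sub>U p. ev (D p (T p j)))"
  by (simp add: Div2_def ev_Contr Cov2_def ev_simps ev_C)

lemma ev_D_Div2: "ev (D q (Div2 D C Gi T j)) = (\<Sum>\<^sub>U p. ev (D q (D p (T p j)))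
    - (\<Sum>\<^sub>U m. ev (D q (C m p p)) * ev (T m j) + ev (D q (C m p j)) * ev (T p m)))"
  by (simp add: Div2_def ev_D_Contr Cov2_def D_simps ev_simps ev_C)

lemma ev_Codiff: "ev (Codiff D C Gi H i j) = - (\<Sum>\<^sub>U p. ev (D p (H p i j)))"
  by (simp add: Codiff_def ev_Contr Cov3_def ev_simps ev_C)

text \<open>
  At the centre both sides are linear in the third derivatives of the metric, and the identity is a
  comparison of double sums.
\<close>

theorem contracted_Bianchi_normal: "ev (Div2 D C Gi Rc j) = ev (D j R) / 2"
proof -
  have Rc: "ev (D p (Rc j k))
     = (\<Sum>\<^sub>U l. g3 p l j k l + g3 p l k j l - g3 p l l j k - g3 p j k l l) / 2" for p j k
    unfolding ev_D_Rc ev_DDC sum_divide_distrib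
    by (rule sum.cong[OF refl]) (simp add: g3_sym(1)[of _ _ _ _ k] diff_divide_distrib add_divide_distrib)
  have "(\<Sum>\<^sub>U p l. g3 p l p j l) = (\<Sum>\<^sub>U p l. g3 p l l p j)"
    by (subst sum.swap) (metis (no_types, lifting) g3_sym sum.cong)
  moreover have "(\<Sum>\<^sub>U p l. g3 p l j p l) = (\<Sum>\<^sub>U p l. g3 j l p p l)"
    by (metis (no_types, lifting) g3_sym sum.cong)
  moreover have "(\<Sum>\<^sub>U p l. g3 p p j l l) = (\<Sum>\<^sub>U p l. g3 j p p l l)"
    by (metis (no_types, lifting) g3_sym sum.cong)
  moreover have "(\<Sum>\<^sub>U p l. g3 j l l p p) = (\<Sum>\<^sub>U p l. g3 j p p l l)"
    by (rule sum.swap)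
  ultimately show ?thesis
    unfolding ev_Div2 ev_D_Contr Rc sum_divide_distrib[symmetric]
    by (simp add: sum.distrib sum_subtractf sum_distrib_left[symmetric] sum_divide_distrib[symmetric] field_simps)
qed

end

locale normal_three_form = normal_point +
  fixes H :: "'a \<Rightarrow> 'a \<Rightarrow> 'a \<Rightarrow> 'b"
  assumes H_skew1: "H i j k = - H j i k" and H_skew2: "H i j k = - H i k j"
    and H_closed: "Ext3 D H i j k l = 0"
begin

abbreviation "S \<equiv> FormSq Gi H"
abbreviation "N \<equiv> Contr Gi S"
abbreviation "B \<equiv> Codiff D C Gi H"
abbreviation "W \<equiv> FormPair Gi B H"

lemma ev_S: "ev (S i j) = (\<Sum>\<^sub>U a b. ev (H i a b) * ev (H j a b))"
  by (simp add: FormSq_def ev_Contr ev_simps)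

lemma ev_D_S: "ev (D p (S i j)) = (\<Sum>\<^sub>U a b. ev (D p (H i a b)) * ev (H j a b) + ev (H i a b) * ev (D p (H j a b)))"
  by (simp add: FormSq_def ev_D_Contr D_simps ev_simps)

lemma ev_W: "ev (W j) = (\<Sum>\<^sub>U a b. ev (B a b) * ev (H j a b))"
  by (simp add: FormPair_def ev_Contr ev_simps)

lemma ev_D_W: "ev (D p (W j)) = (\<Sum>\<^sub>U a b. ev (D p (B a b)) * ev (H j a b) + ev (B a b) * ev (D p (H j a b)))"
  by (simp add: FormPair_def ev_D_Contr D_simps ev_simps)

text \<open>
  Contracting $dH = 0$ with $H$ gives $3 H^{iab} \nabla_i H_{jab} = H^{iab} \nabla_j H_{iab}$, which is
  \<open>3 * X = Y\<close> in the proof. As \<open>Y\<close> is half the derivative of $|H|^2$, the coefficient is $1/6$.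
\<close>

theorem Div_FormSq_normal: "ev (Div2 D C Gi S j) = - ev (W j) + ev (D j N) / 6"
proof -
  let ?h = "\<lambda>i a b. ev (H i a b)" and ?d = "\<lambda>p i a b. ev (D p (H i a b))"
  have h1: "?h i j k = - ?h j i k" and h2: "?h i j k = - ?h i k j" for i j k
    using H_skew1[of i j k] H_skew2[of i j k] by (simp_all add: ev_minus)
  have d1: "?d p i j k = - ?d p j i k" and d2: "?d p i j k = - ?d p i k j" for p i j k
    using H_skew1[of i j k] H_skew2[of i j k] by (simp_all add: ev_minus D_minus)
  define X where "X = (\<Sum>\<^sub>U i a b. ?h i a b * ?d i j a b)"
  define Y where "Y = (\<Sum>\<^sub>U i a b. ?h i a b * ?d j i a b)"
  have "ev (Ext3 D H i j a b) = 0" for i a b by (simp add: H_closed)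
  then have "(\<Sum>\<^sub>U i a b. ?h i a b * (?d i j a b - ?d j i a b + ?d a i j b - ?d b i j a)) = 0"
    by (simp add: Ext3_def ev_simps)
  moreover have "(\<Sum>\<^sub>U i a b. ?h i a b * ?d a i j b) = X"
  proof -
    have "(\<Sum>\<^sub>U i a b. ?h i a b * ?d a i j b)
      = (\<Sum>\<^sub>U a i b. ?h i a b * ?d a i j b)"
      by (rule sum.swap)
    also have "\<dots> = X"
      unfolding X_def
      apply (intro sum.cong refl)
      subgoal for a i b using h1[of a i b] d1[of a i j b] by simp
      done
    finally show ?thesis .
  qed
  moreover have "(\<Sum>\<^sub>U i a b. ?h i a b * ?d b i j a) = - X"
  proof -
    have "(\<Sum>\<^sub>U i a b. ?h i a b * ?d b i j a)
      = (\<Sum>\<^sub>U i b a. ?h i a b * ?d b i j a)"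
      by (intro sum.cong refl sum.swap)
    also have "\<dots> = (\<Sum>\<^sub>U b i a. ?h i a b * ?d b i j a)"
      by (rule sum.swap)
    also have "\<dots> = - X"
      unfolding X_def sum_negf[symmetric]
      apply (intro sum.cong refl)
      subgoal for b i a using h2[of i a b] h1[of i b a] d1[of b i j a] by simp
      done
    finally show ?thesis .
  qed
  ultimately have "3 * X = Y"
    by (simp add: X_def[symmetric] Y_def[symmetric] sum.distrib sum_subtractf algebra_simps)
  moreover have "ev (D j N) = 2 * Y"
    unfolding ev_D_Contr ev_D_S Y_def sum_distrib_left by (intro sum.cong refl) simp
  moreover have "ev (Div2 D C Gi S j) = X - ev (W j)"
  proof -
    have "ev (W j) = - (\<Sum>\<^sub>U a b p. ?d p p a b * ?h j a b)"
      unfolding ev_W ev_Codiff by (simp add: sum_distrib_right sum_negf)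
    also have "(\<Sum>\<^sub>U a b p. ?d p p a b * ?h j a b)
        = (\<Sum>\<^sub>U p a b. ?d p p a b * ?h j a b)"
      by (subst (2) sum.swap) (intro sum.cong refl sum.swap)
    finally show ?thesis
      unfolding ev_Div2 ev_D_S X_def by (simp add: sum.distrib)
  qed
  ultimately show ?thesis by simp
qed

end

section \<open>The evolution of the generalized scalar curvature\<close>

text \<open>
  The flow in normal coordinates. The assumptions \<open>Bianchi\<close> and \<open>Div_S\<close> are equations in the ring,
  not only at the centre, because the computation differentiates them.
\<close>

locale normal_flow = normal_three_form D ev G Gi H
  for D :: "'n::finite \<Rightarrow> 'f::{comm_ring_1,real_algebra_1} \<Rightarrow> 'f"
    and ev :: "'f \<Rightarrow> real" and G Gi H +
  fixes Dt :: "'f \<Rightarrow> 'f" and f :: 'f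
  assumes Dt_add: "Dt (x + y) = Dt x + Dt y"
    and Dt_mult: "Dt (x * y) = Dt x * y + x * Dt y"
    and Dt_scaleR: "Dt (r *\<^sub>R x) = r *\<^sub>R Dt x"
    and Dt_D: "Dt (D i x) = D i (Dt x)"
    and Dt_G: "Dt (G i j) = (- 2) *\<^sub>R Rc i j + (1/2) *\<^sub>R S i j"
    and Dt_H: "Dt (H i j k) = - Ext2 D B i j k"
    and Dt_f: "Dt f = Contr Gi (Hess D C f) + (1/6) *\<^sub>R N"
    and Bianchi: "Div2 D C Gi Rc j = (1/2) *\<^sub>R D j R"
    and Div_S: "Div2 D C Gi S j = - W j + (1/6) *\<^sub>R D j N"
begin

lemma Dt_zero [simp]: "Dt 0 = 0"
  using Dt_scaleR[of 0 0] by simp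

lemma Dt_minus: "Dt (- x) = - Dt x"
  using Dt_scaleR[of "-1" x] by simp

lemma Dt_diff: "Dt (x - y) = Dt x - Dt y"
  using Dt_add[of x "- y"] by (simp add: Dt_minus)

lemma Dt_sum: "Dt (sum F A) = (\<Sum>s\<in>A. Dt (F s))"
  by (induction A rule: infinite_finite_induct) (simp_all add: Dt_add)

lemmas Dt_simps = Dt_add Dt_mult Dt_scaleR Dt_minus Dt_diff Dt_sum Dt_D

definition h where "h i j = Dt (G i j)"

lemma h_sym: "h i j = h j i"
  unfolding h_def by (simp add: G_sym[of i j])

lemma ev_Dt_Gi: "ev (Dt (Gi i j)) = - ev (h i j)"
  unfolding h_def by (rule ev_derivation_Gi[OF Dt_add Dt_mult])

lemma ev_Dt_Contr: "ev (Dt (Contr Gi T))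
    = (\<Sum>\<^sub>U i. ev (Dt (T i i))) - (\<Sum>\<^sub>U i j. ev (h i j) * ev (T i j))"
  by (simp add: Contr_def Dt_simps ev_simps ev_normal ev_Dt_Gi sum.distrib sum_negf)

lemma ev_Dt_C: "ev (Dt (C l i j)) = (ev (D i (h j l)) + ev (D j (h i l)) - ev (D l (h i j))) / 2"
  by (simp add: Chr_def Dt_simps ev_simps ev_normal h_def[symmetric])

lemma ev_D_Dt_C: "ev (D p (Dt (C l i j))) =
    (ev (D p (D i (h j l))) + ev (D p (D j (h i l))) - ev (D p (D l (h i j)))) / 2
     - (\<Sum>\<^sub>U m. ev (h l m) * ev (D p (C m i j)))"
  by (simp add: Chr_def Dt_simps D_simps ev_simps ev_normal ev_Dt_Gi h_def[symmetric] g2_def[symmetric]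
      sum.distrib sum_subtractf sum_negf sum_distrib_left sum_divide_distrib field_simps)
     (simp add: add_divide_distrib diff_divide_distrib sum.distrib sum_subtractf)

lemma ev_Dt_Rc: "ev (Dt (Rc j k))
    = (\<Sum>\<^sub>U l. ev (D l (Dt (C l j k))) - ev (D j (Dt (C l l k))))"
  by (simp add: Ric_def Riem_def Dt_simps ev_simps ev_C)

text \<open>
  The classical formula $\partial_t R = \mathrm{div}\,\mathrm{div}\,h - \Delta\,\mathrm{tr}\,h - \langle h, \mathrm{Rc}\rangle$
  for the velocity $h$ of the metric. At the centre the second derivatives of \<open>h\<close> match directly;
  what is left pairs \<open>h\<close> with first derivatives of Christoffel symbols and with second derivatives of
  the metric, and these agree by the symmetry of \<open>h\<close> (fact \<open>3\<close>).
\<close>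

lemma first_variation_R:
  "ev (Dt R) = (\<Sum>\<^sub>U i. ev (D i (Div2 D C Gi h i))) - (\<Sum>\<^sub>U i. ev (D i (D i (Contr Gi h))))
     - (\<Sum>\<^sub>U i j. ev (h i j) * ev (Rc i j))"
proof -
  define a where "a i j = ev (h i j)" for i j
  define hh where "hh p q i j = ev (D p (D q (h i j)))" for p q i j
  define c where "c p m i j = ev (D p (C m i j))" for p m i j
  have a: "a i j = a j i" for i j unfolding a_def by (simp add: h_sym[of i j])
  have hh: "hh p q i j = hh p q j i" "hh p q i j = hh q p i j" for p q i j
    unfolding hh_def by (simp_all add: h_sym[of i j] D_commute[of p q])
  have "(\<Sum>\<^sub>U k. ev (Dt (Rc k k))) = (\<Sum>\<^sub>U k l. hh l k l k - hh l l k k / 2 - hh k k l l / 2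
      - (\<Sum>\<^sub>U m. a l m * c l m k k) + (\<Sum>\<^sub>U m. a l m * c k m l k))"
    unfolding ev_Dt_Rc ev_D_Dt_C hh_def[symmetric] a_def[symmetric] c_def[symmetric]
    apply (intro sum.cong refl)
    subgoal for k l using hh(1)[of l k k l] hh(1)[of k l k l] hh(2)[of k l k l] by (simp add: field_simps)
    done
  also have "\<dots> = (\<Sum>\<^sub>U k l. hh l k l k) - (\<Sum>\<^sub>U k l. hh l l k k) / 2
      - (\<Sum>\<^sub>U k l. hh k k l l) / 2
      - (\<Sum>\<^sub>U k l m. a l m * c l m k k) + (\<Sum>\<^sub>U k l m. a l m * c k m l k)"
    by (simp add: sum.distrib sum_subtractf sum_divide_distrib)
  also have "(\<Sum>\<^sub>U k l. hh l l k k) = (\<Sum>\<^sub>U k l. hh k k l l)"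
    by (rule sum.swap)
  finally have 1: "(\<Sum>\<^sub>U k. ev (Dt (Rc k k))) = (\<Sum>\<^sub>U k l. hh l k l k)
      - (\<Sum>\<^sub>U k l. hh k k l l)
      - (\<Sum>\<^sub>U k l m. a l m * c l m k k) + (\<Sum>\<^sub>U k l m. a l m * c k m l k)"
    by simp
  have 2: "(\<Sum>\<^sub>U i. ev (D i (Div2 D C Gi h i))) = (\<Sum>\<^sub>U k l. hh l k l k)
      - (\<Sum>\<^sub>U k l m. a l m * c l m k k) - (\<Sum>\<^sub>U k l m. a l m * c k m l k)"
  proof -
    have "(\<Sum>\<^sub>U i. ev (D i (Div2 D C Gi h i))) = (\<Sum>\<^sub>U i p. hh i p p i)
      - (\<Sum>\<^sub>U i p m. c i m p p * a m i) - (\<Sum>\<^sub>U i p m. c i m p i * a p m)"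
      unfolding ev_D_Div2 hh_def[symmetric] a_def[symmetric] c_def[symmetric]
      by (simp add: sum.distrib sum_subtractf)
    moreover have "(\<Sum>\<^sub>U i p. hh i p p i) = (\<Sum>\<^sub>U k l. hh l k l k)"
      by (subst sum.swap) (simp add: hh(1))
    moreover have "(\<Sum>\<^sub>U i p m. c i m p p * a m i) = (\<Sum>\<^sub>U k l m. a l m * c l m k k)"
      by (subst sum.swap) (simp add: a mult.commute)
    moreover have "(\<Sum>\<^sub>U i p m. c i m p i * a p m) = (\<Sum>\<^sub>U k l m. a l m * c k m l k)"
      by (simp add: mult.commute)
    ultimately show ?thesis by simp
  qed
  have 3: "2 * (\<Sum>\<^sub>U k l m. a l m * c k m l k)
      = (\<Sum>\<^sub>U k l m. g2 k k l m * a l m)"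
  proof -
    have "(\<Sum>\<^sub>U l m. a l m * g2 k l k m) = (\<Sum>\<^sub>U l m. a l m * g2 k m l k)" for k
      by (subst sum.swap) (simp add: a g2_sym(1))
    moreover have "2 * (a l m * c k m l k) = a l m * g2 k l k m + g2 k k l m * a l m - a l m * g2 k m l k" for k l m
      unfolding c_def ev_DC by (simp add: field_simps)
    ultimately show ?thesis by (simp add: sum_distrib_left sum.distrib sum_subtractf)
  qed
  have 4: "(\<Sum>\<^sub>U i. ev (D i (D i (Contr Gi h)))) = (\<Sum>\<^sub>U k l. hh k k l l)
      - (\<Sum>\<^sub>U k l m. g2 k k l m * a l m)"
    unfolding ev_DD_Contr by (simp add: sum_subtractf hh_def a_def)
  show ?thesis
    unfolding ev_Dt_Contr 1 2 4 3[symmetric] by simp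
qed

lemma Div2_h: "Div2 D C Gi h j = - D j R - (1/2) *\<^sub>R W j + (1/12) *\<^sub>R D j N"
proof -
  have "Div2 D C Gi h j = (-2) *\<^sub>R Div2 D C Gi Rc j + (1/2) *\<^sub>R Div2 D C Gi S j"
    unfolding h_def Dt_G Div2_def Contr_def Cov2_def
    by (simp add: D_simps algebra_simps sum.distrib sum_subtractf scaleR_sum_right sum_distrib_left sum_negf)
  then show ?thesis by (simp add: Bianchi Div_S algebra_simps)
qed

lemma Contr_h: "Contr Gi h = (-2) *\<^sub>R R + (1/2) *\<^sub>R N"
  unfolding h_def Dt_G Contr_def
  by (simp add: algebra_simps sum.distrib sum_subtractf scaleR_sum_right sum_distrib_left sum_negf)

text \<open>
  Values at the centre: the Laplacian of a function, the pairing of the covariant derivative of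
  $d^*H$ with $H$, and the inner product of two tensors of rank two.
\<close>

definition "Lapl x = (\<Sum>\<^sub>U i. ev (D i (D i x)))"
definition "DB_H = (\<Sum>\<^sub>U i a b. ev (D i (B a b)) * ev (H i a b))"
definition "inner2 T U = (\<Sum>\<^sub>U i j. ev (T i j) * ev (U i j))"

lemma inner2_h: "inner2 h T = - 2 * inner2 Rc T + inner2 S T / 2"
  unfolding inner2_def h_def Dt_G
  by (simp add: ev_simps algebra_simps sum.distrib sum_subtractf sum_distrib_left sum_divide_distrib sum_negf)

lemma Lapl_simps: "Lapl (x + y) = Lapl x + Lapl y" "Lapl (x - y) = Lapl x - Lapl y"
  "Lapl (r *\<^sub>R x) = r * Lapl x" "Lapl (- x) = - Lapl x"
  unfolding Lapl_def by (simp_all add: D_simps ev_simps sum.distrib sum_subtractf sum_distrib_left sum_negf)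

lemma Div_W: "(\<Sum>\<^sub>U i. ev (D i (W i))) = DB_H - inner2 B B"
proof -
  have "(\<Sum>\<^sub>U i. ev (D i (W i))) = DB_H + (\<Sum>\<^sub>U i a b. ev (B a b) * ev (D i (H i a b)))"
    unfolding ev_D_W DB_H_def by (simp add: sum.distrib)
  also have "(\<Sum>\<^sub>U i a b. ev (B a b) * ev (D i (H i a b)))
      = (\<Sum>\<^sub>U a i b. ev (B a b) * ev (D i (H i a b)))"
    by (rule sum.swap)
  also have "\<dots> = (\<Sum>\<^sub>U a b i. ev (B a b) * ev (D i (H i a b)))"
    by (intro sum.cong refl sum.swap)
  also have "\<dots> = - inner2 B B"
    unfolding inner2_def by (simp add: sum_distrib_left[symmetric] ev_Codiff sum_negf)
  finally show ?thesis by simp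
qed

lemma ev_Dt_R: "ev (Dt R) = Lapl R + 2 * inner2 Rc Rc - inner2 S Rc / 2 - (DB_H - inner2 B B) / 2 - 5/12 * Lapl N"
proof -
  have "ev (Dt R) = (\<Sum>\<^sub>U i. ev (D i (Div2 D C Gi h i))) - Lapl (Contr Gi h) - inner2 h Rc"
    unfolding first_variation_R Lapl_def inner2_def ..
  also have "(\<Sum>\<^sub>U i. ev (D i (Div2 D C Gi h i))) = - Lapl R - (DB_H - inner2 B B) / 2 + Lapl N / 12"
    unfolding Div2_h Div_W[symmetric] Lapl_def
    by (simp add: D_simps ev_simps sum.distrib sum_subtractf sum_negf sum_divide_distrib)
  finally show ?thesis unfolding Contr_h inner2_h Lapl_simps by simp
qed

text \<open>
  The three inverse metrics in $|H|^2$ contribute equally, and so do the three terms of the exterior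
  derivative of $d^*H$, both by the skew-symmetry of $H$.
\<close>

lemma ev_Dt_N: "ev (Dt N) = - 6 * DB_H - 3 * inner2 h S"
proof -
  let ?H = "\<lambda>i a b. ev (H i a b)"
  let ?d = "\<lambda>i a b. ev (D i (B a b))"
  have h1: "?H i j k = - ?H j i k" and h2: "?H i j k = - ?H i k j" for i j k
    using H_skew1[of i j k] H_skew2[of i j k] by (simp_all add: ev_minus)
  have S': "inner2 h S = (\<Sum>\<^sub>U i j a b. ev (h i j) * ?H i a b * ?H j a b)"
    unfolding inner2_def ev_S by (simp add: sum_distrib_left mult.assoc)
  have DtS: "ev (Dt (S i i)) = (\<Sum>\<^sub>U a b. 2 * ?H i a b * ev (Dt (H i a b)))
     - (\<Sum>\<^sub>U a b q. ev (h b q) * (?H i a b * ?H i a q))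
     - (\<Sum>\<^sub>U a p. ev (h a p) * (\<Sum>\<^sub>U b. ?H i a b * ?H i p b))" for i
    unfolding FormSq_def ev_Dt_Contr by (simp add: ev_Contr ev_Dt_Contr Dt_simps ev_simps sum_subtractf mult.commute mult.left_commute ev_two)
  have A1: "(\<Sum>\<^sub>U i a p. ev (h a p) * (\<Sum>\<^sub>U b. ?H i a b * ?H i p b)) = inner2 h S"
  proof -
    have "(\<Sum>\<^sub>U i a p. ev (h a p) * (\<Sum>\<^sub>U b. ?H i a b * ?H i p b))
       = (\<Sum>\<^sub>U i a p b. ev (h a p) * ?H a i b * ?H p i b)"
      unfolding sum_distrib_left
      apply (intro sum.cong refl)
      subgoal for i a p b using h1[of i a b] h1[of i p b] by simp
      done
    also have "\<dots> = (\<Sum>\<^sub>U a i p b. ev (h a p) * ?H a i b * ?H p i b)"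
      by (rule sum.swap)
    also have "\<dots> = (\<Sum>\<^sub>U a p i b. ev (h a p) * ?H a i b * ?H p i b)"
      by (intro sum.cong refl sum.swap)
    finally show ?thesis unfolding S' .
  qed
  have A2: "(\<Sum>\<^sub>U i a b q. ev (h b q) * (?H i a b * ?H i a q)) = inner2 h S"
  proof -
    have "(\<Sum>\<^sub>U i a b q. ev (h b q) * (?H i a b * ?H i a q))
       = (\<Sum>\<^sub>U i b a q. ev (h b q) * (?H i a b * ?H i a q))"
      by (intro sum.cong refl sum.swap)
    also have "\<dots> = (\<Sum>\<^sub>U i b q a. ev (h b q) * (?H i b a * ?H i q a))"
    proof (rule sum.cong[OF refl], rule sum.cong[OF refl])
      fix i b
      have "(\<Sum>\<^sub>U a q. ev (h b q) * (?H i a b * ?H i a q))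
          = (\<Sum>\<^sub>U q a. ev (h b q) * (?H i a b * ?H i a q))"
        by (rule sum.swap)
      moreover have "?H i a b * ?H i a q = ?H i b a * ?H i q a" for a q
        using h2[of i a b] h2[of i a q] by simp
      ultimately show "(\<Sum>\<^sub>U a q. ev (h b q) * (?H i a b * ?H i a q))
          = (\<Sum>\<^sub>U q a. ev (h b q) * (?H i b a * ?H i q a))" by simp
    qed
    finally show ?thesis by (simp add: A1[symmetric] sum_distrib_left)
  qed
  have A3: "(\<Sum>\<^sub>U i a b. 2 * ?H i a b * ev (Dt (H i a b))) = - 6 * DB_H"
  proof -
    have "(\<Sum>\<^sub>U i a b. 2 * ?H i a b * ev (Dt (H i a b)))
      = - 2 * (DB_H - (\<Sum>\<^sub>U i a b. ?d a i b * ?H i a b)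
         + (\<Sum>\<^sub>U i a b. ?d b i a * ?H i a b))"
      unfolding Dt_H Ext2_def DB_H_def sum_distrib_left sum.distrib[symmetric] sum_subtractf[symmetric]
      by (intro sum.cong refl) (simp add: ev_simps algebra_simps)
    also have "(\<Sum>\<^sub>U i a b. ?d a i b * ?H i a b)
        = (\<Sum>\<^sub>U a i b. ?d a i b * ?H i a b)"
      by (rule sum.swap)
    also have "\<dots> = - DB_H"
      unfolding DB_H_def sum_negf[symmetric]
      apply (intro sum.cong refl)
      subgoal for a i b using h1[of i a b] by simp
      done
    also have "(\<Sum>\<^sub>U i a b. ?d b i a * ?H i a b)
        = (\<Sum>\<^sub>U i b a. ?d b i a * ?H i a b)"
      by (intro sum.cong refl sum.swap)
    also have "\<dots> = (\<Sum>\<^sub>U b i a. ?d b i a * ?H i a b)"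
      by (rule sum.swap)
    also have "\<dots> = DB_H"
      unfolding DB_H_def
      apply (intro sum.cong refl)
      subgoal for b i a using h2[of i a b] h1[of i b a] by simp
      done
    finally show ?thesis by simp
  qed
  have "ev (Dt N) = (\<Sum>\<^sub>U i. ev (Dt (S i i))) - inner2 h S"
    unfolding ev_Dt_Contr inner2_def ..
  also have "(\<Sum>\<^sub>U i. ev (Dt (S i i))) = - 6 * DB_H - 2 * inner2 h S"
    unfolding DtS sum_subtractf A1 A2 A3 by simp
  finally show ?thesis by simp
qed

text \<open>
  At the centre \<open>dW\<close> and \<open>dN\<close> are the pairings of \<open>W\<close> and of the gradient of $|H|^2$ with
  $\nabla\phi$, and \<open>quad T\<close> is $T(\nabla\phi, \nabla\phi)$.
\<close>

definition "df i = ev (D i f)"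
definition "lap = Contr Gi (Hess D C f)"
definition "grad_sq = Contr Gi (\<lambda>i j. D i f * D j f)"
definition "dW = (\<Sum>\<^sub>U i. ev (W i) * df i)"
definition "dN = (\<Sum>\<^sub>U i. df i * ev (D i N))"
definition "quad T = (\<Sum>\<^sub>U i j. ev (T i j) * df i * df j)"
definition "ddf i j = D i (D j f)"

lemma ev_Dt_Lap: "ev (Dt lap) = Lapl (Dt f) - inner2 h ddf + dW / 2 + dN / 6"
proof -
  have "(\<Sum>\<^sub>U i. ev (Dt (C l i i))) = - ev (W l) / 2 - ev (D l N) / 6" for l
  proof -
    have "(\<Sum>\<^sub>U i. ev (Dt (C l i i))) = (\<Sum>\<^sub>U i. ev (D i (h i l))) - (\<Sum>\<^sub>U i. ev (D l (h i i))) / 2"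
      unfolding ev_Dt_C by (simp add: sum_subtractf sum_divide_distrib diff_divide_distrib)
    also have "\<dots> = ev (Div2 D C Gi h l) - ev (D l (Contr Gi h)) / 2"
      by (simp add: ev_Div2 ev_D_Contr)
    also have "\<dots> = - ev (W l) / 2 - ev (D l N) / 6"
      unfolding Div2_h Contr_h by (simp add: D_simps ev_simps field_simps)
    finally show ?thesis .
  qed
  note Cl = this
  have C: "(\<Sum>\<^sub>U l. (\<Sum>\<^sub>U i. ev (Dt (C l i i))) * df l) = - dW / 2 - dN / 6"
    unfolding dW_def dN_def Cl sum_divide_distrib sum_negf[symmetric] sum_subtractf[symmetric]
    by (intro sum.cong refl) (simp add: field_simps)
  have "(\<Sum>\<^sub>U i. ev (Dt (Hess D C f i i)))
      = Lapl (Dt f) - (\<Sum>\<^sub>U i l. ev (Dt (C l i i)) * df l)"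
    by (simp add: Hess_def Dt_simps ev_simps ev_C Lapl_def df_def sum_subtractf)
  also have "(\<Sum>\<^sub>U i l. ev (Dt (C l i i)) * df l) = - dW / 2 - dN / 6"
    unfolding C[symmetric] sum_distrib_right by (rule sum.swap)
  finally show ?thesis
    unfolding lap_def ev_Dt_Contr by (simp add: inner2_def ev_Hess ddf_def)
qed

lemma ev_Dt_Q: "ev (Dt grad_sq) = 2 * (\<Sum>\<^sub>U i. df i * ev (D i (Dt f))) - quad h"
  unfolding grad_sq_def ev_Dt_Contr
  by (simp add: Dt_simps ev_simps df_def quad_def sum_distrib_left mult.commute mult.left_commute ev_two)

text \<open>
  The second derivatives of the inverse metric in $|\nabla\phi|^2$ and the first derivatives of the
  Christoffel symbols in $\Delta\phi$ combine to the Ricci tensor.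
\<close>

lemma Bochner: "Lapl grad_sq = 2 * inner2 ddf ddf + 2 * (\<Sum>\<^sub>U i. df i * ev (D i lap)) + 2 * quad Rc"
proof -
  define c where "c p m i j = ev (D p (C m i j))" for p m i j
  have DLap: "ev (D i lap) = (\<Sum>\<^sub>U j. ev (D i (D j (D j f)))) - (\<Sum>\<^sub>U l. (\<Sum>\<^sub>U j. c i l j j) * df l)" for i
  proof -
    have "ev (D i lap) = (\<Sum>\<^sub>U j. ev (D i (D j (D j f)))) - (\<Sum>\<^sub>U j l. c i l j j * df l)"
      unfolding lap_def ev_D_Contr by (simp add: Hess_def D_simps ev_simps ev_C df_def c_def sum_subtractf)
    also have "(\<Sum>\<^sub>U j l. c i l j j * df l) = (\<Sum>\<^sub>U l. (\<Sum>\<^sub>U j. c i l j j) * df l)"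
      unfolding sum_distrib_right by (rule sum.swap)
    finally show ?thesis .
  qed
  have "Lapl grad_sq = (\<Sum>\<^sub>U k i. 2 * (df i * ev (D k (D k (D i f)))) + 2 * (ev (ddf k i) * ev (ddf k i)))
     - (\<Sum>\<^sub>U k i j. g2 k k i j * (df i * df j))"
    unfolding Lapl_def grad_sq_def ev_DD_Contr sum_subtractf
    by (simp add: D_simps ev_simps df_def ddf_def algebra_simps ev_two D_two)
  also have "(\<Sum>\<^sub>U k i. 2 * (df i * ev (D k (D k (D i f)))) + 2 * (ev (ddf k i) * ev (ddf k i)))
      = 2 * (\<Sum>\<^sub>U k i. df i * ev (D k (D k (D i f)))) + 2 * inner2 ddf ddf"
    by (simp add: inner2_def sum.distrib sum_distrib_left)
  also have "(\<Sum>\<^sub>U k i. df i * ev (D k (D k (D i f))))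
      = (\<Sum>\<^sub>U i. df i * (\<Sum>\<^sub>U k. ev (D i (D k (D k f)))))"
    unfolding sum_distrib_left
    by (subst sum.swap) (simp add: D_commute[of _ _ f] D_commute[of _ _ "D _ f"])
  also have "\<dots> = (\<Sum>\<^sub>U i. df i * ev (D i lap)) + (\<Sum>\<^sub>U i l. (\<Sum>\<^sub>U j. c i l j j) * df i * df l)"
    unfolding DLap by (simp add: algebra_simps sum_distrib_left sum_subtractf)
  also have "(\<Sum>\<^sub>U k i j. g2 k k i j * (df i * df j))
      = (\<Sum>\<^sub>U i l. (\<Sum>\<^sub>U k. g2 k k i l) * df i * df l)"
  proof -
    have "(\<Sum>\<^sub>U k i j. g2 k k i j * (df i * df j))
       = (\<Sum>\<^sub>U i k j. g2 k k i j * (df i * df j))"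
      by (rule sum.swap)
    also have "\<dots> = (\<Sum>\<^sub>U i j k. g2 k k i j * (df i * df j))"
      by (intro sum.cong refl sum.swap)
    finally show ?thesis by (simp add: sum_distrib_right mult.assoc)
  qed
  finally have *: "Lapl grad_sq = 2 * inner2 ddf ddf + 2 * (\<Sum>\<^sub>U i. df i * ev (D i lap))
      + 2 * (\<Sum>\<^sub>U i l. (\<Sum>\<^sub>U j. c i l j j) * df i * df l)
      - (\<Sum>\<^sub>U i l. (\<Sum>\<^sub>U k. g2 k k i l) * df i * df l)"
    by simp
  define A K M where "A i l = (\<Sum>\<^sub>U j. g2 i j j l)" and "K i l = (\<Sum>\<^sub>U j. g2 j j i l)"
    and "M i l = (\<Sum>\<^sub>U j. g2 i l j j)" for i l
  define q where "q T = (\<Sum>\<^sub>U i l. T i l * df i * df l)" for T :: "'n \<Rightarrow> 'n \<Rightarrow> real"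
  have q_lin: "q (\<lambda>i l. T i l + U i l) = q T + q U" "q (\<lambda>i l. T i l - U i l) = q T - q U"
    "q (\<lambda>i l. r * T i l) = r * q T" for T U r
    by (simp_all add: q_def sum.distrib sum_subtractf algebra_simps sum_distrib_left)
  have q_swap: "q (\<lambda>i l. T l i) = q T" for T
    unfolding q_def by (subst sum.swap) (simp add: mult.assoc mult.commute[of "df _" "df _"])
  have "2 * ev (Rc i l) = A i l + A l i - K i l - M i l" for i l
    unfolding ev_Rc ev_DC A_def K_def M_def sum_distrib_left sum.distrib[symmetric] sum_subtractf[symmetric]
    apply (intro sum.cong refl)
    subgoal for j
      using g2_sym(1)[of j i l j] g2_sym(2)[of j i j l] g2_sym(2)[of j l j i] g2_sym(1)[of i j l j]
        g2_sym(1)[of i l j j] g2_sym(1)[of j l i j] by simp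
    done
  then have 1: "2 * quad Rc = q (\<lambda>i l. A i l + A l i - K i l - M i l)"
    unfolding quad_def q_def by (simp add: sum_distrib_left mult.assoc[symmetric])
  have "2 * (\<Sum>\<^sub>U j. c i l j j) = 2 * A i l - M i l" for i l
    unfolding c_def ev_DC A_def M_def sum_distrib_left sum_subtractf[symmetric] by (intro sum.cong refl) simp
  then have 2: "2 * q (\<lambda>i l. \<Sum>\<^sub>U j. c i l j j) = 2 * q A - q M"
    unfolding q_lin[symmetric] by simp
  have 3: "2 * quad Rc = 2 * q A - q K - q M"
    unfolding 1 q_lin q_swap[of A] by simp
  have "2 * quad Rc = 2 * (\<Sum>\<^sub>U i l. (\<Sum>\<^sub>U j. c i l j j) * df i * df l)
      - (\<Sum>\<^sub>U i l. (\<Sum>\<^sub>U k. g2 k k i l) * df i * df l)"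
    using 2 3 unfolding q_def K_def by simp
  then show ?thesis unfolding * by simp
qed

text \<open>
  The Laplacian of $|H|^2$ occurs with the coefficients $-5/12$, $1/12$ and $1/3$, which add up to zero,
  and \<open>dN\<close> with $1/3$ and $-1/3$. What remains is the expansion of two squares.
\<close>

theorem gen_scalar_evolution:
  assumes u: "u = R - (1/12) *\<^sub>R N + 2 *\<^sub>R lap - grad_sq"
  shows "ev (Dt u) - Lapl u =
    2 * (\<Sum>\<^sub>U i j. (ev (Rc i j) - ev (S i j) / 4 + ev (ddf i j))\<^sup>2)
    + (\<Sum>\<^sub>U a b. (ev (B a b) + (\<Sum>\<^sub>U i. df i * ev (H i a b)))\<^sup>2) / 2"
proof -
  have sym: "inner2 T U = inner2 U T" for T U by (simp add: inner2_def mult.commute)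
  have Dtf: "Lapl (Dt f) = Lapl lap + Lapl N / 6"
    unfolding Dt_f lap_def[symmetric] by (simp add: Lapl_simps)
  have dDtf: "(\<Sum>\<^sub>U i. df i * ev (D i (Dt f))) = (\<Sum>\<^sub>U i. df i * ev (D i lap)) + dN / 6"
    unfolding Dt_f lap_def[symmetric] dN_def
    by (simp add: D_simps ev_simps algebra_simps sum.distrib sum_divide_distrib)
  have quad_h: "quad h = - 2 * quad Rc + quad S / 2"
    unfolding quad_def h_def Dt_G
    by (simp add: ev_simps algebra_simps sum.distrib sum_subtractf sum_distrib_left sum_divide_distrib sum_negf)
  have "ev (Dt u) - Lapl u = 2 * inner2 Rc Rc - inner2 Rc S + inner2 S S / 8 + 4 * inner2 Rc ddf - inner2 S ddf + 2 * inner2 ddf ddf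
      + inner2 B B / 2 + dW + quad S / 2"
    unfolding u Lapl_simps Dt_simps ev_simps ev_Dt_R ev_Dt_N ev_Dt_Lap ev_Dt_Q Bochner Dtf dDtf quad_h inner2_h
    by (simp add: sym[of S Rc] algebra_simps diff_divide_distrib)
  moreover have "2 * (\<Sum>\<^sub>U i j. (ev (Rc i j) - ev (S i j) / 4 + ev (ddf i j))\<^sup>2)
    = 2 * inner2 Rc Rc - inner2 Rc S + inner2 S S / 8 + 4 * inner2 Rc ddf - inner2 S ddf + 2 * inner2 ddf ddf"
    unfolding inner2_def
    by (simp add: power2_eq_square algebra_simps sum.distrib sum_subtractf sum_distrib_left sum_divide_distrib)
  moreover have "(\<Sum>\<^sub>U a b. (ev (B a b) + (\<Sum>\<^sub>U i. df i * ev (H i a b)))\<^sup>2)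
     = inner2 B B + 2 * dW + quad S"
  proof -
    have "(\<Sum>\<^sub>U a b. (ev (B a b) + (\<Sum>\<^sub>U i. df i * ev (H i a b)))\<^sup>2)
       = inner2 B B + 2 * (\<Sum>\<^sub>U a b i. df i * (ev (B a b) * ev (H i a b)))
         + (\<Sum>\<^sub>U a b i j. (df i * ev (H i a b)) * (df j * ev (H j a b)))"
    proof -
      have "(ev (B a b) + (\<Sum>\<^sub>U i. df i * ev (H i a b)))\<^sup>2
          = ev (B a b) * ev (B a b) + 2 * (\<Sum>\<^sub>U i. df i * (ev (B a b) * ev (H i a b)))
            + (\<Sum>\<^sub>U i j. (df i * ev (H i a b)) * (df j * ev (H j a b)))" for a b
        unfolding power2_sum sum_product[symmetric]
        by (simp add: power2_eq_square sum_distrib_left ac_simps)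
      then show ?thesis by (simp add: inner2_def sum.distrib sum_distrib_left)
    qed
    also have "(\<Sum>\<^sub>U a b i. df i * (ev (B a b) * ev (H i a b)))
        = (\<Sum>\<^sub>U a i b. df i * (ev (B a b) * ev (H i a b)))"
      by (intro sum.cong refl sum.swap)
    also have "\<dots> = (\<Sum>\<^sub>U i a b. df i * (ev (B a b) * ev (H i a b)))"
      by (rule sum.swap)
    also have "\<dots> = dW"
      unfolding dW_def ev_W by (simp add: sum_distrib_left mult.commute)
    also have "(\<Sum>\<^sub>U a b i j. (df i * ev (H i a b)) * (df j * ev (H j a b)))
        = (\<Sum>\<^sub>U a i b j. (df i * ev (H i a b)) * (df j * ev (H j a b)))"
      by (intro sum.cong refl sum.swap)
    also have "\<dots> = (\<Sum>\<^sub>U i a b j. (df i * ev (H i a b)) * (df j * ev (H j a b)))"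
      by (rule sum.swap)
    also have "\<dots> = (\<Sum>\<^sub>U i a j b. (df i * ev (H i a b)) * (df j * ev (H j a b)))"
      by (intro sum.cong refl sum.swap)
    also have "\<dots> = (\<Sum>\<^sub>U i j a b. (df i * ev (H i a b)) * (df j * ev (H j a b)))"
      by (intro sum.cong refl sum.swap)
    also have "\<dots> = quad S"
      unfolding quad_def ev_S by (simp add: sum_distrib_left sum_distrib_right mult.commute mult.left_commute)
    finally show ?thesis by simp
  qed
  ultimately show ?thesis by simp
qed

end

section \<open>Smooth functions\<close>

lemma Ck_on_cong:
  assumes "Ck_on k S f" and "\<And>x. x \<in> S \<Longrightarrow> g x = f x"
  shows "Ck_on k S g"
proof (cases k)
  case 0
  then show ?thesis using assms by (simp cong: continuous_on_cong)
next
  case (Suc m)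
  then obtain f' where f': "\<forall>x\<in>S. (f has_derivative f' x) (at x within S)" "\<forall>v. Ck_on m S (\<lambda>x. f' x v)"
    using assms(1) by auto
  then have "\<forall>x\<in>S. (g has_derivative f' x) (at x within S)"
    using assms(2) by (auto intro: has_derivative_transform)
  with f'(2) show ?thesis unfolding Suc by auto
qed

lemma Ck_on_lower: "Ck_on (Suc k) S f \<Longrightarrow> Ck_on k S f"
proof (induction k arbitrary: f)
  case 0
  then show ?case by (auto simp: continuous_on_eq_continuous_within intro: has_derivative_continuous)
next
  case (Suc k)
  then show ?case by (metis Ck_on.simps(2))
qed

lemma Ck_on_subset: "Ck_on k S f \<Longrightarrow> T \<subseteq> S \<Longrightarrow> Ck_on k T f"
proof (induction k arbitrary: f)
  case 0
  then show ?case by (auto intro: continuous_on_subset)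
next
  case (Suc k)
  then obtain f' where f': "\<forall>x\<in>S. (f has_derivative f' x) (at x within S)" "\<forall>v. Ck_on k S (\<lambda>x. f' x v)"
    by auto
  then have "\<forall>x\<in>T. (f has_derivative f' x) (at x within T)" "\<forall>v. Ck_on k T (\<lambda>x. f' x v)"
    using Suc by (auto intro: has_derivative_subset)
  then show ?case by auto
qed

lemma Ck_on_const: "Ck_on k S (\<lambda>x. c)"
proof (induction k arbitrary: c)
  case (Suc k)
  have "\<forall>x\<in>S. ((\<lambda>x. c) has_derivative (\<lambda>v. 0)) (at x within S)" by simp
  then show ?case using Suc unfolding Ck_on.simps by (intro exI[of _ "\<lambda>x v. 0"]) simp
qed simp

lemma Ck_on_add: "Ck_on k S f \<Longrightarrow> Ck_on k S g \<Longrightarrow> Ck_on k S (\<lambda>x. f x + g x)"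
proof (induction k arbitrary: f g)
  case 0
  then show ?case by (auto intro: continuous_intros)
next
  case (Suc k)
  then obtain f' g' where
    f': "\<forall>x\<in>S. (f has_derivative f' x) (at x within S)" "\<forall>v. Ck_on k S (\<lambda>x. f' x v)" and
    g': "\<forall>x\<in>S. (g has_derivative g' x) (at x within S)" "\<forall>v. Ck_on k S (\<lambda>x. g' x v)"
    by auto
  have "\<forall>x\<in>S. ((\<lambda>x. f x + g x) has_derivative (\<lambda>v. f' x v + g' x v)) (at x within S)"
    using f' g' by (auto intro: has_derivative_add)
  moreover have "\<forall>v. Ck_on k S (\<lambda>x. f' x v + g' x v)" using f' g' Suc.IH by auto
  ultimately show ?case unfolding Ck_on.simps by (intro exI[of _ "\<lambda>x v. f' x v + g' x v"]) simp
qed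

lemma Ck_on_linear:
  assumes "bounded_linear L"
  shows "Ck_on k S f \<Longrightarrow> Ck_on k S (\<lambda>x. L (f x))"
proof (induction k arbitrary: f)
  case 0
  then show ?case using assms by (auto intro: continuous_intros linear_continuous_on_compose bounded_linear.continuous_on)
next
  case (Suc k)
  then obtain f' where
    f': "\<forall>x\<in>S. (f has_derivative f' x) (at x within S)" "\<forall>v. Ck_on k S (\<lambda>x. f' x v)"
    by auto
  have "\<forall>x\<in>S. ((\<lambda>x. L (f x)) has_derivative (\<lambda>v. L (f' x v))) (at x within S)"
    using f'(1) by (blast intro: bounded_linear.has_derivative[OF assms])
  moreover have "\<forall>v. Ck_on k S (\<lambda>x. L (f' x v))" using f' Suc.IH by auto
  ultimately show ?case unfolding Ck_on.simps by (intro exI[of _ "\<lambda>x v. L (f' x v)"]) simp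
qed

lemma Ck_on_mult:
  fixes f g :: "'a::real_normed_vector \<Rightarrow> real"
  shows "Ck_on k S f \<Longrightarrow> Ck_on k S g \<Longrightarrow> Ck_on k S (\<lambda>x. f x * g x)"
proof (induction k arbitrary: f g)
  case 0
  then show ?case by (auto intro: continuous_intros)
next
  case (Suc k)
  then obtain f' g' where
    f': "\<forall>x\<in>S. (f has_derivative f' x) (at x within S)" "\<forall>v. Ck_on k S (\<lambda>x. f' x v)" and
    g': "\<forall>x\<in>S. (g has_derivative g' x) (at x within S)" "\<forall>v. Ck_on k S (\<lambda>x. g' x v)"
    by auto
  have "\<forall>x\<in>S. ((\<lambda>x. f x * g x) has_derivative (\<lambda>v. f x * g' x v + f' x v * g x)) (at x within S)"
    using f' g' by (auto intro: has_derivative_mult)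
  moreover have fg: "Ck_on k S f" "Ck_on k S g" using Suc.prems Ck_on_lower by blast+
  have "\<forall>v. Ck_on k S (\<lambda>x. f x * g' x v + f' x v * g x)"
    by (intro allI Ck_on_add Suc.IH fg f'(2)[rule_format] g'(2)[rule_format])
  ultimately show ?case unfolding Ck_on.simps by (intro exI[of _ "\<lambda>x v. f x * g' x v + f' x v * g x"]) simp
qed

lemma Ck_on_inverse:
  fixes f :: "'a::real_normed_vector \<Rightarrow> real"
  assumes "\<And>x. x \<in> S \<Longrightarrow> f x \<noteq> 0"
  shows "Ck_on k S f \<Longrightarrow> Ck_on k S (\<lambda>x. inverse (f x))"
proof (induction k)
  case 0
  then show ?case using assms by (auto intro: continuous_intros)
next
  case (Suc k)
  then obtain f' where
    f': "\<forall>x\<in>S. (f has_derivative f' x) (at x within S)" "\<forall>v. Ck_on k S (\<lambda>x. f' x v)"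
    by auto
  have "\<forall>x\<in>S. ((\<lambda>x. inverse (f x)) has_derivative (\<lambda>v. - (inverse (f x) * f' x v * inverse (f x)))) (at x within S)"
    using f' assms by (auto intro: has_derivative_inverse)
  moreover have i: "Ck_on k S (\<lambda>x. inverse (f x))" using Suc Ck_on_lower by blast
  have "Ck_on k S (\<lambda>x. - (inverse (f x) * f' x v * inverse (f x)))" for v
    by (intro Ck_on_linear[OF bounded_linear_minus[OF bounded_linear_ident]] Ck_on_mult i f'(2)[rule_format])
  ultimately show ?case unfolding Ck_on.simps
    by (intro exI[of _ "\<lambda>x v. - (inverse (f x) * f' x v * inverse (f x))"]) simp
qed

lemma Ck_on_sum: "(\<And>s. s \<in> A \<Longrightarrow> Ck_on k S (f s)) \<Longrightarrow> Ck_on k S (\<lambda>x. \<Sum>s\<in>A. f s x)"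
  by (induction A rule: infinite_finite_induct) (auto intro: Ck_on_add Ck_on_const)

text \<open>
  The derivative of the outer function is expanded in a basis, because \<open>Ck_on\<close> speaks of directional
  derivatives along fixed vectors, whereas the inner derivative is a vector that varies.
\<close>

lemma Ck_on_compose:
  fixes g :: "'c::real_normed_vector \<Rightarrow> 'a::euclidean_space" and f :: "'a \<Rightarrow> real"
  shows "Ck_on k T f \<Longrightarrow> Ck_on k S g \<Longrightarrow> g ` S \<subseteq> T \<Longrightarrow> Ck_on k S (\<lambda>x. f (g x))"
proof (induction k arbitrary: f)
  case 0
  then show ?case by (auto intro: continuous_on_compose2)
next
  case (Suc k)
  then obtain f' g' where
    f': "\<forall>x\<in>T. (f has_derivative f' x) (at x within T)" "\<forall>v. Ck_on k T (\<lambda>x. f' x v)" and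
    g': "\<forall>x\<in>S. (g has_derivative g' x) (at x within S)" "\<forall>v. Ck_on k S (\<lambda>x. g' x v)"
    by auto
  have f_lin: "f' y v = (\<Sum>b\<in>Basis. (v \<bullet> b) * f' y b)" if "y \<in> T" for y v
  proof -
    have lin: "linear (f' y)" using f' that has_derivative_linear by blast
    have "f' y v = f' y (\<Sum>b\<in>Basis. (v \<bullet> b) *\<^sub>R b)" by (simp add: euclidean_representation)
    then show ?thesis by (simp add: linear_sum[OF lin] linear_cmul[OF lin])
  qed
  have "((\<lambda>x. f (g x)) has_derivative (\<lambda>v. f' (g x) (g' x v))) (at x within S)" if "x \<in> S" for x
    by (rule has_derivative_in_compose2[OF f'(1)[rule_format] Suc.prems(3) that g'(1)[rule_format, OF that]])
  moreover have "(\<lambda>v. f' (g x) (g' x v)) = (\<lambda>v. \<Sum>b\<in>Basis. (g' x v \<bullet> b) * f' (g x) b)" if "x \<in> S" for x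
    using Suc.prems(3) that by (intro ext f_lin) auto
  ultimately have "\<forall>x\<in>S. ((\<lambda>x. f (g x)) has_derivative (\<lambda>v. \<Sum>b\<in>Basis. (g' x v \<bullet> b) * f' (g x) b)) (at x within S)"
    by simp
  moreover have g: "Ck_on k S g" using Suc.prems Ck_on_lower by blast
  have "Ck_on k S (\<lambda>x. \<Sum>b\<in>Basis. (g' x v \<bullet> b) * f' (g x) b)" for v
    by (intro Ck_on_sum Ck_on_mult Ck_on_linear[OF bounded_linear_inner_left] g'(2)[rule_format]
        Suc.IH[OF f'(2)[rule_format] g Suc.prems(3)])
  ultimately show ?case unfolding Ck_on.simps
    by (intro exI[of _ "\<lambda>x v. \<Sum>b\<in>Basis. (g' x v \<bullet> b) * f' (g x) b"]) simp
qed

lemma smooth_on_cong: "smooth_on S f \<Longrightarrow> (\<And>x. x \<in> S \<Longrightarrow> g x = f x) \<Longrightarrow> smooth_on S g"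
  unfolding smooth_on_def by (blast intro: Ck_on_cong)

lemma smooth_on_subset: "smooth_on S f \<Longrightarrow> T \<subseteq> S \<Longrightarrow> smooth_on T f"
  unfolding smooth_on_def by (blast intro: Ck_on_subset)

lemma smooth_on_const: "smooth_on S (\<lambda>x. c)"
  unfolding smooth_on_def by (blast intro: Ck_on_const)

lemma smooth_on_add: "smooth_on S f \<Longrightarrow> smooth_on S g \<Longrightarrow> smooth_on S (\<lambda>x. f x + g x)"
  unfolding smooth_on_def by (blast intro: Ck_on_add)

lemma smooth_on_linear: "bounded_linear L \<Longrightarrow> smooth_on S f \<Longrightarrow> smooth_on S (\<lambda>x. L (f x))"
  unfolding smooth_on_def by (blast intro: Ck_on_linear)

lemma smooth_on_bounded_linear: "bounded_linear L \<Longrightarrow> smooth_on S L"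
proof (unfold smooth_on_def, rule allI)
  fix k assume L: "bounded_linear L"
  show "Ck_on k S L"
  proof (cases k)
    case 0 then show ?thesis using L by (simp add: linear_continuous_on)
  next
    case (Suc m)
    have "\<forall>x\<in>S. (L has_derivative L) (at x within S)" using L bounded_linear_imp_has_derivative by blast
    moreover have "\<forall>v. Ck_on m S (\<lambda>x. L v)" by (simp add: Ck_on_const)
    ultimately show ?thesis unfolding Suc Ck_on.simps by (intro exI[of _ "\<lambda>x. L"]) simp
  qed
qed

lemma smooth_on_minus: "smooth_on S f \<Longrightarrow> smooth_on S (\<lambda>x. - f x)"
  by (rule smooth_on_linear[OF bounded_linear_minus[OF bounded_linear_ident]])

lemma smooth_on_diff: "smooth_on S f \<Longrightarrow> smooth_on S g \<Longrightarrow> smooth_on S (\<lambda>x. f x - g x)"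
  using smooth_on_add[OF _ smooth_on_minus, of S f g] by simp

lemma smooth_on_scaleR: "smooth_on S f \<Longrightarrow> smooth_on S (\<lambda>x. r *\<^sub>R f x)"
  by (rule smooth_on_linear[OF bounded_linear_scaleR_right])

lemma smooth_on_nth: "smooth_on S f \<Longrightarrow> smooth_on S (\<lambda>x. f x $ i)"
  by (rule smooth_on_linear[OF bounded_linear_vec_nth])

lemma smooth_on_mult:
  fixes f g :: "'a::real_normed_vector \<Rightarrow> real"
  shows "smooth_on S f \<Longrightarrow> smooth_on S g \<Longrightarrow> smooth_on S (\<lambda>x. f x * g x)"
  unfolding smooth_on_def by (blast intro: Ck_on_mult)

lemma smooth_on_inverse:
  fixes f :: "'a::real_normed_vector \<Rightarrow> real"
  shows "smooth_on S f \<Longrightarrow> (\<And>x. x \<in> S \<Longrightarrow> f x \<noteq> 0) \<Longrightarrow> smooth_on S (\<lambda>x. inverse (f x))"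
  unfolding smooth_on_def by (blast intro: Ck_on_inverse)

lemma smooth_on_sum: "(\<And>s. s \<in> A \<Longrightarrow> smooth_on S (f s)) \<Longrightarrow> smooth_on S (\<lambda>x. \<Sum>s\<in>A. f s x)"
  unfolding smooth_on_def by (blast intro: Ck_on_sum)

lemma smooth_on_prod:
  fixes f :: "'s \<Rightarrow> 'a::real_normed_vector \<Rightarrow> real"
  shows "(\<And>s. s \<in> A \<Longrightarrow> smooth_on S (f s)) \<Longrightarrow> smooth_on S (\<lambda>x. \<Prod>s\<in>A. f s x)"
  by (induction A rule: infinite_finite_induct) (auto intro: smooth_on_mult smooth_on_const)

lemma smooth_on_compose:
  fixes g :: "'c::real_normed_vector \<Rightarrow> 'a::euclidean_space" and f :: "'a \<Rightarrow> real"
  shows "smooth_on T f \<Longrightarrow> smooth_on S g \<Longrightarrow> g ` S \<subseteq> T \<Longrightarrow> smooth_on S (\<lambda>x. f (g x))"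
  unfolding smooth_on_def by (blast intro: Ck_on_compose)

lemma smooth_on_euclidean:
  fixes f :: "'a::real_normed_vector \<Rightarrow> 'b::euclidean_space"
  assumes "\<And>b. b \<in> Basis \<Longrightarrow> smooth_on S (\<lambda>x. f x \<bullet> b)"
  shows "smooth_on S f"
proof -
  have "smooth_on S (\<lambda>x. \<Sum>b\<in>Basis. (f x \<bullet> b) *\<^sub>R b)"
    by (intro smooth_on_sum smooth_on_linear[OF bounded_linear_scaleR_left] assms)
  then show ?thesis by (simp add: euclidean_representation)
qed

lemma smooth_on_Pair:
  fixes f :: "'a::real_normed_vector \<Rightarrow> 'b::euclidean_space" and g :: "'a \<Rightarrow> 'c::euclidean_space"
  assumes "smooth_on S f" "smooth_on S g"
  shows "smooth_on S (\<lambda>x. (f x, g x))"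
proof (rule smooth_on_euclidean)
  have "smooth_on S (\<lambda>x. f x \<bullet> u)" "smooth_on S (\<lambda>x. g x \<bullet> u')" for u u'
    by (intro smooth_on_linear[OF bounded_linear_inner_left] assms)+
  then show "smooth_on S (\<lambda>x. (f x, g x) \<bullet> b)" if "b \<in> Basis" for b :: "'b \<times> 'c"
    using that by (auto simp: Basis_prod_def)
qed

lemma smooth_on_compose_euclidean:
  fixes g :: "'c::real_normed_vector \<Rightarrow> 'a::euclidean_space" and f :: "'a \<Rightarrow> 'b::euclidean_space"
  assumes "smooth_on T f" "smooth_on S g" "g ` S \<subseteq> T"
  shows "smooth_on S (\<lambda>x. f (g x))"
proof (rule smooth_on_euclidean)
  fix b :: 'b
  show "smooth_on S (\<lambda>x. f (g x) \<bullet> b)"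
    by (rule smooth_on_compose[OF smooth_on_linear[OF bounded_linear_inner_left assms(1)] assms(2,3)])
qed

lemma smooth_on_slice:
  fixes F :: "real \<Rightarrow> real^'n::finite \<Rightarrow> 'b::euclidean_space"
  assumes "smooth_on (I \<times> U) (\<lambda>z. F (fst z) (snd z))" "t \<in> I"
  shows "smooth_on U (F t)"
proof -
  have "smooth_on U (\<lambda>x. (t, x))"
    by (intro smooth_on_Pair smooth_on_const smooth_on_bounded_linear bounded_linear_ident)
  from smooth_on_compose_euclidean[OF assms(1) this] show ?thesis using assms(2) by auto
qed

lemma smooth_on_vec:
  fixes f :: "'a::real_normed_vector \<Rightarrow> 'n::finite \<Rightarrow> real"
  assumes "\<And>i. smooth_on S (\<lambda>x. f x i)"
  shows "smooth_on S (\<lambda>x. \<chi> i. f x i)"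
  by (rule smooth_on_euclidean) (auto simp: Basis_vec_def inner_axis intro!: assms)

lemma smooth_on_imp_continuous_on: "smooth_on S f \<Longrightarrow> continuous_on S f"
  unfolding smooth_on_def by (metis Ck_on.simps(1))

lemma smooth_on_imp_differentiable:
  assumes "smooth_on S f" "open S" "x \<in> S"
  shows "f differentiable (at x)"
proof -
  have "Ck_on (Suc 0) S f" using assms by (auto simp: smooth_on_def simp del: Ck_on.simps)
  then obtain f' where "\<forall>x\<in>S. (f has_derivative f' x) (at x within S)" by auto
  then have "(f has_derivative f' x) (at x)"
    using assms(3) at_within_open[OF assms(3,2)] by metis
  then show ?thesis by (rule differentiableI)
qed

lemma smooth_on_frechet_derivative:
  assumes "smooth_on S f" "open S"
  shows "smooth_on S (\<lambda>x. frechet_derivative f (at x) v)"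
  unfolding smooth_on_def
proof
  fix k
  have "Ck_on (Suc k) S f" using assms by (simp add: smooth_on_def del: Ck_on.simps)
  then obtain f' where f': "\<forall>x\<in>S. (f has_derivative f' x) (at x within S)" "\<forall>v. Ck_on k S (\<lambda>x. f' x v)"
    by auto
  have eq: "frechet_derivative f (at x) v = f' x v" if "x \<in> S" for x
    using f'(1) that at_within_open[OF that assms(2)] by (metis frechet_derivative_at)
  show "Ck_on k S (\<lambda>x. frechet_derivative f (at x) v)"
    by (rule Ck_on_cong[OF f'(2)[rule_format, of v]]) (rule eq)
qed

text \<open>
  At an end point of \<open>I\<close> there are only one-sided time derivatives, but a slice of constant time lies
  in the open set \<open>U\<close>. Hence the spatial partial derivatives are smooth up to the end points.
\<close>

lemma smooth_on_pderiv_slice: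
  fixes F :: "real \<times> (real^'n::finite) \<Rightarrow> real"
  assumes "smooth_on (I \<times> U) F" "open U"
  shows "smooth_on (I \<times> U) (\<lambda>z. pderiv_at i (\<lambda>y. F (fst z, y)) (snd z))"
  unfolding smooth_on_def
proof
  fix k
  have "Ck_on (Suc k) (I \<times> U) F" using assms by (simp add: smooth_on_def del: Ck_on.simps)
  then obtain f' where f': "\<forall>x\<in>I \<times> U. (F has_derivative f' x) (at x within I \<times> U)" "\<forall>v. Ck_on k (I \<times> U) (\<lambda>x. f' x v)"
    by auto
  have eq: "pderiv_at i (\<lambda>y. F (fst z, y)) (snd z) = f' z (0, axis i 1)" if z: "z \<in> I \<times> U" for z
  proof -
    obtain t x where tx: "z = (t, x)" "t \<in> I" "x \<in> U" using z by auto
    have "((\<lambda>y. F (t, y)) has_derivative (\<lambda>v. f' (t, x) (0, v))) (at x within U)"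
      by (rule has_derivative_in_compose2[OF f'(1)[rule_format]])
        (use tx in \<open>auto intro!: derivative_eq_intros\<close>)
    then have "((\<lambda>y. F (t, y)) has_derivative (\<lambda>v. f' (t, x) (0, v))) (at x)"
      by (simp add: at_within_open[OF tx(3) assms(2)])
    then show ?thesis unfolding pderiv_at_def tx by (simp add: frechet_derivative_at[symmetric])
  qed
  show "Ck_on k (I \<times> U) (\<lambda>z. pderiv_at i (\<lambda>y. F (fst z, y)) (snd z))"
    by (rule Ck_on_cong[OF f'(2)[rule_format]]) (rule eq)
qed

lemma has_derivative_frechet:
  assumes "smooth_on S f" "open S" "x \<in> S"
  shows "(f has_derivative frechet_derivative f (at x)) (at x)"
  using smooth_on_imp_differentiable[OF assms] by (simp add: frechet_derivative_works)

lemma has_derivative_along_line: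
  fixes f :: "'a::real_normed_vector \<Rightarrow> real"
  assumes "smooth_on S f" "open S" "x + s *\<^sub>R v \<in> S"
  shows "((\<lambda>s. f (x + s *\<^sub>R v)) has_real_derivative frechet_derivative f (at (x + s *\<^sub>R v)) v) (at s)"
proof -
  let ?f' = "frechet_derivative f (at (x + s *\<^sub>R v))"
  have f: "(f has_derivative ?f') (at (x + s *\<^sub>R v))"
    by (rule has_derivative_frechet[OF assms])
  have "((\<lambda>s. x + s *\<^sub>R v) has_derivative (\<lambda>h. h *\<^sub>R v)) (at s)"
    by (auto intro!: derivative_eq_intros)
  from has_derivative_compose[OF this f] have "((\<lambda>s. f (x + s *\<^sub>R v)) has_derivative (\<lambda>h. ?f' (h *\<^sub>R v))) (at s)" .
  moreover have "?f' (h *\<^sub>R v) = ?f' v * h" for h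
    using linear_cmul[OF has_derivative_linear[OF f]] by simp
  ultimately show ?thesis by (simp add: has_field_derivative_def)
qed

text \<open>
  The second difference of \<open>f\<close> over a small parallelogram is symmetric in \<open>v\<close> and \<open>w\<close>; applying the
  mean value theorem twice expresses it by one mixed derivative or the other. Schwarz's theorem
  \<open>frechet_derivative_commute\<close> follows by letting the parallelogram shrink.
\<close>

lemma second_difference_mvt:
  fixes f :: "'a::real_normed_vector \<Rightarrow> real"
  assumes f: "smooth_on S f" "open S" and h: "h > 0"
    and S: "\<And>s t. 0 \<le> s \<Longrightarrow> s \<le> h \<Longrightarrow> 0 \<le> t \<Longrightarrow> t \<le> h \<Longrightarrow> x + s *\<^sub>R v + t *\<^sub>R w \<in> S"
  shows "\<exists>s t. 0 < s \<and> s < h \<and> 0 < t \<and> t < h \<and>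
     f (x + h *\<^sub>R v + h *\<^sub>R w) - f (x + h *\<^sub>R v) - f (x + h *\<^sub>R w) + f x
       = h * h * frechet_derivative (\<lambda>y. frechet_derivative f (at y) v) (at (x + s *\<^sub>R v + t *\<^sub>R w)) w"
proof -
  define g where "g s = f ((x + h *\<^sub>R w) + s *\<^sub>R v) - f (x + s *\<^sub>R v)" for s
  define fv where "fv y = frechet_derivative f (at y) v" for y
  have fv: "smooth_on S fv" unfolding fv_def by (rule smooth_on_frechet_derivative[OF f])
  have g: "(g has_real_derivative fv ((x + h *\<^sub>R w) + s *\<^sub>R v) - fv (x + s *\<^sub>R v)) (at s)"
    if "0 \<le> s" "s \<le> h" for s
    unfolding g_def fv_def
    using S[of s h] S[of s 0] that h
    by (intro DERIV_diff has_derivative_along_line[OF f]) (auto simp: algebra_simps)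
  obtain s where s: "0 < s" "s < h" "g h - g 0 = (h - 0) * (fv ((x + h *\<^sub>R w) + s *\<^sub>R v) - fv (x + s *\<^sub>R v))"
    using MVT2[OF h g] by blast
  have k: "((\<lambda>t. fv ((x + s *\<^sub>R v) + t *\<^sub>R w)) has_real_derivative
      frechet_derivative fv (at ((x + s *\<^sub>R v) + t *\<^sub>R w)) w) (at t)" if "0 \<le> t" "t \<le> h" for t
    using S[of s t] that s by (intro has_derivative_along_line[OF fv f(2)]) auto
  obtain t where t: "0 < t" "t < h"
    "fv ((x + s *\<^sub>R v) + h *\<^sub>R w) - fv ((x + s *\<^sub>R v) + 0 *\<^sub>R w) = (h - 0) * frechet_derivative fv (at ((x + s *\<^sub>R v) + t *\<^sub>R w)) w"
    using MVT2[OF h k] by blast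
  have "f (x + h *\<^sub>R v + h *\<^sub>R w) - f (x + h *\<^sub>R v) - f (x + h *\<^sub>R w) + f x = g h - g 0"
    by (simp add: g_def algebra_simps)
  also have "\<dots> = h * h * frechet_derivative fv (at (x + s *\<^sub>R v + t *\<^sub>R w)) w"
    using s(3) t(3) by (simp add: algebra_simps)
  finally show ?thesis using s t unfolding fv_def by blast
qed

lemma frechet_derivative_commute:
  fixes f :: "'a::real_normed_vector \<Rightarrow> real"
  assumes f: "smooth_on S f" "open S" "x \<in> S"
  shows "frechet_derivative (\<lambda>y. frechet_derivative f (at y) v) (at x) w
       = frechet_derivative (\<lambda>y. frechet_derivative f (at y) w) (at x) v"
proof -
  define A where "A y = frechet_derivative (\<lambda>y. frechet_derivative f (at y) v) (at y) w" for y
  define B where "B y = frechet_derivative (\<lambda>y. frechet_derivative f (at y) w) (at y) v" for y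
  have sm: "smooth_on S A" "smooth_on S B" unfolding A_def B_def
    using f by (auto intro!: smooth_on_frechet_derivative)
  then have cont: "isCont A x" "isCont B x"
    using f by (auto dest!: smooth_on_imp_continuous_on simp: continuous_on_eq_continuous_at)
  have "\<bar>A x - B x\<bar> \<le> e" if e: "e > 0" for e
  proof -
    obtain d1 where d1: "d1 > 0" "\<And>y. dist y x < d1 \<Longrightarrow> dist (A y) (A x) < e / 2"
      using cont(1) e unfolding continuous_at_eps_delta by (metis half_gt_zero)
    obtain d2 where d2: "d2 > 0" "\<And>y. dist y x < d2 \<Longrightarrow> dist (B y) (B x) < e / 2"
      using cont(2) e unfolding continuous_at_eps_delta by (metis half_gt_zero)
    obtain d3 where d3: "d3 > 0" "ball x d3 \<subseteq> S" using f openE by blast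
    define d where "d = min d1 (min d2 d3)"
    define n where "n = norm v + norm w + 1"
    define h where "h = d / (2 * n)"
    have pos: "n > 0" unfolding n_def by (smt (verit) norm_ge_zero)
    have d: "d > 0" using d1 d2 d3 by (simp add: d_def)
    then have h: "h > 0" using pos by (simp add: h_def)
    have close: "dist (x + s *\<^sub>R v + t *\<^sub>R w) x < d" "dist (x + s *\<^sub>R w + t *\<^sub>R v) x < d"
      if "0 \<le> s" "s \<le> h" "0 \<le> t" "t \<le> h" for s t
    proof -
      have *: "s' * norm v + t' * norm w < d" if "0 \<le> s'" "s' \<le> h" "0 \<le> t'" "t' \<le> h" for s' t'
      proof -
        have "s' * norm v + t' * norm w \<le> h * norm v + h * norm w"
          using that by (intro add_mono mult_right_mono) auto
        also have "\<dots> \<le> h * n" using h by (simp add: n_def algebra_simps)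
        also have "\<dots> = d / 2" using pos by (simp add: h_def)
        finally show ?thesis using d by simp
      qed
      show "dist (x + s *\<^sub>R v + t *\<^sub>R w) x < d"
        using norm_triangle_ineq[of "s *\<^sub>R v" "t *\<^sub>R w"] *[of s t] that by (simp add: dist_norm add.assoc)
      show "dist (x + s *\<^sub>R w + t *\<^sub>R v) x < d"
        using norm_triangle_ineq[of "s *\<^sub>R w" "t *\<^sub>R v"] *[of t s] that by (simp add: dist_norm add.assoc)
    qed
    have inS: "y \<in> S" if "dist y x < d" for y
      using that d3(2) by (auto simp: d_def dist_commute)
    obtain s t where st: "0 < s" "s < h" "0 < t" "t < h"
      "f (x + h *\<^sub>R v + h *\<^sub>R w) - f (x + h *\<^sub>R v) - f (x + h *\<^sub>R w) + f x = h * h * A (x + s *\<^sub>R v + t *\<^sub>R w)"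
      using second_difference_mvt[OF f(1,2) h, of x v w] close inS unfolding A_def by blast
    obtain s' t' where st': "0 < s'" "s' < h" "0 < t'" "t' < h"
      "f (x + h *\<^sub>R w + h *\<^sub>R v) - f (x + h *\<^sub>R w) - f (x + h *\<^sub>R v) + f x = h * h * B (x + s' *\<^sub>R w + t' *\<^sub>R v)"
      using second_difference_mvt[OF f(1,2) h, of x w v] close inS unfolding B_def by blast
    have "x + h *\<^sub>R v + h *\<^sub>R w = x + h *\<^sub>R w + h *\<^sub>R v" by (simp add: algebra_simps)
    then have "h * h * A (x + s *\<^sub>R v + t *\<^sub>R w) = h * h * B (x + s' *\<^sub>R w + t' *\<^sub>R v)"
      using st(5) st'(5) by (simp add: algebra_simps)
    then have eq: "A (x + s *\<^sub>R v + t *\<^sub>R w) = B (x + s' *\<^sub>R w + t' *\<^sub>R v)" using h by simp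
    have "dist (A (x + s *\<^sub>R v + t *\<^sub>R w)) (A x) < e / 2" "dist (B (x + s' *\<^sub>R w + t' *\<^sub>R v)) (B x) < e / 2"
      using close[of s t] close[of s' t'] st st' d1(2) d2(2) by (auto simp: d_def)
    then show ?thesis unfolding eq dist_real_def by linarith
  qed
  then have "\<bar>A x - B x\<bar> \<le> 0" by (meson dense_ge)
  then show ?thesis by (simp add: A_def B_def)
qed

lemma smooth_on_det:
  fixes M :: "'a::real_normed_vector \<Rightarrow> real^'n::finite^'n"
  assumes "\<And>i j. smooth_on S (\<lambda>x. M x $ i $ j)"
  shows "smooth_on S (\<lambda>x. det (M x))"
  unfolding det_def by (intro smooth_on_sum smooth_on_mult smooth_on_const smooth_on_prod assms)

lemma matrix_inv_mult:
  fixes M :: "real^'n::finite^'n"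
  assumes "det M \<noteq> 0"
  shows "M ** matrix_inv M = mat 1" and "matrix_inv M ** M = mat 1"
proof -
  have "\<exists>N. M ** N = mat 1 \<and> N ** M = mat 1"
    using assms unfolding invertible_det_nz[symmetric] invertible_def .
  then have "M ** matrix_inv M = mat 1 \<and> matrix_inv M ** M = mat 1"
    unfolding matrix_inv_def by (rule someI_ex)
  then show "M ** matrix_inv M = mat 1" and "matrix_inv M ** M = mat 1" by auto
qed

text \<open>
  Cramer's rule, which shows that the entries of the inverse depend smoothly on the matrix.
\<close>

lemma matrix_inv_entry:
  fixes M :: "real^'n::finite^'n"
  assumes "det M \<noteq> 0"
  shows "matrix_inv M $ i $ j = det (\<chi> k l. if l = i then axis j 1 $ k else M $ k $ l) * inverse (det M)"
proof -
  have "M *v column j (matrix_inv M) = column j (M ** matrix_inv M)"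
    by (simp add: vec_eq_iff matrix_matrix_mult_def matrix_vector_mult_def column_def)
  also have "\<dots> = axis j 1"
    by (simp add: matrix_inv_mult[OF assms] vec_eq_iff column_def mat_def axis_def)
  finally have "M *v column j (matrix_inv M) = axis j 1" .
  then show ?thesis
    using cramer[OF assms, of "column j (matrix_inv M)" "axis j 1"]
    by (simp add: column_def vec_eq_iff divide_inverse)
qed

lemma smooth_on_matrix_inv:
  fixes M :: "'a::real_normed_vector \<Rightarrow> real^'n::finite^'n"
  assumes M: "\<And>i j. smooth_on S (\<lambda>x. M x $ i $ j)" and nz: "\<And>x. x \<in> S \<Longrightarrow> det (M x) \<noteq> 0"
  shows "smooth_on S (\<lambda>x. matrix_inv (M x) $ i $ j)"
proof -
  have "smooth_on S (\<lambda>x. det (\<chi> k l. if l = i then axis j 1 $ k else M x $ k $ l) * inverse (det (M x)))"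
  proof -
    have "smooth_on S (\<lambda>x. (\<chi> k l. if l = i then axis j 1 $ k else M x $ k $ l) $ k $ l)" for k l
      by (cases "l = i") (simp_all add: M smooth_on_const)
    then show ?thesis by (intro smooth_on_mult smooth_on_det smooth_on_inverse nz M)
  qed
  then show ?thesis by (rule smooth_on_cong) (simp add: matrix_inv_entry nz)
qed

section \<open>Germs of smooth functions\<close>

lemma frechet_derivative_cong_open:
  assumes "open S" "x \<in> S" "\<And>y. y \<in> S \<Longrightarrow> f y = g y"
  shows "frechet_derivative f (at x) = frechet_derivative g (at x)"
proof -
  have "(f has_derivative f') (at x) \<longleftrightarrow> (g has_derivative f') (at x)" for f'
    using assms has_derivative_transform_within_open[of f f' x UNIV S g]
      has_derivative_transform_within_open[of g f' x UNIV S f] by auto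
  then show ?thesis unfolding frechet_derivative_def by simp
qed

lemma frechet_derivative_shift:
  "frechet_derivative (\<lambda>y. f (a + y)) (at x) = frechet_derivative f (at (a + x))"
proof -
  have "((\<lambda>y. f (a + y)) has_derivative f') (at x) \<longleftrightarrow> (f has_derivative f') (at (a + x))" for f'
  proof
    assume *: "(f has_derivative f') (at (a + x))"
    show "((\<lambda>y. f (a + y)) has_derivative f') (at x)"
      by (rule has_derivative_compose[of "\<lambda>y. a + y" "\<lambda>v. v" x UNIV f f'])
        (use * in \<open>auto intro!: derivative_eq_intros\<close>)
  next
    assume *: "((\<lambda>y. f (a + y)) has_derivative f') (at x)"
    have "((\<lambda>y. f (a + (y - a))) has_derivative f') (at (a + x))"
      by (rule has_derivative_compose[of "\<lambda>y. y - a" "\<lambda>v. v" "a + x" UNIV "\<lambda>y. f (a + y)" f'])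
        (use * in \<open>auto intro!: derivative_eq_intros\<close>)
    then show "(f has_derivative f') (at (a + x))" by simp
  qed
  then show ?thesis unfolding frechet_derivative_def by simp
qed

definition smooth_at :: "'a::real_normed_vector \<Rightarrow> ('a \<Rightarrow> 'b::real_normed_vector) \<Rightarrow> bool" where
  "smooth_at z f \<longleftrightarrow> (\<exists>S. open S \<and> z \<in> S \<and> smooth_on S f)"

lemma smooth_atI: "smooth_on S f \<Longrightarrow> open S \<Longrightarrow> z \<in> S \<Longrightarrow> smooth_at z f"
  unfolding smooth_at_def by auto

lemma smooth_at_cong:
  assumes "smooth_at z f" "\<forall>\<^sub>F w in nhds z. g w = f w"
  shows "smooth_at z g"
proof -
  obtain S where S: "open S" "z \<in> S" "smooth_on S f" using assms unfolding smooth_at_def by auto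
  obtain T where T: "open T" "z \<in> T" "\<And>w. w \<in> T \<Longrightarrow> g w = f w"
    using assms(2) unfolding eventually_nhds by auto
  have "smooth_on (S \<inter> T) g"
    by (rule smooth_on_cong[OF smooth_on_subset[OF S(3)]]) (use T in auto)
  then show ?thesis using S T by (intro smooth_atI[of "S \<inter> T"]) auto
qed

lemma smooth_at_const: "smooth_at z (\<lambda>w. c)"
  by (rule smooth_atI[OF smooth_on_const open_UNIV]) simp

lemma smooth_at_binary:
  assumes "\<And>S. smooth_on S f \<Longrightarrow> smooth_on S g \<Longrightarrow> smooth_on S h"
  shows "smooth_at z f \<Longrightarrow> smooth_at z g \<Longrightarrow> smooth_at z h"
proof -
  assume "smooth_at z f" "smooth_at z g"
  then obtain S T where S: "open S" "z \<in> S" "smooth_on S f" and T: "open T" "z \<in> T" "smooth_on T g"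
    unfolding smooth_at_def by auto
  have "smooth_on (S \<inter> T) h"
    by (intro assms smooth_on_subset[OF S(3)] smooth_on_subset[OF T(3)]) auto
  then show ?thesis using S T by (intro smooth_atI[of "S \<inter> T"]) auto
qed

lemma smooth_at_unary:
  assumes "\<And>S. open S \<Longrightarrow> smooth_on S f \<Longrightarrow> smooth_on S g"
  shows "smooth_at z f \<Longrightarrow> smooth_at z g"
  unfolding smooth_at_def using assms by blast

lemma smooth_at_add: "smooth_at z f \<Longrightarrow> smooth_at z g \<Longrightarrow> smooth_at z (\<lambda>w. f w + g w)"
  by (rule smooth_at_binary[OF smooth_on_add])

lemma smooth_at_mult:
  fixes f g :: "'a::real_normed_vector \<Rightarrow> real"
  shows "smooth_at z f \<Longrightarrow> smooth_at z g \<Longrightarrow> smooth_at z (\<lambda>w. f w * g w)"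
  by (rule smooth_at_binary[OF smooth_on_mult])

lemma smooth_at_minus: "smooth_at z f \<Longrightarrow> smooth_at z (\<lambda>w. - f w)"
  by (rule smooth_at_unary[OF smooth_on_minus])

lemma smooth_at_diff: "smooth_at z f \<Longrightarrow> smooth_at z g \<Longrightarrow> smooth_at z (\<lambda>w. f w - g w)"
  by (rule smooth_at_binary[OF smooth_on_diff])

lemma smooth_at_scaleR: "smooth_at z f \<Longrightarrow> smooth_at z (\<lambda>w. r *\<^sub>R f w)"
  by (rule smooth_at_unary[OF smooth_on_scaleR])

lemma smooth_at_frechet: "smooth_at z f \<Longrightarrow> smooth_at z (\<lambda>w. frechet_derivative f (at w) v)"
  by (rule smooth_at_unary[OF smooth_on_frechet_derivative])

lemma smooth_at_compose:
  fixes g :: "'c::real_normed_vector \<Rightarrow> 'a::euclidean_space" and f :: "'a \<Rightarrow> real"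
  assumes "smooth_at (g z) f" "smooth_at z g"
  shows "smooth_at z (\<lambda>w. f (g w))"
proof -
  obtain S T where S: "open S" "g z \<in> S" "smooth_on S f" and T: "open T" "z \<in> T" "smooth_on T g"
    using assms unfolding smooth_at_def by auto
  have o: "open (T \<inter> g -` S)"
    using continuous_open_preimage[OF smooth_on_imp_continuous_on[OF T(3)] T(1) S(1)] .
  have "smooth_on (T \<inter> g -` S) (\<lambda>w. f (g w))"
    by (rule smooth_on_compose[OF S(3) smooth_on_subset[OF T(3)]]) auto
  then show ?thesis using S T by (intro smooth_atI[OF _ o]) auto
qed

lemma smooth_at_shift:
  fixes f :: "'a::euclidean_space \<Rightarrow> real"
  assumes "smooth_at (a + z) f" shows "smooth_at z (\<lambda>w. f (a + w))"
proof (rule smooth_at_compose[of "\<lambda>w. a + w" z f, OF assms])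
  show "smooth_at z (\<lambda>w. a + w)"
    by (rule smooth_atI[OF smooth_on_add[OF smooth_on_const smooth_on_bounded_linear[OF bounded_linear_ident]] open_UNIV])
      simp
qed

lemma smooth_at_eventually: "smooth_at z f \<Longrightarrow> \<forall>\<^sub>F w in nhds z. smooth_at w f"
  unfolding smooth_at_def eventually_nhds by blast

text \<open>
  Germs are taken at the origin of space-time; functions near other points are translated to the
  origin. So a single type serves all points.
\<close>

type_synonym 'n spacetime = "real \<times> (real^'n)"

definition germ_rel :: "('n::finite spacetime \<Rightarrow> real) \<Rightarrow> ('n spacetime \<Rightarrow> real) \<Rightarrow> bool" where
  "germ_rel f g \<longleftrightarrow> smooth_at 0 f \<and> smooth_at 0 g \<and> (\<forall>\<^sub>F z in nhds 0. f z = g z)"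

lemma germ_relI: "smooth_at 0 f \<Longrightarrow> \<forall>\<^sub>F z in nhds 0. f z = g z \<Longrightarrow> germ_rel f g"
  unfolding germ_rel_def by (auto elim!: eventually_mono intro: smooth_at_cong)

quotient_type 'n germ = "'n::finite spacetime \<Rightarrow> real" / partial: germ_rel
proof (rule part_equivpI)
  show "\<exists>f. germ_rel f f"
    by (intro exI[of _ "\<lambda>_. 0"]) (auto simp: germ_rel_def smooth_at_const)
  show "symp germ_rel"
    by (auto simp: symp_def germ_rel_def elim: eventually_mono)
  show "transp germ_rel"
    by (auto simp: transp_def germ_rel_def elim: eventually_elim2)
qed

instantiation germ :: (finite) "{comm_ring_1,real_algebra_1}"
begin

lift_definition zero_germ :: "'a germ" is "\<lambda>_. 0" by (auto simp: germ_rel_def smooth_at_const)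
lift_definition one_germ :: "'a germ" is "\<lambda>_. 1" by (auto simp: germ_rel_def smooth_at_const)
lift_definition plus_germ :: "'a germ \<Rightarrow> 'a germ \<Rightarrow> 'a germ" is "\<lambda>f g z. f z + g z"
  by (auto simp: germ_rel_def smooth_at_add elim: eventually_elim2)
lift_definition minus_germ :: "'a germ \<Rightarrow> 'a germ \<Rightarrow> 'a germ" is "\<lambda>f g z. f z - g z"
  by (auto simp: germ_rel_def smooth_at_diff elim: eventually_elim2)
lift_definition times_germ :: "'a germ \<Rightarrow> 'a germ \<Rightarrow> 'a germ" is "\<lambda>f g z. f z * g z"
  by (auto simp: germ_rel_def smooth_at_mult elim: eventually_elim2)
lift_definition uminus_germ :: "'a germ \<Rightarrow> 'a germ" is "\<lambda>f z. - f z"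
  by (auto simp: germ_rel_def smooth_at_minus elim: eventually_mono)
lift_definition scaleR_germ :: "real \<Rightarrow> 'a germ \<Rightarrow> 'a germ" is "\<lambda>r f z. r *\<^sub>R f z"
  by (auto simp: germ_rel_def elim: eventually_mono intro: smooth_at_mult smooth_at_const)

instance
proof
  show "(0::'a germ) \<noteq> 1"
    by transfer (auto simp: germ_rel_def dest: eventually_nhds_x_imp_x)
qed (transfer; auto simp: germ_rel_def algebra_simps
    intro!: smooth_at_add smooth_at_mult smooth_at_minus smooth_at_diff smooth_at_scaleR smooth_at_const)+

end

lift_definition germ_D :: "'n::finite spacetime \<Rightarrow> 'n germ \<Rightarrow> 'n germ"
  is "\<lambda>v f z. frechet_derivative f (at z) v"
proof -
  fix v and f g :: "'n spacetime \<Rightarrow> real"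
  assume "germ_rel f g"
  then obtain T where fg: "smooth_at 0 f" "smooth_at 0 g" and T: "open T" "0 \<in> T" "\<And>z. z \<in> T \<Longrightarrow> f z = g z"
    unfolding germ_rel_def eventually_nhds by auto
  show "germ_rel (\<lambda>z. frechet_derivative f (at z) v) (\<lambda>z. frechet_derivative g (at z) v)"
    unfolding germ_rel_def eventually_nhds using T fg
    by (auto intro!: smooth_at_frechet exI[of _ T] simp: frechet_derivative_cong_open[OF T(1) _ T(3)])
qed

lift_definition germ_ev :: "'n::finite germ \<Rightarrow> real" is "\<lambda>f. f 0"
  unfolding germ_rel_def by (auto dest: eventually_nhds_x_imp_x)

text \<open>
  The smoothness of \<open>f\<close> is included, so that one set of closure rules proves that an expression is
  smooth and computes its germ.
\<close>

definition has_germ :: "'n::finite spacetime \<Rightarrow> ('n spacetime \<Rightarrow> real) \<Rightarrow> 'n germ \<Rightarrow> bool" where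
  "has_germ z f a \<longleftrightarrow> smooth_at z f \<and> a = abs_germ (\<lambda>w. f (z + w))"

lemma germ_rel_shift: "smooth_at z f \<Longrightarrow> germ_rel (\<lambda>w. f (z + w)) (\<lambda>w. f (z + w))"
  unfolding germ_rel_def using smooth_at_shift[of z 0 f] by simp

lemma has_germ_exists: "\<exists>f. has_germ 0 f a"
proof -
  have "germ_rel (rep_germ a) (rep_germ a)"
    using Quotient_rep_reflp[OF Quotient_germ] .
  moreover have "a = abs_germ (rep_germ a)"
    by (simp add: Quotient_abs_rep[OF Quotient_germ])
  ultimately show ?thesis by (intro exI[of _ "rep_germ a"]) (simp add: has_germ_def germ_rel_def)
qed

lemma has_germ_smooth: "smooth_at z f \<Longrightarrow> \<exists>a. has_germ z f a"
  unfolding has_germ_def by auto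

lemma has_germ_unique: "has_germ z f a \<Longrightarrow> has_germ z f b \<Longrightarrow> a = b"
  unfolding has_germ_def by auto

lemma has_germ_cong:
  assumes "has_germ z f a" "\<forall>\<^sub>F w in nhds z. g w = f w"
  shows "has_germ z g a"
proof -
  have g: "smooth_at z g" using assms smooth_at_cong unfolding has_germ_def by blast
  have "filtermap (\<lambda>w. z + w) (nhds 0) = nhds z"
    using filtermap_nhds_shift[of "- z" 0] by (simp add: add.commute)
  then have "\<forall>\<^sub>F w in filtermap (\<lambda>w. z + w) (nhds 0). g w = f w"
    using assms(2) by simp
  then have "\<forall>\<^sub>F w in nhds 0. g (z + w) = f (z + w)"
    by (simp only: eventually_filtermap)
  then have "germ_rel (\<lambda>w. g (z + w)) (\<lambda>w. f (z + w))"
    using germ_rel_shift[OF g] by (intro germ_relI) (auto simp: germ_rel_def)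
  then have "abs_germ (\<lambda>w. g (z + w)) = abs_germ (\<lambda>w. f (z + w))"
    using Quotient_rel_abs[OF Quotient_germ] by blast
  then show ?thesis using g assms(1) unfolding has_germ_def by simp
qed

lemma has_germ_const: "has_germ z (\<lambda>w. c) (c *\<^sub>R 1)"
proof -
  have "c *\<^sub>R 1 = abs_germ (\<lambda>w. c)"
    unfolding one_germ_def by (subst scaleR_germ.abs_eq) (auto simp: eq_onp_def germ_rel_def smooth_at_const)
  then show ?thesis by (simp add: has_germ_def smooth_at_const)
qed

lemma has_germ_add: "has_germ z f a \<Longrightarrow> has_germ z g b \<Longrightarrow> has_germ z (\<lambda>w. f w + g w) (a + b)"
  unfolding has_germ_def
  by (auto simp: smooth_at_add plus_germ.abs_eq germ_rel_shift)

lemma has_germ_diff: "has_germ z f a \<Longrightarrow> has_germ z g b \<Longrightarrow> has_germ z (\<lambda>w. f w - g w) (a - b)"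
  unfolding has_germ_def
  by (auto simp: smooth_at_diff minus_germ.abs_eq germ_rel_shift)

lemma has_germ_mult: "has_germ z f a \<Longrightarrow> has_germ z g b \<Longrightarrow> has_germ z (\<lambda>w. f w * g w) (a * b)"
  unfolding has_germ_def
  by (auto simp: smooth_at_mult times_germ.abs_eq germ_rel_shift)

lemma has_germ_minus: "has_germ z f a \<Longrightarrow> has_germ z (\<lambda>w. - f w) (- a)"
  unfolding has_germ_def
  by (auto simp: smooth_at_minus uminus_germ.abs_eq germ_rel_shift)

lemma has_germ_scaleR: "has_germ z f a \<Longrightarrow> has_germ z (\<lambda>w. r * f w) (r *\<^sub>R a)"
  unfolding has_germ_def
  using smooth_at_scaleR[of z f r] by (auto simp: scaleR_germ.abs_eq germ_rel_shift)

lemma has_germ_0: "has_germ z (\<lambda>w. 0) 0"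
  using has_germ_const[of z 0] by simp

lemma has_germ_1: "has_germ z (\<lambda>w. 1) 1"
  using has_germ_const[of z 1] by simp

lemma has_germ_sum:
  "(\<And>s. s \<in> A \<Longrightarrow> has_germ z (f s) (a s)) \<Longrightarrow> has_germ z (\<lambda>w. \<Sum>s\<in>A. f s w) (\<Sum>s\<in>A. a s)"
  by (induction A rule: infinite_finite_induct) (auto intro: has_germ_0 has_germ_add)

lemma has_germ_D: "has_germ z f a \<Longrightarrow> has_germ z (\<lambda>w. frechet_derivative f (at w) v) (germ_D v a)"
  unfolding has_germ_def
  by (auto simp: smooth_at_frechet germ_D.abs_eq germ_rel_shift frechet_derivative_shift)

lemma has_germ_ev: "has_germ z f a \<Longrightarrow> germ_ev a = f z"
  unfolding has_germ_def by (auto simp: germ_ev.abs_eq germ_rel_shift)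

lemma has_germ_shift: "has_germ z f a \<Longrightarrow> has_germ 0 (\<lambda>w. f (z + w)) a"
  unfolding has_germ_def using smooth_at_shift[of z 0 f] by simp

lemma germ_eqI:
  assumes "has_germ z f a" "has_germ z g b" "\<forall>\<^sub>F w in nhds z. f w = g w"
  shows "a = b"
proof -
  have "has_germ z f b" using assms(3) by (rule has_germ_cong[OF assms(2)])
  then show ?thesis using assms(1) has_germ_unique by blast
qed

lemma germ_ev_simps:
  "germ_ev (a + b) = germ_ev a + germ_ev b" "germ_ev (a * b) = germ_ev a * germ_ev b"
  "germ_ev (r *\<^sub>R a) = r * germ_ev a" "germ_ev 1 = 1"
  by (transfer; simp)+

lemma germ_ev_linear:
  "germ_ev (0 :: 'n::finite germ) = 0" "germ_ev (- a) = - germ_ev a" "germ_ev (a - b) = germ_ev a - germ_ev (b :: 'n germ)"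
  "germ_ev (sum F S) = (\<Sum>s\<in>S. germ_ev (F s :: 'n germ))"
proof -
  show z: "germ_ev (0 :: 'n germ) = 0" using germ_ev_simps(3)[of 0 0] by simp
  show m: "germ_ev (- a) = - germ_ev a" for a :: "'n germ" using germ_ev_simps(3)[of "-1" a] by simp
  show "germ_ev (a - b) = germ_ev a - germ_ev b" using germ_ev_simps(1)[of a "- b"] by (simp add: m)
  show "germ_ev (sum F S) = (\<Sum>s\<in>S. germ_ev (F s :: 'n germ))"
    by (induction S rule: infinite_finite_induct) (simp_all add: germ_ev_simps z)
qed

lemma smooth_at_has_derivative:
  "smooth_at z f \<Longrightarrow> (f has_derivative frechet_derivative f (at z)) (at z)"
  unfolding smooth_at_def using has_derivative_frechet by blast

lemma germ_D_simps:
  fixes x y :: "'n::finite germ"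
  shows germ_D_add: "germ_D v (x + y) = germ_D v x + germ_D v y"
    and germ_D_mult: "germ_D v (x * y) = germ_D v x * y + x * germ_D v y"
    and germ_D_scaleR: "germ_D v (r *\<^sub>R x) = r *\<^sub>R germ_D v x"
    and germ_D_commute: "germ_D v (germ_D w x) = germ_D w (germ_D v x)"
proof -
  obtain f g where f: "has_germ 0 f x" and g: "has_germ 0 g y" using has_germ_exists by metis
  have ev: "\<forall>\<^sub>F z in nhds 0. smooth_at z f \<and> smooth_at z g"
    using f g unfolding has_germ_def by (simp add: eventually_conj_iff smooth_at_eventually)
  show "germ_D v (x + y) = germ_D v x + germ_D v y"
  proof (rule germ_eqI[OF has_germ_D[OF has_germ_add[OF f g]] has_germ_add[OF has_germ_D[OF f] has_germ_D[OF g]]])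
    show "\<forall>\<^sub>F z in nhds 0. frechet_derivative (\<lambda>y. f y + g y) (at z) v
        = frechet_derivative f (at z) v + frechet_derivative g (at z) v"
      using ev
    proof (rule eventually_mono)
      fix z assume "smooth_at z f \<and> smooth_at z g"
      then have "((\<lambda>y. f y + g y) has_derivative (\<lambda>v. frechet_derivative f (at z) v + frechet_derivative g (at z) v)) (at z)"
        by (intro has_derivative_add smooth_at_has_derivative) auto
      then show "frechet_derivative (\<lambda>y. f y + g y) (at z) v
        = frechet_derivative f (at z) v + frechet_derivative g (at z) v"
        by (simp add: frechet_derivative_at[symmetric])
    qed
  qed
  show "germ_D v (x * y) = germ_D v x * y + x * germ_D v y"
  proof (rule germ_eqI[OF has_germ_D[OF has_germ_mult[OF f g]]
        has_germ_add[OF has_germ_mult[OF has_germ_D[OF f] g] has_germ_mult[OF f has_germ_D[OF g]]]])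
    show "\<forall>\<^sub>F z in nhds 0. frechet_derivative (\<lambda>y. f y * g y) (at z) v
        = frechet_derivative f (at z) v * g z + f z * frechet_derivative g (at z) v"
      using ev
    proof (rule eventually_mono)
      fix z assume "smooth_at z f \<and> smooth_at z g"
      then have "((\<lambda>y. f y * g y) has_derivative (\<lambda>v. f z * frechet_derivative g (at z) v + frechet_derivative f (at z) v * g z)) (at z)"
        by (intro has_derivative_mult smooth_at_has_derivative) auto
      then show "frechet_derivative (\<lambda>y. f y * g y) (at z) v
        = frechet_derivative f (at z) v * g z + f z * frechet_derivative g (at z) v"
        by (simp add: frechet_derivative_at[symmetric])
    qed
  qed
  show "germ_D v (r *\<^sub>R x) = r *\<^sub>R germ_D v x"
  proof (rule germ_eqI[OF has_germ_D[OF has_germ_scaleR[OF f]] has_germ_scaleR[OF has_germ_D[OF f]]])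
    show "\<forall>\<^sub>F z in nhds 0. frechet_derivative (\<lambda>y. r * f y) (at z) v = r * frechet_derivative f (at z) v"
      using ev
    proof (rule eventually_mono)
      fix z assume "smooth_at z f \<and> smooth_at z g"
      then have "((\<lambda>y. r * f y) has_derivative (\<lambda>v. r * frechet_derivative f (at z) v)) (at z)"
        by (intro has_derivative_mult_right smooth_at_has_derivative) auto
      then show "frechet_derivative (\<lambda>y. r * f y) (at z) v = r * frechet_derivative f (at z) v"
        by (simp add: frechet_derivative_at[symmetric])
    qed
  qed
  show "germ_D v (germ_D w x) = germ_D w (germ_D v x)"
  proof (rule germ_eqI[OF has_germ_D[OF has_germ_D[OF f]] has_germ_D[OF has_germ_D[OF f]]])
    show "\<forall>\<^sub>F z in nhds 0. frechet_derivative (\<lambda>y. frechet_derivative f (at y) w) (at z) v =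
       frechet_derivative (\<lambda>y. frechet_derivative f (at y) v) (at z) w"
      using ev
    proof (rule eventually_mono)
      fix z assume "smooth_at z f \<and> smooth_at z g"
      then obtain S where "open S" "z \<in> S" "smooth_on S f" unfolding smooth_at_def by auto
      then show "frechet_derivative (\<lambda>y. frechet_derivative f (at y) w) (at z) v =
         frechet_derivative (\<lambda>y. frechet_derivative f (at y) v) (at z) w"
        by (intro frechet_derivative_commute)
    qed
  qed
qed

abbreviation space_D :: "'n::finite \<Rightarrow> 'n germ \<Rightarrow> 'n germ" where
  "space_D i \<equiv> germ_D (0, axis i 1)"

abbreviation time_D :: "'n::finite germ \<Rightarrow> 'n germ" where
  "time_D \<equiv> germ_D (1, 0)"

lemma derivations_space_D: "derivations space_D"
  by (rule derivations.intro) (rule germ_D_simps)+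

text \<open>
  Composition with a change of the space coordinates. The time coordinate is kept, so that the
  pull-back commutes with the time derivative (\<open>time_D_pull\<close>).
\<close>

definition germ_pull :: "(real^'n \<Rightarrow> real^'n) \<Rightarrow> 'n::finite germ \<Rightarrow> 'n germ" where
  "germ_pull p a = abs_germ (\<lambda>z. rep_germ a (fst z, p (snd z)))"

lemma smooth_on_snd:
  fixes p :: "'b::euclidean_space \<Rightarrow> 'c::euclidean_space"
  assumes "smooth_on U p"
  shows "smooth_on (A \<times> U) (\<lambda>z. p (snd z))"
proof (rule smooth_on_euclidean)
  fix b :: 'c
  have "smooth_on U (\<lambda>y. p y \<bullet> b)" by (rule smooth_on_linear[OF bounded_linear_inner_left assms])
  then show "smooth_on (A \<times> U) (\<lambda>z. p (snd z) \<bullet> b)"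
    by (rule smooth_on_compose[OF _ smooth_on_bounded_linear[OF bounded_linear_snd]]) auto
qed

lemma smooth_at_space_map:
  fixes p :: "real^'n::finite \<Rightarrow> real^'n" and z :: "'n spacetime"
  assumes "smooth_at (snd z) p"
  shows "smooth_at z (\<lambda>z. (fst z, p (snd z)))"
proof -
  obtain U where U: "open U" "snd z \<in> U" "smooth_on U p" using assms unfolding smooth_at_def by auto
  have "smooth_on ((UNIV :: real set) \<times> U) (\<lambda>z. (fst z, p (snd z)))"
    by (intro smooth_on_Pair smooth_on_bounded_linear[OF bounded_linear_fst] smooth_on_snd U(3))
  then show ?thesis
    by (rule smooth_atI) (use U in \<open>auto simp: open_Times mem_Times_iff\<close>)
qed

lemma space_map_tendsto:
  fixes p :: "real^'n::finite \<Rightarrow> real^'n"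
  assumes "smooth_at 0 p" "p 0 = 0"
  shows "filterlim (\<lambda>z. (fst z, p (snd z))) (nhds 0) (nhds (0 :: 'n spacetime))"
proof -
  have "isCont (\<lambda>z. (fst z, p (snd z))) (0 :: 'n spacetime)"
    using smooth_at_has_derivative[OF smooth_at_space_map[of "0 :: 'n spacetime" p]] assms
    by (auto dest: has_derivative_continuous)
  then have "filterlim (\<lambda>z. (fst z, p (snd z))) (nhds (fst (0 :: 'n spacetime), p (snd (0 :: 'n spacetime)))) (nhds 0)"
    using isCont_def tendsto_at_iff_tendsto_nhds by blast
  then show ?thesis using assms by (simp add: zero_prod_def)
qed

lemma has_germ_pull:
  fixes p :: "real^'n::finite \<Rightarrow> real^'n"
  assumes p: "smooth_at 0 p" "p 0 = 0" and f: "has_germ 0 f a"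
  shows "has_germ 0 (\<lambda>z. f (fst z, p (snd z))) (germ_pull p a)"
proof -
  have "germ_rel f f" using f germ_rel_shift[of 0 f] unfolding has_germ_def by simp
  then have "germ_rel (rep_germ a) f"
    using f Quotient_rep_abs[OF Quotient_germ, of f] unfolding has_germ_def by simp
  then have "\<forall>\<^sub>F z in nhds 0. rep_germ a z = f z" unfolding germ_rel_def by simp
  then have *: "\<forall>\<^sub>F z in nhds 0. rep_germ a (fst z, p (snd z)) = f (fst z, p (snd z))"
    using space_map_tendsto[OF p] by (rule eventually_compose_filterlim)
  have "smooth_at 0 (\<lambda>z. f (fst z, p (snd z)))"
    by (rule smooth_at_compose[of "\<lambda>z. (fst z, p (snd z))"])
      (use p f in \<open>auto simp: has_germ_def zero_prod_def[symmetric] intro: smooth_at_space_map\<close>)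
  then have "has_germ 0 (\<lambda>z. f (fst z, p (snd z))) (abs_germ (\<lambda>z. f (fst z, p (snd z))))"
    by (simp add: has_germ_def)
  then have "has_germ 0 (\<lambda>z. rep_germ a (fst z, p (snd z))) (abs_germ (\<lambda>z. f (fst z, p (snd z))))"
    using * by (rule has_germ_cong)
  then have "germ_pull p a = abs_germ (\<lambda>z. f (fst z, p (snd z)))"
    by (simp add: has_germ_def germ_pull_def)
  with \<open>has_germ 0 (\<lambda>z. f (fst z, p (snd z))) _\<close> show ?thesis by simp
qed

locale space_map =
  fixes p :: "real^'n::finite \<Rightarrow> real^'n" and P :: "'n \<Rightarrow> 'n germ"
  assumes smooth_p: "smooth_at 0 p" and p_0: "p 0 = 0"
    and P: "has_germ 0 (\<lambda>z. p (snd z) $ k) (P k)"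
begin

lemmas hpull = has_germ_pull[OF smooth_p p_0]

lemma germ_pull_simps:
  "germ_pull p (a + b) = germ_pull p a + germ_pull p b"
  "germ_pull p (a * b) = germ_pull p a * germ_pull p b"
  "germ_pull p (r *\<^sub>R a) = r *\<^sub>R germ_pull p a"
  "germ_pull p 1 = 1"
  "germ_ev (germ_pull p a) = germ_ev a"
proof -
  obtain f g where f: "has_germ 0 f a" and g: "has_germ 0 g b" using has_germ_exists by metis
  show "germ_pull p (a + b) = germ_pull p a + germ_pull p b"
    by (rule has_germ_unique[OF hpull[OF has_germ_add[OF f g]] has_germ_add[OF hpull[OF f] hpull[OF g]]])
  show "germ_pull p (a * b) = germ_pull p a * germ_pull p b"
    by (rule has_germ_unique[OF hpull[OF has_germ_mult[OF f g]] has_germ_mult[OF hpull[OF f] hpull[OF g]]])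
  show "germ_pull p (r *\<^sub>R a) = r *\<^sub>R germ_pull p a"
    by (rule has_germ_unique[OF hpull[OF has_germ_scaleR[OF f]] has_germ_scaleR[OF hpull[OF f]]])
  show "germ_pull p 1 = 1"
    by (rule has_germ_unique[OF hpull[OF has_germ_1] has_germ_1])
  show "germ_ev (germ_pull p a) = germ_ev a"
    using has_germ_ev[OF hpull[OF f]] has_germ_ev[OF f] by (simp add: p_0 zero_prod_def)
qed

lemma ev_smooth: "\<forall>\<^sub>F z in nhds (0 :: 'n spacetime). smooth_at (snd z) p"
proof -
  have "filterlim snd (nhds (0::real^'n)) (nhds (0 :: 'n spacetime))"
    using tendsto_snd[OF filterlim_ident[of "nhds (0 :: 'n spacetime)"]] by simp
  with smooth_at_eventually[OF smooth_p] show ?thesis by (rule eventually_compose_filterlim)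
qed

lemma ev_smooth_f:
  assumes f: "has_germ 0 f a"
  shows "\<forall>\<^sub>F z in nhds (0 :: 'n spacetime). smooth_at (fst z, p (snd z)) f"
proof -
  have "\<forall>\<^sub>F z in nhds 0. smooth_at z f" using f smooth_at_eventually unfolding has_germ_def by blast
  then show ?thesis using space_map_tendsto[OF smooth_p p_0] by (rule eventually_compose_filterlim)
qed

lemma chain_rule_at:
  assumes "smooth_at (snd z) p" "smooth_at (fst z, p (snd z)) f"
  shows "frechet_derivative (\<lambda>z. f (fst z, p (snd z))) (at z) v
      = fst v * frechet_derivative f (at (fst z, p (snd z))) (1, 0)
        + (\<Sum>\<^sub>U k. frechet_derivative (\<lambda>z. p (snd z) $ k) (at z) v
             * frechet_derivative f (at (fst z, p (snd z))) (0, axis k 1))"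
    and "fst v = 1 \<Longrightarrow> snd v = 0 \<Longrightarrow> frechet_derivative (\<lambda>z. p (snd z) $ k) (at z) v = 0"
proof -
  let ?p' = "frechet_derivative p (at (snd z))" and ?f' = "frechet_derivative f (at (fst z, p (snd z)))"
  have p: "(p has_derivative ?p') (at (snd z))" and f: "(f has_derivative ?f') (at (fst z, p (snd z)))"
    using assms smooth_at_has_derivative by auto
  have "((\<lambda>z. p (snd z)) has_derivative (\<lambda>v. ?p' (snd v))) (at z)"
    by (rule has_derivative_compose[of snd snd z UNIV p ?p'])
      (use p in \<open>auto intro!: derivative_eq_intros\<close>)
  note ps = this
  have pk: "((\<lambda>z. p (snd z) $ k) has_derivative (\<lambda>v. ?p' (snd v) $ k)) (at z)" for k
    by (rule bounded_linear.has_derivative[OF bounded_linear_vec_nth ps])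
  have "((\<lambda>z. (fst z, p (snd z))) has_derivative (\<lambda>v. (fst v, ?p' (snd v)))) (at z)"
    by (rule has_derivative_Pair[OF has_derivative_fst[OF has_derivative_ident] ps])
  from has_derivative_compose[of _ _ z UNIV f ?f', OF this f]
  have 1: "((\<lambda>z. f (fst z, p (snd z))) has_derivative (\<lambda>v. ?f' (fst v, ?p' (snd v)))) (at z)" .
  have lin: "linear ?f'" using f has_derivative_linear by blast
  have "(a, b) = a *\<^sub>R (1, 0) + (\<Sum>\<^sub>U k. (b $ k) *\<^sub>R (0, axis k 1))" for a :: real and b :: "real^'n"
    by (simp add: prod_eq_iff fst_sum snd_sum scaleR_prod_def)
      (simp add: vec_eq_iff axis_def if_distrib[of "\<lambda>x. _ * x"] cong: if_cong)
  then have "?f' (fst v, ?p' (snd v)) = ?f' (fst v *\<^sub>R (1, 0) + (\<Sum>\<^sub>U k. (?p' (snd v) $ k) *\<^sub>R (0, axis k 1)))"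
    by metis
  then have 2: "?f' (fst v, ?p' (snd v)) = fst v * ?f' (1, 0) + (\<Sum>\<^sub>U k. ?p' (snd v) $ k * ?f' (0, axis k 1))"
    by (simp only: linear_add[OF lin] linear_sum[OF lin] linear_cmul[OF lin] real_scaleR_def)
  show "frechet_derivative (\<lambda>z. f (fst z, p (snd z))) (at z) v
      = fst v * ?f' (1, 0) + (\<Sum>\<^sub>U k. frechet_derivative (\<lambda>z. p (snd z) $ k) (at z) v * ?f' (0, axis k 1))"
    unfolding frechet_derivative_at[OF 1, symmetric] frechet_derivative_at[OF pk, symmetric] 2 ..
  show "fst v = 1 \<Longrightarrow> snd v = 0 \<Longrightarrow> frechet_derivative (\<lambda>z. p (snd z) $ k) (at z) v = 0"
    unfolding frechet_derivative_at[OF pk, symmetric]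
    using linear_0[OF has_derivative_linear[OF p]] by simp
qed

lemma chain_rule:
  shows space_D_pull: "space_D i (germ_pull p a) = (\<Sum>\<^sub>U k. space_D i (P k) * germ_pull p (space_D k a))"
    and time_D_pull: "time_D (germ_pull p a) = germ_pull p (time_D a)"
    and time_D_P: "time_D (P k) = 0"
proof -
  obtain f where f: "has_germ 0 f a" using has_germ_exists by metis
  have ev: "\<forall>\<^sub>F z in nhds (0 :: 'n spacetime). smooth_at (snd z) p \<and> smooth_at (fst z, p (snd z)) f"
    using ev_smooth ev_smooth_f[OF f] by (rule eventually_conj)
  show "space_D i (germ_pull p a) = (\<Sum>\<^sub>U k. space_D i (P k) * germ_pull p (space_D k a))"
    by (rule germ_eqI[OF has_germ_D[OF hpull[OF f]]
          has_germ_sum[OF has_germ_mult[OF has_germ_D[OF P] hpull[OF has_germ_D[OF f]]]]],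
        rule eventually_mono[OF ev]) (simp add: chain_rule_at(1))
  show "time_D (P k) = 0"
    by (rule germ_eqI[OF has_germ_D[OF P] has_germ_0], rule eventually_mono[OF ev]) (simp add: chain_rule_at(2)[where f = f])
  show "time_D (germ_pull p a) = germ_pull p (time_D a)"
    by (rule germ_eqI[OF has_germ_D[OF hpull[OF f]] hpull[OF has_germ_D[OF f]]],
        rule eventually_mono[OF ev]) (simp add: chain_rule_at(1) chain_rule_at(2)[where f = f])
qed

lemma frame_map:
  assumes "\<And>a b. (\<Sum>\<^sub>U i. space_D i (P a) * K i b) = (if a = b then 1 else 0)"
    and "\<And>i j. (\<Sum>\<^sub>U a. K i a * space_D j (P a)) = (if i = j then 1 else 0)"
  shows "frame_map space_D space_D (germ_pull p) (\<lambda>a i. space_D i (P a)) K"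
  by (intro frame_map.intro frame_map_axioms.intro derivations_space_D assms germ_pull_simps space_D_pull
      germ_D_commute)

end

lemma germ_matrix_inverse:
  fixes M :: "'n::finite \<Rightarrow> 'n \<Rightarrow> 'm::finite germ"
  assumes "det (\<chi> i j. germ_ev (M i j)) \<noteq> 0"
  shows "\<exists>K. (\<forall>a b. (\<Sum>\<^sub>U i. M a i * K i b) = (if a = b then 1 else 0))
    \<and> (\<forall>i j. (\<Sum>\<^sub>U a. K i a * M a j) = (if i = j then 1 else 0))"
proof -
  define f where "f i j = (SOME g. has_germ 0 g (M i j))" for i j
  have f: "has_germ 0 (f i j) (M i j)" for i j
    unfolding f_def by (rule someI_ex[OF has_germ_exists])
  define F where "F z = (\<chi> i j. f i j z)" for z
  define S where "S i j = (SOME S. open S \<and> 0 \<in> S \<and> smooth_on S (f i j))" for i j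
  have S: "open (S i j) \<and> 0 \<in> S i j \<and> smooth_on (S i j) (f i j)" for i j
    unfolding S_def by (rule someI_ex) (use f in \<open>simp add: has_germ_def smooth_at_def\<close>)
  define T where "T = (\<Inter>i\<in>UNIV. \<Inter>j\<in>UNIV. S i j)"
  have T: "open T" "0 \<in> T" unfolding T_def using S by (auto intro!: open_INT)
  have fT: "smooth_on T (\<lambda>z. F z $ i $ j)" for i j
    using smooth_on_subset[of "S i j" "f i j" T] S by (auto simp: F_def T_def)
  have detF: "smooth_on T (\<lambda>z. det (F z))" by (rule smooth_on_det[OF fT])
  define V where "V = T \<inter> (\<lambda>z. det (F z)) -` (- {0})"
  have V: "open V" unfolding V_def
    by (rule continuous_open_preimage[OF smooth_on_imp_continuous_on[OF detF] T(1)]) auto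
  have V0: "0 \<in> V" using T assms has_germ_ev[OF f] by (auto simp: V_def F_def)
  have nz: "det (F z) \<noteq> 0" if "z \<in> V" for z using that by (auto simp: V_def)
  have fV: "smooth_on V (\<lambda>z. F z $ i $ j)" for i j
    by (rule smooth_on_subset[OF fT]) (simp add: V_def)
  define K where "K i j = (SOME a. has_germ 0 (\<lambda>z. matrix_inv (F z) $ i $ j) a)" for i j
  have smF: "smooth_at 0 (\<lambda>z. matrix_inv (F z) $ i $ j)" for i j
    by (rule smooth_atI[OF smooth_on_matrix_inv[OF fV nz] V V0])
  have K: "has_germ 0 (\<lambda>z. matrix_inv (F z) $ i $ j) (K i j)" for i j
    unfolding K_def by (rule someI_ex[OF has_germ_smooth[OF smF]])
  have c: "has_germ 0 (\<lambda>z. if a = b then 1 else 0) (if a = b then 1 else 0 :: 'm germ)" for a b :: 'n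
    by (simp add: has_germ_0 has_germ_1)
  have evV: "\<forall>\<^sub>F z in nhds 0. z \<in> V" using V V0 eventually_nhds by blast
  show ?thesis
  proof (intro exI[of _ K] conjI allI)
    fix a b
    show "(\<Sum>\<^sub>U i. M a i * K i b) = (if a = b then 1 else 0)"
    proof (rule germ_eqI[OF has_germ_sum[OF has_germ_mult[OF f K]] c], rule eventually_mono[OF evV])
      fix z assume "z \<in> V"
      then have "(F z ** matrix_inv (F z)) $ a $ b = mat 1 $ a $ b" by (simp add: matrix_inv_mult nz)
      then show "(\<Sum>\<^sub>U s. f a s z * matrix_inv (F z) $ s $ b) = (if a = b then 1 else 0)"
        by (simp add: matrix_matrix_mult_def mat_def F_def)
    qed
    show "(\<Sum>\<^sub>U i. K a i * M i b) = (if a = b then 1 else 0)"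
    proof (rule germ_eqI[OF has_germ_sum[OF has_germ_mult[OF K f]] c], rule eventually_mono[OF evV])
      fix z assume "z \<in> V"
      then have "(matrix_inv (F z) ** F z) $ a $ b = mat 1 $ a $ b" by (simp add: matrix_inv_mult nz)
      then show "(\<Sum>\<^sub>U s. matrix_inv (F z) $ a $ s * f s b z) = (if a = b then 1 else 0)"
        by (simp add: matrix_matrix_mult_def mat_def F_def)
    qed
  qed
qed

section \<open>Normal coordinates\<close>

text \<open>
  The Gram-Schmidt process: fewer than \<open>CARD('n)\<close> vectors do not span, so that a further vector can
  be made orthogonal to them.
\<close>

lemma orthonormal_family:
  fixes M :: "'n::finite \<Rightarrow> 'n \<Rightarrow> real" and S :: "'n set"
  assumes sym: "\<And>a b. M a b = M b a"
    and pos: "\<And>v :: real^'n. v \<noteq> 0 \<Longrightarrow> (\<Sum>\<^sub>U a b. v $ a * v $ b * M a b) > 0"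
  shows "\<exists>w :: 'n \<Rightarrow> real^'n. \<forall>i\<in>S. \<forall>j\<in>S.
    (\<Sum>\<^sub>U a b. w i $ a * w j $ b * M a b) = (if i = j then 1 else 0)"
proof -
  define B where "B v w = (\<Sum>\<^sub>U a b. v $ a * w $ b * M a b)" for v w :: "real^'n"
  have B_sym: "B v w = B w v" for v w
    unfolding B_def by (subst sum.swap) (simp add: sym mult.commute)
  have B_add: "B (u + v) w = B u w + B v w" for u v w
    by (simp add: B_def algebra_simps sum.distrib)
  have B_scale: "B (r *\<^sub>R v) w = r * B v w" for r v w
    by (simp add: B_def algebra_simps sum_distrib_left)
  have B_0: "B 0 w = 0" for w by (simp add: B_def)
  have B_sum: "B (\<Sum>s\<in>A. f s) w = (\<Sum>s\<in>A. B (f s) w)" for f :: "'n \<Rightarrow> real^'n" and A w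
    by (induction A rule: infinite_finite_induct) (simp_all add: B_add B_0)
  have "finite S" by simp
  then have "\<exists>w :: 'n \<Rightarrow> real^'n. \<forall>i\<in>S. \<forall>j\<in>S. B (w i) (w j) = (if i = j then 1 else 0)"
  proof (induction S rule: finite_induct)
    case (insert k S)
    then obtain w where w: "\<And>i j. i \<in> S \<Longrightarrow> j \<in> S \<Longrightarrow> B (w i) (w j) = (if i = j then 1 else 0)"
      by blast
    have "dim (span (w ` S)) \<le> card (w ` S)" by (simp add: dim_le_card')
    also have "\<dots> \<le> card S" by (rule card_image_le) (rule insert)
    also have "\<dots> < CARD('n)" using insert by (intro psubset_card_mono) auto
    finally have "dim (span (w ` S)) \<noteq> dim (UNIV :: (real^'n) set)" by (simp add: dim_UNIV)
    then have "span (w ` S) \<noteq> (UNIV :: (real^'n) set)" by metis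
    then obtain x where x: "x \<notin> span (w ` S)" by blast
    define y where "y = x - (\<Sum>i\<in>S. B x (w i) *\<^sub>R w i)"
    have "(\<Sum>i\<in>S. B x (w i) *\<^sub>R w i) \<in> span (w ` S)"
      by (intro span_sum span_scale span_base) auto
    then have y0: "y \<noteq> 0" using x unfolding y_def by auto
    then have yy: "B y y > 0" unfolding B_def by (rule pos)
    have yw: "B y (w j) = 0" if "j \<in> S" for j
    proof -
      have "B y (w j) = B x (w j) - (\<Sum>i\<in>S. B x (w i) * B (w i) (w j))"
        using B_add[of y "\<Sum>i\<in>S. B x (w i) *\<^sub>R w i" "w j"]
        by (simp add: y_def B_sum B_scale)
      also have "(\<Sum>i\<in>S. B x (w i) * B (w i) (w j)) = (\<Sum>i\<in>S. if i = j then B x (w i) else 0)"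
        using w that by (intro sum.cong) auto
      finally show ?thesis using that insert.hyps by simp
    qed
    define z where "z = (1 / sqrt (B y y)) *\<^sub>R y"
    have zz: "B z z = 1"
      unfolding z_def B_scale B_sym[of y "_ *\<^sub>R _"] using yy
      by (simp add: divide_simps power2_eq_square[symmetric])
    have zw: "B z (w j) = 0" "B (w j) z = 0" if "j \<in> S" for j
      unfolding z_def B_sym[of "w j" "_ *\<^sub>R _"] B_scale using yw[OF that] by auto
    show ?case
      by (rule exI[of _ "w(k := z)"]) (use insert.hyps w zz zw in \<open>auto\<close>)
  qed simp
  then show ?thesis unfolding B_def .
qed

definition coord_germ :: "'n::finite \<Rightarrow> 'n germ" where
  "coord_germ i = abs_germ (\<lambda>z. snd z $ i)"

lemma has_germ_coord: fixes i :: "'n::finite" shows "has_germ 0 (\<lambda>z. snd z $ i) (coord_germ i)"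
proof -
  have "bounded_linear (\<lambda>z :: 'n::finite spacetime. snd z $ i)"
    by (rule bounded_linear_compose[OF bounded_linear_vec_nth bounded_linear_snd])
  then show ?thesis
    by (auto simp: has_germ_def coord_germ_def intro!: smooth_atI[OF smooth_on_bounded_linear open_UNIV])
qed

lemma ev_coord: "germ_ev (coord_germ i) = 0"
  using has_germ_ev[OF has_germ_coord] by simp

lemma space_D_coord: fixes i :: "'n::finite" shows "space_D i (coord_germ j) = (if i = j then 1 else 0)"
proof -
  have bl: "bounded_linear (\<lambda>z :: 'n::finite spacetime. snd z $ j)"
    by (rule bounded_linear_compose[OF bounded_linear_vec_nth bounded_linear_snd])
  have fd: "frechet_derivative (\<lambda>z. snd z $ j) (at w) (0, axis i 1) = (if i = j then 1 else 0 :: real)" for w :: "'n spacetime"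
    using frechet_derivative_at[OF bounded_linear_imp_has_derivative[OF bl], of w, symmetric]
    by (simp add: axis_def)
  have "has_germ 0 (\<lambda>w. if i = j then 1 else 0) (if i = j then 1 else 0)"
    by (simp add: has_germ_0 has_germ_1)
  then show ?thesis using has_germ_unique has_germ_D[OF has_germ_coord[of j], of "(0, axis i 1)"]
    unfolding fd by blast
qed

locale germ_metric =
  fixes G Gi :: "'n::finite \<Rightarrow> 'n \<Rightarrow> 'n germ"
  assumes G_sym: "G i j = G j i"
    and Gi_inv: "(\<Sum>\<^sub>U j. Gi a j * G j b) = (if a = b then 1 else 0)"
    and G_pos: "v \<noteq> 0 \<Longrightarrow> (\<Sum>\<^sub>U a b. v $ a * v $ b * germ_ev (G a b)) > 0"
begin

abbreviation "C \<equiv> Chr space_D G Gi"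

text \<open>
  The old coordinates are \<open>x = l(y) - \<Gamma>(l(y), l(y)) / 2\<close> in terms of the new ones, where \<open>l\<close> is linear
  with orthonormal columns. The linear part makes the metric the identity at the point; the second
  derivatives of the quadratic part are such that the inhomogeneous term in the transformation law
  of the Christoffel symbols cancels their value at the point.
\<close>

theorem normal_coordinates:
  obtains p P K Gn Gni where "space_map p P"
    and "metric_map space_D space_D (germ_pull p) (\<lambda>a i. space_D i (P a)) K Gn Gni G Gi"
    and "normal_point space_D germ_ev Gn Gni"
proof -
  interpret D: derivations "space_D :: 'n \<Rightarrow> 'n germ \<Rightarrow> 'n germ" by (rule derivations_space_D)
  note ev_simps = germ_ev_simps germ_ev_linear
  obtain w :: "'n \<Rightarrow> real^'n" where w: "\<And>i j. (\<Sum>\<^sub>U a b. w i $ a * w j $ b * germ_ev (G a b)) = (if i = j then 1 else 0)"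
    using orthonormal_family[of "\<lambda>a b. germ_ev (G a b)" UNIV] G_pos by (auto simp: G_sym)
  define A where "A a i = w i $ a" for a i
  define \<Gamma> where "\<Gamma> c a b = germ_ev (C c a b)" for c a b
  have \<Gamma>_sym: "\<Gamma> c a b = \<Gamma> c b a" for c a b
    unfolding \<Gamma>_def by (subst D.Chr_sym[OF G_sym]) simp
  define l where "l a y = (\<Sum>\<^sub>U i. A a i * y $ i)" for a and y :: "real^'n"
  define p where "p y = (\<chi> c. l c y - 1/2 * (\<Sum>\<^sub>U a b. \<Gamma> c a b * (l a y * l b y)))" for y
  define L where "L a = (\<Sum>\<^sub>U i. A a i *\<^sub>R coord_germ i)" for a
  define P where "P c = L c - (1/2) *\<^sub>R (\<Sum>\<^sub>U a b. \<Gamma> c a b *\<^sub>R (L a * L b))" for c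
  have L: "has_germ 0 (\<lambda>z. l a (snd z)) (L a)" for a
    unfolding L_def l_def by (intro has_germ_sum has_germ_scaleR has_germ_coord)
  have "smooth_on UNIV (\<lambda>y. l a y)" for a
    unfolding l_def by (intro smooth_on_sum smooth_on_mult smooth_on_const smooth_on_bounded_linear bounded_linear_vec_nth)
  then have "smooth_on UNIV p"
    unfolding p_def by (intro smooth_on_vec smooth_on_diff smooth_on_mult smooth_on_const smooth_on_sum)
  then have smooth_p: "smooth_at 0 p" by (rule smooth_atI) auto
  have p0: "p 0 = 0" by (simp add: p_def l_def vec_eq_iff)
  have P: "has_germ 0 (\<lambda>z. p (snd z) $ c) (P c)" for c
    unfolding p_def P_def by (simp only: vec_lambda_beta, intro has_germ_sum has_germ_diff has_germ_scaleR has_germ_mult L)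
  have sm: "space_map p P" by (intro space_map.intro smooth_p p0 P)
  interpret s: space_map p P by (rule sm)
  have D_L: "space_D i (L a) = A a i *\<^sub>R 1" for a i
    by (simp add: L_def D.D_simps space_D_coord if_distrib[of "\<lambda>x. _ *\<^sub>R x"] cong: if_cong)
  have ev_L: "germ_ev (L a) = 0" for a
    by (simp add: L_def ev_simps ev_coord)
  have D_1: "space_D i (1 :: 'n germ) = 0" for i by simp
  have ev_DP: "germ_ev (space_D i (P c)) = A c i" for i c
    by (simp add: P_def D.D_simps D_L ev_simps ev_L)
  have ev_DDP: "germ_ev (space_D i (space_D j (P c))) = - (\<Sum>\<^sub>U a b. A a i * (A b j * \<Gamma> c a b))" for i j c
  proof -
    have "germ_ev (space_D i (space_D j (P c)))
       = - ((\<Sum>\<^sub>U a b. A a i * (A b j * \<Gamma> c a b)) + (\<Sum>\<^sub>U a b. A b i * (A a j * \<Gamma> c a b))) / 2"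
      by (simp add: P_def D.D_simps D_L ev_simps ev_L sum.distrib algebra_simps)
    also have "(\<Sum>\<^sub>U a b. A b i * (A a j * \<Gamma> c a b)) = (\<Sum>\<^sub>U a b. A a i * (A b j * \<Gamma> c a b))"
      by (subst sum.swap) (simp add: \<Gamma>_sym)
    finally show ?thesis by simp
  qed
  have detA: "det (\<chi> a i. germ_ev (space_D i (P a))) \<noteq> 0"
  proof -
    define AA GG where "AA = (\<chi> a i. A a i)" and "GG = (\<chi> a b. germ_ev (G a b))"
    have "(transpose AA ** (GG ** AA)) $ i $ j = mat 1 $ i $ j" for i j
      using w[of i j]
      by (simp add: matrix_matrix_mult_def transpose_def AA_def GG_def mat_def A_def sum_distrib_left mult_ac)
    then have "transpose AA ** (GG ** AA) = mat 1" by (simp add: vec_eq_iff)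
    then have "det (transpose AA) * (det GG * det AA) = 1" by (metis det_I det_mul)
    then show ?thesis unfolding ev_DP AA_def[symmetric] by auto
  qed
  obtain K where K: "\<And>a b. (\<Sum>\<^sub>U i. space_D i (P a) * K i b) = (if a = b then 1 else 0)"
    "\<And>i j. (\<Sum>\<^sub>U a. K i a * space_D j (P a)) = (if i = j then 1 else 0)"
    using germ_matrix_inverse[OF detA] by blast
  interpret F: frame_map space_D space_D "germ_pull p" "\<lambda>a i. space_D i (P a)" K
    by (rule s.frame_map) (use K in auto)
  define Gn where "Gn i j = F.pb i (\<lambda>a. F.pb j (\<lambda>b. germ_pull p (G a b)))" for i j
  have ev_Gn: "germ_ev (Gn i j) = (if i = j then 1 else 0)" for i j
    unfolding Gn_def F.pb_def w[symmetric]
    by (simp add: ev_simps s.germ_pull_simps ev_DP A_def sum_distrib_left mult_ac)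
  have "(\<chi> i j. germ_ev (Gn i j)) = mat 1" by (simp add: ev_Gn mat_def)
  then have detG: "det (\<chi> i j. germ_ev (Gn i j)) \<noteq> 0" by simp
  obtain Gni where Gni: "\<And>a b. (\<Sum>\<^sub>U i. Gn a i * Gni i b) = (if a = b then 1 else 0)"
    "\<And>i j. (\<Sum>\<^sub>U a. Gni i a * Gn a j) = (if i = j then 1 else 0)"
    using germ_matrix_inverse[OF detG] by blast
  have mm: "metric_map space_D space_D (germ_pull p) (\<lambda>a i. space_D i (P a)) K Gn Gni G Gi"
    by (intro metric_map.intro metric_map_axioms.intro F.frame_map_axioms)
      (rule Gn_def G_sym Gni Gi_inv)+
  interpret M: metric_map space_D space_D "germ_pull p" "\<lambda>a i. space_D i (P a)" K Gn Gni G Gi by (rule mm)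
  have ev_Gni: "germ_ev (Gni i j) = (if i = j then 1 else 0)" for i j
    using arg_cong[OF Gni(2)[of i j], of germ_ev] by (simp add: ev_simps ev_Gn split: if_splits)
  have ev_C: "germ_ev (M.C c i j) = 0" for c i j
  proof -
    have "germ_ev (\<Sum>\<^sub>U l. space_D l (P a) * M.C l i j) = 0" for a
      unfolding M.Chr_map
      by (simp add: ev_simps F.pb_def s.germ_pull_simps ev_DP ev_DDP \<Gamma>_def sum_distrib_left)
    then have "(\<Sum>\<^sub>U a. germ_ev (K c a) * germ_ev (\<Sum>\<^sub>U l. space_D l (P a) * M.C l i j)) = 0"
      by simp
    then have "germ_ev (\<Sum>\<^sub>U a. K c a * (\<Sum>\<^sub>U l. space_D l (P a) * M.C l i j)) = 0"
      by (simp add: ev_simps)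
    then show ?thesis by (simp add: sum_mult_assoc[symmetric] K)
  qed
  have np: "normal_point space_D germ_ev Gn Gni"
  proof unfold_locales
    fix q i j
    have A: "germ_ev (space_D i (Gn j m)) + germ_ev (space_D j (Gn i m)) - germ_ev (space_D m (Gn i j)) = 0" for i j m
      using ev_C[of m i j] by (simp add: Chr_def ev_simps ev_Gni)
    have "germ_ev (space_D q (Gn i j)) + germ_ev (space_D i (Gn q j)) - germ_ev (space_D j (Gn q i)) = 0"
      and "germ_ev (space_D q (Gn j i)) + germ_ev (space_D j (Gn q i)) - germ_ev (space_D i (Gn q j)) = 0"
      by (rule A)+
    then show "germ_ev (space_D q (Gn i j)) = 0" using M.G_sym[of i j] by simp
  qed (rule germ_ev_simps Gni ev_Gn M.G_sym)+
  show ?thesis by (rule that[OF sm mm np])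
qed

text \<open>
  Brings an equation between covectors back from normal coordinates; the Jacobian matrix is
  invertible.
\<close>

lemma ev_covector_zero:
  assumes mm: "metric_map space_D space_D (germ_pull p) (\<lambda>a i. space_D i (P a)) K Gn Gni G Gi"
    and sm: "space_map p P"
    and X: "\<And>j. germ_ev (frame_map.pb (\<lambda>a i. space_D i (P a)) j (\<lambda>b. germ_pull p (X b))) = 0"
  shows "germ_ev (X c) = 0"
proof -
  interpret M: metric_map space_D space_D "germ_pull p" "\<lambda>a i. space_D i (P a)" K Gn Gni G Gi by (rule mm)
  have "germ_ev (X c) = germ_ev (germ_pull p (X c))"
    by (simp add: space_map.germ_pull_simps[OF sm])
  also have "\<dots> = germ_ev (\<Sum>\<^sub>U i. K i c * M.pb i (\<lambda>b. germ_pull p (X b)))"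
    unfolding M.K_pb ..
  also have "\<dots> = 0" using X by (simp add: germ_ev_simps germ_ev_linear)
  finally show ?thesis .
qed

theorem contracted_Bianchi:
  "germ_ev (Div2 space_D C Gi (Ric space_D C) j - (1/2) *\<^sub>R space_D j (Contr Gi (Ric space_D C))) = 0"
proof -
  obtain p P K Gn Gni where sm: "space_map p P"
    and mm: "metric_map space_D space_D (germ_pull p) (\<lambda>a i. space_D i (P a)) K Gn Gni G Gi"
    and np: "normal_point space_D germ_ev Gn Gni"
    by (rule normal_coordinates)
  interpret M: metric_map space_D space_D "germ_pull p" "\<lambda>a i. space_D i (P a)" K Gn Gni G Gi by (rule mm)
  interpret N: normal_point space_D germ_ev Gn Gni by (rule np)
  have R: "N.R = germ_pull p (Contr Gi (Ric space_D C))"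
    unfolding M.Ric_map M.Contr_pb M.Contr_\<theta> ..
  show ?thesis
  proof (rule ev_covector_zero[OF mm sm])
    fix j
    have "germ_ev (Div2 space_D N.C Gni N.Rc j - (1/2) *\<^sub>R space_D j N.R) = 0"
      using N.contracted_Bianchi_normal[of j] by (simp add: N.ev_simps)
    then show "germ_ev (M.pb j (\<lambda>b. germ_pull p (Div2 space_D C Gi (Ric space_D C) b
        - (1/2) *\<^sub>R space_D b (Contr Gi (Ric space_D C))))) = 0"
      unfolding M.Div2_map[OF M.Ric_map] R M.D_\<theta> by (simp add: M.pb_in M.\<theta>_simps)
  qed
qed

theorem Div_FormSq:
  assumes skew: "\<And>i j k. H i j k = - H j i k" "\<And>i j k. H i j k = - H i k j"
    and closed: "\<And>i j k l. Ext3 space_D H i j k l = 0"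
  shows "germ_ev (Div2 space_D C Gi (FormSq Gi H) j + FormPair Gi (Codiff space_D C Gi H) H j
     - (1/6) *\<^sub>R space_D j (Contr Gi (FormSq Gi H))) = 0"
proof -
  obtain p P K Gn Gni where sm: "space_map p P"
    and mm: "metric_map space_D space_D (germ_pull p) (\<lambda>a i. space_D i (P a)) K Gn Gni G Gi"
    and np: "normal_point space_D germ_ev Gn Gni"
    by (rule normal_coordinates)
  interpret M: metric_map space_D space_D "germ_pull p" "\<lambda>a i. space_D i (P a)" K Gn Gni G Gi by (rule mm)
  interpret N: normal_point space_D germ_ev Gn Gni by (rule np)
  define Hn where "Hn i j k = M.pb i (\<lambda>a. M.pb j (\<lambda>b. M.pb k (\<lambda>c. germ_pull p (H a b c))))" for i j k
  have n3: "normal_three_form space_D germ_ev Gn Gni Hn"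
    by (intro normal_three_form.intro np normal_three_form_axioms.intro
        M.skew1_map[OF Hn_def skew(1)] M.skew2_map[OF Hn_def skew(2)])
      (simp add: M.Ext3_map[OF Hn_def skew] closed M.pb_zero)
  interpret N3: normal_three_form space_D germ_ev Gn Gni Hn by (rule n3)
  have N: "N3.N = germ_pull p (Contr Gi (FormSq Gi H))"
    unfolding M.FormSq_map[OF Hn_def] M.Contr_pb M.Contr_\<theta> ..
  show ?thesis
  proof (rule ev_covector_zero[OF mm sm])
    fix j
    have "germ_ev (Div2 space_D N.C Gni N3.S j + N3.W j - (1/6) *\<^sub>R space_D j N3.N) = 0"
      using N3.Div_FormSq_normal[of j] by (simp add: N.ev_simps)
    then show "germ_ev (M.pb j (\<lambda>b. germ_pull p (Div2 space_D C Gi (FormSq Gi H) b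
        + FormPair Gi (Codiff space_D C Gi H) H b - (1/6) *\<^sub>R space_D b (Contr Gi (FormSq Gi H))))) = 0"
      unfolding M.Div2_map[OF M.FormSq_map[OF Hn_def]] M.FormPair_map[OF M.Codiff_map[OF Hn_def] Hn_def] N M.D_\<theta>
      by (simp add: M.pb_in M.\<theta>_simps)
  qed
qed

end

definition GenScal :: "('n::finite, 'f) partials \<Rightarrow> ('n, 'f) rank2 \<Rightarrow> ('n, 'f) rank2 \<Rightarrow>
    ('n, 'f) rank3 \<Rightarrow> 'f \<Rightarrow> 'f::{comm_ring_1,real_algebra_1}" where
  "GenScal D G Gi H f = Contr Gi (Ric D (Chr D G Gi)) - (1/12) *\<^sub>R Contr Gi (FormSq Gi H)
     + 2 *\<^sub>R Contr Gi (Hess D (Chr D G Gi) f) - Contr Gi (\<lambda>i j. D i f * D j f)"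

lemma (in metric_map) GenScal_map:
  assumes H: "\<And>i j k. H i j k = pb i (\<lambda>a. pb j (\<lambda>b. pb k (\<lambda>c. \<theta> (H' a b c))))"
  shows "GenScal D G Gi H (\<theta> f) = \<theta> (GenScal D' G' Gi' H' f)"
proof -
  have "D i (\<theta> f) * D j (\<theta> f) = pb i (\<lambda>a. pb j (\<lambda>b. \<theta> (D' a f * D' b f)))" for i j
    unfolding D_\<theta> by (simp add: pb_in \<theta>_simps pb_swap[of j i])
  then have Q: "Contr Gi (\<lambda>i j. D i (\<theta> f) * D j (\<theta> f)) = \<theta> (Contr Gi' (\<lambda>i j. D' i f * D' j f))"
    by (simp only: Contr_pb Contr_\<theta>)
  have R: "Contr Gi (Ric D C) = \<theta> (Contr Gi' (Ric D' C'))"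
    unfolding Ric_map Contr_pb Contr_\<theta> ..
  have N: "Contr Gi (FormSq Gi H) = \<theta> (Contr Gi' (FormSq Gi' H'))"
    unfolding FormSq_map[OF H] Contr_pb Contr_\<theta> ..
  have L: "Contr Gi (Hess D C (\<theta> f)) = \<theta> (Contr Gi' (Hess D' C' f))"
    unfolding Hess_map Contr_pb Contr_\<theta> ..
  show ?thesis unfolding GenScal_def Q R N L by (simp only: \<theta>_simps)
qed

locale germ_flow = germ_metric +
  fixes H :: "'a \<Rightarrow> 'a \<Rightarrow> 'a \<Rightarrow> 'a germ" and f :: "'a germ"
  assumes skew: "H i j k = - H j i k" "H i j k = - H i k j"
    and closed: "Ext3 space_D H i j k l = 0"
    and Dt_G: "time_D (G i j) = (- 2) *\<^sub>R Ric space_D C i j + (1/2) *\<^sub>R FormSq Gi H i j"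
    and Dt_H: "time_D (H i j k) = - Ext2 space_D (Codiff space_D C Gi H) i j k"
    and Dt_f: "time_D f = Contr Gi (Hess space_D C f) + (1/6) *\<^sub>R Contr Gi (FormSq Gi H)"
    and Bianchi: "Div2 space_D C Gi (Ric space_D C) j = (1/2) *\<^sub>R space_D j (Contr Gi (Ric space_D C))"
    and Div_S: "Div2 space_D C Gi (FormSq Gi H) j
       = - FormPair Gi (Codiff space_D C Gi H) H j + (1/6) *\<^sub>R space_D j (Contr Gi (FormSq Gi H))"
begin

abbreviation "u \<equiv> GenScal space_D G Gi H f"

text \<open>
  In normal coordinates the Laplacian at the centre is the sum of the pure second derivatives, and
  the right-hand side of \<open>gen_scalar_evolution\<close> is a sum of squares.
\<close>

theorem supersolution:
  "\<exists>p P. space_map p P \<and>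
     (\<Sum>\<^sub>U i. germ_ev (space_D i (space_D i (germ_pull p u)))) \<le> germ_ev (time_D u)"
proof -
  obtain p P K Gn Gni where sm: "space_map p P"
    and mm: "metric_map space_D space_D (germ_pull p) (\<lambda>a i. space_D i (P a)) K Gn Gni G Gi"
    and np: "normal_point space_D germ_ev Gn Gni"
    by (rule normal_coordinates)
  interpret sm: space_map p P by (rule sm)
  interpret M: metric_map space_D space_D "germ_pull p" "\<lambda>a i. space_D i (P a)" K Gn Gni G Gi by (rule mm)
  interpret N: normal_point space_D germ_ev Gn Gni by (rule np)
  define Hn where "Hn i j k = M.pb i (\<lambda>a. M.pb j (\<lambda>b. M.pb k (\<lambda>c. germ_pull p (H a b c))))" for i j k
  define fn where "fn = germ_pull p f"
  have n3: "normal_three_form space_D germ_ev Gn Gni Hn"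
    by (intro normal_three_form.intro np normal_three_form_axioms.intro
        M.skew1_map[OF Hn_def skew(1)] M.skew2_map[OF Hn_def skew(2)])
      (simp add: M.Ext3_map[OF Hn_def skew] closed M.pb_zero)
  interpret N3: normal_three_form space_D germ_ev Gn Gni Hn by (rule n3)
  have N: "N3.N = germ_pull p (Contr Gi (FormSq Gi H))"
    unfolding M.FormSq_map[OF Hn_def] M.Contr_pb M.Contr_\<theta> ..
  have R: "N.R = germ_pull p (Contr Gi (Ric space_D C))"
    unfolding M.Ric_map M.Contr_pb M.Contr_\<theta> ..
  have B: "N3.B i j = M.pb i (\<lambda>a. M.pb j (\<lambda>b. germ_pull p (Codiff space_D C Gi H a b)))" for i j
    by (rule M.Codiff_map[OF Hn_def])
  have Codiff_skew: "Codiff space_D C Gi H a b = - Codiff space_D C Gi H b a" for a b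
    by (rule derivations.Codiff_skew[OF derivations_space_D]) (rule skew)+
  have Dt_sum: "time_D (sum g S) = (\<Sum>s\<in>S. time_D (g s))" for g :: "'a \<Rightarrow> 'a germ" and S
    using germ_D_scaleR[of "(1, 0)" 0 "0 :: 'a germ"]
    by (induction S rule: infinite_finite_induct) (simp_all add: germ_D_add)
  have Dt_pb: "time_D (M.pb i X) = M.pb i (\<lambda>a. time_D (X a))" for i X
    unfolding M.pb_def by (simp add: Dt_sum germ_D_mult germ_D_commute[of "(1, 0)"] sm.time_D_P)
  have "normal_flow space_D germ_ev Gn Gni Hn time_D fn"
  proof (intro normal_flow.intro n3 normal_flow_axioms.intro germ_D_simps)
    fix i j k
    show "time_D (Gn i j) = (- 2) *\<^sub>R N.Rc i j + (1/2) *\<^sub>R N3.S i j"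
      unfolding M.G_pb Dt_pb sm.time_D_pull Dt_G M.Ric_map M.FormSq_map[OF Hn_def]
      by (simp only: M.pb_in M.\<theta>_simps)
    show "time_D (Hn i j k) = - Ext2 space_D N3.B i j k"
      unfolding M.Ext2_map[OF B Codiff_skew] Hn_def Dt_pb sm.time_D_pull Dt_H
      by (simp only: M.pb_in M.\<theta>_simps)
    show "time_D fn = Contr Gni (Hess space_D N.C fn) + (1/6) *\<^sub>R N3.N"
      unfolding fn_def sm.time_D_pull Dt_f N M.Hess_map M.Contr_pb M.Contr_\<theta>
      by (simp only: M.\<theta>_simps)
    show "Div2 space_D N.C Gni N.Rc j = (1/2) *\<^sub>R space_D j N.R"
      unfolding M.Div2_map[OF M.Ric_map] R M.D_\<theta> Bianchi by (simp only: M.pb_in M.\<theta>_simps)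
    show "Div2 space_D N.C Gni N3.S j = - N3.W j + (1/6) *\<^sub>R space_D j N3.N"
      unfolding M.Div2_map[OF M.FormSq_map[OF Hn_def]] M.FormPair_map[OF M.Codiff_map[OF Hn_def] Hn_def] N M.D_\<theta>
        Div_S by (simp only: M.pb_in M.\<theta>_simps)
  qed
  then interpret F: normal_flow space_D germ_ev Gn Gni Hn time_D fn .
  have u: "germ_pull p u = N.R - (1/12) *\<^sub>R N3.N + 2 *\<^sub>R F.lap - F.grad_sq"
    using M.GenScal_map[OF Hn_def, of f, symmetric]
    unfolding GenScal_def F.lap_def F.grad_sq_def fn_def[symmetric] .
  have "germ_ev (time_D (germ_pull p u)) - F.Lapl (germ_pull p u) \<ge> 0"
    unfolding F.gen_scalar_evolution[OF u] by (intro add_nonneg_nonneg mult_nonneg_nonneg divide_nonneg_nonneg sum_nonneg) auto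
  then have "F.Lapl (germ_pull p u) \<le> germ_ev (time_D u)"
    by (simp add: sm.time_D_pull sm.germ_pull_simps)
  then show ?thesis using sm unfolding F.Lapl_def by blast
qed

end

section \<open>Coordinate formulas as germs\<close>

lemma FormSq_expand:
  "(\<Sum>\<^sub>U a b p q. Gi a p * Gi b q * H i a b * H j p q) = FormSq Gi H i j"
proof -
  have "(\<Sum>\<^sub>U b p q. Gi a p * Gi b q * H i a b * H j p q)
    = (\<Sum>\<^sub>U p b q. Gi a p * Gi b q * H i a b * H j p q)" for a
    by (rule sum.swap)
  then show ?thesis by (simp add: FormSq_def Contr_def sum_distrib_left mult.assoc)
qed

lemma FormNorm_expand:
  "(\<Sum>\<^sub>U i j k a b e. Gi i a * Gi j b * Gi k e * H i j k * H a b e) = Contr Gi (FormSq Gi H)"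
proof -
  let ?t = "\<lambda>i j k a b e. Gi i a * Gi j b * Gi k e * H i j k * H a b e"
  have "(\<Sum>\<^sub>U j k a b e. ?t i j k a b e)
     = (\<Sum>\<^sub>U a. Gi i a * FormSq Gi H i a)" for i
  proof -
    have "(\<Sum>\<^sub>U j k a b e. ?t i j k a b e)
       = (\<Sum>\<^sub>U j a k b e. ?t i j k a b e)"
      by (intro sum.cong refl sum.swap)
    also have "\<dots> = (\<Sum>\<^sub>U a j k b e. ?t i j k a b e)"
      by (rule sum.swap)
    finally show ?thesis
      unfolding FormSq_expand[symmetric] by (simp add: sum_distrib_left mult.assoc)
  qed
  then show ?thesis by (simp only: Contr_def)
qed

text \<open>
  The coordinate formulas are composed of the same few operations, through which this locale passes
  once. It is applied with two predicates: \<open>f\<close> has the germ \<open>a\<close> at a point, and \<open>f\<close> is smooth on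
  \<open>I \<times> U\<close> up to the end points of \<open>I\<close>.
\<close>

locale function_calculus =
  fixes Q :: "(real \<Rightarrow> real^'n::finite \<Rightarrow> real) \<Rightarrow> 'n germ \<Rightarrow> bool"
  assumes Q_add: "Q f a \<Longrightarrow> Q g b \<Longrightarrow> Q (\<lambda>t x. f t x + g t x) (a + b)"
    and Q_diff: "Q f a \<Longrightarrow> Q g b \<Longrightarrow> Q (\<lambda>t x. f t x - g t x) (a - b)"
    and Q_mult: "Q f a \<Longrightarrow> Q g b \<Longrightarrow> Q (\<lambda>t x. f t x * g t x) (a * b)"
    and Q_minus: "Q f a \<Longrightarrow> Q (\<lambda>t x. - f t x) (- a)"
    and Q_scaleR: "Q f a \<Longrightarrow> Q (\<lambda>t x. r * f t x) (r *\<^sub>R a)"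
    and Q_sum: "(\<And>k. Q (F k) (B k)) \<Longrightarrow> Q (\<lambda>t x. \<Sum>\<^sub>U k. F k t x) (\<Sum>k\<in>(UNIV :: 'n set). B k)"
    and Q_pderiv: "Q f a \<Longrightarrow> Q (\<lambda>t x. pderiv_at i (f t) x) (space_D i a)"
begin

context
  fixes G :: "real \<Rightarrow> real^'n \<Rightarrow> real^'n^'n" and Gg Gig :: "'n \<Rightarrow> 'n \<Rightarrow> 'n germ"
  assumes G: "\<And>i j. Q (\<lambda>t x. G t x $ i $ j) (Gg i j)"
    and Gi: "\<And>i j. Q (\<lambda>t x. ginv (G t) x i j) (Gig i j)"
begin

abbreviation "Cg \<equiv> Chr space_D Gg Gig"

lemma Q_christoffel: "Q (\<lambda>t x. christoffel (G t) l i j x) (Cg l i j)"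
  unfolding christoffel_def Chr_def by (intro Q_scaleR Q_sum Q_add Q_diff Q_mult Q_pderiv G Gi)

lemma Q_ricci: "Q (\<lambda>t x. ricci (G t) x $ j $ k) (Ric space_D Cg j k)"
  unfolding ricci_def riemann_def Ric_def Riem_def vec_lambda_beta
  by (intro Q_sum Q_add Q_diff Q_mult Q_pderiv Q_christoffel)

lemma Q_scalar_curv: "Q (\<lambda>t x. scalar_curv (G t) x) (Contr Gig (Ric space_D Cg))"
  unfolding scalar_curv_def Contr_def by (intro Q_sum Q_mult Gi Q_ricci)

lemma Q_laplacian:
  assumes f: "Q f a"
  shows "Q (\<lambda>t x. laplacian (G t) (f t) x) (Contr Gig (Hess space_D Cg a))"
  unfolding laplacian_def hessian_def Contr_def Hess_def vec_lambda_beta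
  by (intro Q_sum Q_diff Q_mult Q_pderiv Gi Q_christoffel f)

lemma Q_grad_norm_sq:
  assumes f: "Q f a"
  shows "Q (\<lambda>t x. grad_norm_sq (G t) (f t) x) (Contr Gig (\<lambda>i j. space_D i a * space_D j a))"
  unfolding grad_norm_sq_def Contr_def mult.assoc by (intro Q_sum Q_mult Q_pderiv Gi f)

lemma Q_form_sq:
  assumes H: "\<And>i j k. Q (\<lambda>t x. H t x $ i $ j $ k) (Hg i j k)"
  shows "Q (\<lambda>t x. form_sq (G t) (H t) x $ i $ j) (FormSq Gig Hg i j)"
  unfolding form_sq_def FormSq_expand[symmetric] vec_lambda_beta
  by (intro Q_sum Q_mult Gi H)

lemma Q_form_norm_sq:
  assumes H: "\<And>i j k. Q (\<lambda>t x. H t x $ i $ j $ k) (Hg i j k)"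
  shows "Q (\<lambda>t x. form_norm_sq (G t) (H t) x) (Contr Gig (FormSq Gig Hg))"
  unfolding form_norm_sq_def FormNorm_expand[symmetric]
  by (intro Q_sum Q_mult Gi H)

lemma Q_codiff3:
  assumes H: "\<And>i j k. Q (\<lambda>t x. H t x $ i $ j $ k) (Hg i j k)"
  shows "Q (\<lambda>t x. codiff3 (G t) (H t) x $ i $ j) (Codiff space_D Cg Gig Hg i j)"
  unfolding codiff3_def cov_deriv3_def Codiff_def Cov3_def Contr_def vec_lambda_beta
  by (intro Q_minus Q_sum Q_add Q_diff Q_mult Q_pderiv Gi H Q_christoffel)

lemma Q_gen_scalar_curv:
  assumes H: "\<And>i j k. Q (\<lambda>t x. H t x $ i $ j $ k) (Hg i j k)" and f: "Q f a"
  shows "Q (\<lambda>t x. gen_scalar_curv_local (G t) (H t) (f t) x) (GenScal space_D Gg Gig Hg a)"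
  unfolding gen_scalar_curv_local_def GenScal_def
  by (intro Q_add Q_diff Q_scaleR Q_scalar_curv Q_form_norm_sq[OF H] Q_laplacian[OF f] Q_grad_norm_sq[OF f])

end

lemma Q_ext_deriv2:
  assumes B: "\<And>i j. Q (\<lambda>t x. B t x $ i $ j) (Bg i j)"
  shows "Q (\<lambda>t x. ext_deriv2 (B t) x $ i $ j $ k) (Ext2 space_D Bg i j k)"
  unfolding ext_deriv2_def Ext2_def vec_lambda_beta by (intro Q_add Q_diff Q_pderiv B)

lemma Q_ext_deriv3:
  assumes H: "\<And>i j k. Q (\<lambda>t x. H t x $ i $ j $ k) (Hg i j k)"
  shows "Q (\<lambda>t x. ext_deriv3 (H t) x $ i $ j $ k $ l) (Ext3 space_D Hg i j k l)"
  unfolding ext_deriv3_def Ext3_def vec_lambda_beta by (intro Q_add Q_diff Q_pderiv H)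

end

definition family_germ :: "'n::finite spacetime \<Rightarrow> (real \<Rightarrow> real^'n \<Rightarrow> real) \<Rightarrow> 'n germ \<Rightarrow> bool" where
  "family_germ z f a \<longleftrightarrow> has_germ z (\<lambda>z. f (fst z) (snd z)) a"

lemma pderiv_slice:
  fixes F :: "'n::finite spacetime \<Rightarrow> real"
  assumes "smooth_at z F"
  shows "pderiv_at i (\<lambda>y. F (fst z, y)) (snd z) = frechet_derivative F (at z) (0, axis i 1)"
proof -
  let ?F' = "frechet_derivative F (at z)"
  have F: "(F has_derivative ?F') (at (fst z, snd z))" using smooth_at_has_derivative[OF assms] by simp
  have "((\<lambda>y. F (fst z, y)) has_derivative (\<lambda>v. ?F' (0, v))) (at (snd z))"
    by (rule has_derivative_compose[of "\<lambda>y. (fst z, y)" "\<lambda>v. (0, v)" "snd z" UNIV F ?F'])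
      (use F in \<open>auto intro!: derivative_eq_intros\<close>)
  then show ?thesis unfolding pderiv_at_def by (simp add: frechet_derivative_at[symmetric])
qed

lemma family_germ_calculus:
  fixes z :: "'n::finite spacetime"
  shows "function_calculus (family_germ z)"
proof
  fix f :: "real \<Rightarrow> real^'n \<Rightarrow> real" and a i
  assume f: "family_germ z f a"
  then have "has_germ z (\<lambda>z. f (fst z) (snd z)) a" by (simp add: family_germ_def)
  then have D: "has_germ z (\<lambda>w. frechet_derivative (\<lambda>z. f (fst z) (snd z)) (at w) (0, axis i 1)) (space_D i a)"
    by (rule has_germ_D)
  have "\<forall>\<^sub>F w in nhds z. smooth_at w (\<lambda>z. f (fst z) (snd z))"
    using f smooth_at_eventually unfolding family_germ_def has_germ_def by blast
  then have "\<forall>\<^sub>F w in nhds z. pderiv_at i (f (fst w)) (snd w)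
      = frechet_derivative (\<lambda>z. f (fst z) (snd z)) (at w) (0, axis i 1)"
    by (rule eventually_mono) (use pderiv_slice in fastforce)
  then show "family_germ z (\<lambda>t x. pderiv_at i (f t) x) (space_D i a)"
    unfolding family_germ_def by (rule has_germ_cong[OF D])
qed (auto simp: family_germ_def intro: has_germ_add has_germ_diff has_germ_mult has_germ_minus has_germ_scaleR has_germ_sum)

lemma smooth_calculus:
  fixes U :: "(real^'n::finite) set"
  assumes "open U"
  shows "function_calculus (\<lambda>f a. smooth_on (I \<times> U) (\<lambda>z. f (fst z) (snd z)))"
proof
  fix f :: "real \<Rightarrow> real^'n \<Rightarrow> real" and i
  assume "smooth_on (I \<times> U) (\<lambda>z. f (fst z) (snd z))"
  from smooth_on_pderiv_slice[OF this assms, of i]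
  show "smooth_on (I \<times> U) (\<lambda>z. pderiv_at i (f (fst z)) (snd z))" by simp
qed (auto intro: smooth_on_add smooth_on_diff smooth_on_mult smooth_on_minus smooth_on_const smooth_on_sum)

definition germ_at :: "'n::finite spacetime \<Rightarrow> (real \<Rightarrow> real^'n \<Rightarrow> real) \<Rightarrow> 'n germ" where
  "germ_at z f = abs_germ (\<lambda>w. f (fst (z + w)) (snd (z + w)))"

lemma family_germ_at:
  assumes "smooth_on (T \<times> U) (\<lambda>z. f (fst z) (snd z))" "open T" "open U" "z \<in> T \<times> U"
  shows "family_germ z f (germ_at z f)"
  using assms unfolding family_germ_def has_germ_def germ_at_def
  by (auto intro!: smooth_atI[OF assms(1)] open_Times)

lemma family_germ_ev: "family_germ z f a \<Longrightarrow> germ_ev a = f (fst z) (snd z)"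
  unfolding family_germ_def by (rule has_germ_ev)

lemma time_slice_derivative:
  fixes F :: "'n::finite spacetime \<Rightarrow> real"
  assumes "smooth_at w F"
  shows "((\<lambda>s. F (s, snd w)) has_real_derivative frechet_derivative F (at w) (1, 0)) (at (fst w))"
proof -
  let ?F' = "frechet_derivative F (at w)"
  have F: "(F has_derivative ?F') (at (fst w, snd w))" using smooth_at_has_derivative[OF assms] by simp
  have "((\<lambda>s. F (s, snd w)) has_derivative (\<lambda>r. ?F' (r, 0))) (at (fst w))"
    by (rule has_derivative_compose[of "\<lambda>s. (s, snd w)" "\<lambda>r. (r, 0)" "fst w" UNIV F ?F'])
      (use F in \<open>auto intro!: derivative_eq_intros\<close>)
  moreover have "(\<lambda>r. ?F' (r, 0)) = (*) (?F' (1, 0))"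
  proof
    fix r show "?F' (r, 0) = ?F' (1, 0) * r"
      using linear_cmul[OF has_derivative_linear[OF F], of r "(1, 0)"] by simp
  qed
  ultimately show ?thesis unfolding has_field_derivative_def by simp
qed

lemma time_derivative_germ:
  assumes f: "family_germ z f a" and h: "family_germ z h b"
    and W: "open W" "z \<in> W"
    and d: "\<And>w. w \<in> W \<Longrightarrow> ((\<lambda>s. f s (snd w)) has_real_derivative h (fst w) (snd w)) (at (fst w))"
  shows "time_D a = b"
proof -
  let ?F = "\<lambda>z. f (fst z) (snd z)"
  have "\<forall>\<^sub>F w in nhds z. smooth_at w ?F"
    using f smooth_at_eventually unfolding family_germ_def has_germ_def by blast
  moreover have "\<forall>\<^sub>F w in nhds z. w \<in> W" using W eventually_nhds by blast
  ultimately have "\<forall>\<^sub>F w in nhds z. frechet_derivative ?F (at w) (1, 0) = h (fst w) (snd w)"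
  proof eventually_elim
    case (elim w)
    have "((\<lambda>s. f s (snd w)) has_real_derivative frechet_derivative ?F (at w) (1, 0)) (at (fst w))"
      using time_slice_derivative[OF elim(1)] by simp
    then show ?case using d[OF elim(2)] by (rule DERIV_unique)
  qed
  then show ?thesis
    by (rule germ_eqI[OF has_germ_D[OF f[unfolded family_germ_def]] h[unfolded family_germ_def]])
qed

text \<open>
  The germs \<open>a z\<close> are the germs of one function, namely of their own values. An equation that holds
  at every point, although proved in coordinates that depend on the point, is then an equation of
  germs and can be differentiated (\<open>coherent_zero\<close>).
\<close>

definition coherent :: "'n::finite spacetime set \<Rightarrow> ('n spacetime \<Rightarrow> 'n germ) \<Rightarrow> bool" where
  "coherent W a \<longleftrightarrow> (\<forall>z\<in>W. has_germ z (\<lambda>w. germ_ev (a w)) (a z))"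

lemma coherent_zero:
  assumes "coherent W a" "open W" "\<And>z. z \<in> W \<Longrightarrow> germ_ev (a z) = 0" "z \<in> W"
  shows "a z = 0"
proof (rule germ_eqI[OF _ has_germ_0])
  show "has_germ z (\<lambda>w. germ_ev (a w)) (a z)" using assms unfolding coherent_def by blast
  show "\<forall>\<^sub>F w in nhds z. germ_ev (a w) = 0" using assms eventually_nhds by blast
qed

lemma coherent_germ_at:
  assumes "smooth_on (T \<times> U) (\<lambda>z. f (fst z) (snd z))" "open T" "open U"
  shows "coherent (T \<times> U) (\<lambda>z. germ_at z f)"
  unfolding coherent_def
proof
  fix z assume z: "z \<in> T \<times> U"
  note * = family_germ_at[OF assms]
  show "has_germ z (\<lambda>w. germ_ev (germ_at w f)) (germ_at z f)"
  proof (rule has_germ_cong[OF *[OF z, unfolded family_germ_def]])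
    have "\<forall>\<^sub>F w in nhds z. w \<in> T \<times> U" using z open_Times[OF assms(2,3)] eventually_nhds by blast
    then show "\<forall>\<^sub>F w in nhds z. germ_ev (germ_at w f) = f (fst w) (snd w)"
      by (rule eventually_mono) (rule family_germ_ev[OF *])
  qed
qed

lemma coherent_intros:
  "coherent W a \<Longrightarrow> coherent W b \<Longrightarrow> coherent W (\<lambda>z. a z + b z)"
  "coherent W a \<Longrightarrow> coherent W b \<Longrightarrow> coherent W (\<lambda>z. a z - b z)"
  "coherent W a \<Longrightarrow> coherent W b \<Longrightarrow> coherent W (\<lambda>z. a z * b z)"
  "coherent W a \<Longrightarrow> coherent W (\<lambda>z. - a z)"
  "coherent W a \<Longrightarrow> coherent W (\<lambda>z. r *\<^sub>R a z)"
  "(\<And>s. coherent W (\<lambda>z. F z s)) \<Longrightarrow> coherent W (\<lambda>z. \<Sum>s\<in>S. F z s)"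
  unfolding coherent_def germ_ev_simps germ_ev_linear
  by (auto intro: has_germ_add has_germ_diff has_germ_mult has_germ_minus has_germ_scaleR has_germ_sum)

lemma coherent_D:
  assumes "coherent W a" "open W"
  shows "coherent W (\<lambda>z. germ_D v (a z))"
  unfolding coherent_def
proof
  fix z assume z: "z \<in> W"
  have *: "has_germ w (\<lambda>w. frechet_derivative (\<lambda>w. germ_ev (a w)) (at w) v) (germ_D v (a w))" if "w \<in> W" for w
    using assms(1) that unfolding coherent_def by (intro has_germ_D) blast
  show "has_germ z (\<lambda>w. germ_ev (germ_D v (a w))) (germ_D v (a z))"
  proof (rule has_germ_cong[OF *[OF z]])
    have "\<forall>\<^sub>F w in nhds z. w \<in> W" using z assms(2) eventually_nhds by blast
    then show "\<forall>\<^sub>F w in nhds z. germ_ev (germ_D v (a w)) = frechet_derivative (\<lambda>w. germ_ev (a w)) (at w) v"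
      by (rule eventually_mono) (rule has_germ_ev[OF *])
  qed
qed

lemma local_min_second_derivative:
  fixes h h' :: "real \<Rightarrow> real"
  assumes h: "\<And>s. \<bar>s\<bar> < d \<Longrightarrow> (h has_real_derivative h' s) (at s)" and d: "d > 0"
    and h': "(h' has_real_derivative c) (at 0)"
    and min: "\<And>s. \<bar>s\<bar> < d \<Longrightarrow> h 0 \<le> h s"
  shows "c \<ge> 0"
proof (rule ccontr)
  assume "\<not> c \<ge> 0"
  then obtain e where e: "e > 0" "\<And>s. 0 < s \<Longrightarrow> s < e \<Longrightarrow> h' (0 + s) < h' 0"
    using DERIV_neg_dec_right[OF h'] by auto
  have "h' 0 = 0" by (rule DERIV_local_min[OF h[of 0] d]) (use min d in auto)
  define r where "r = min (d / 2) (e / 2)"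
  have r: "0 < r" "r < d" "r < e" using d e by (auto simp: r_def)
  obtain s where s: "0 < s" "s < r" "h r - h 0 = (r - 0) * h' s"
    using MVT2[OF r(1), of h h'] h r by force
  then have "h' s < 0" using e(2)[of s] r \<open>h' 0 = 0\<close> by simp
  then have "r * h' s < 0" using r by (simp only: mult_pos_neg)
  then have "h r < h 0" using s(3) by simp
  then show False using min[of r] r by simp
qed

lemma spatial_min_second_derivative:
  fixes g :: "'n::finite spacetime \<Rightarrow> real"
  assumes g: "has_germ 0 g a" and min: "\<forall>\<^sub>F y in nhds 0. g 0 \<le> g (0, y)"
  shows "germ_ev (space_D i (space_D i a)) \<ge> 0"
proof -
  let ?v = "(0, axis i 1) :: 'n spacetime"
  define g' where "g' w = frechet_derivative g (at w) ?v" for w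
  obtain S where S: "open S" "0 \<in> S" "smooth_on S g" using g unfolding has_germ_def smooth_at_def by auto
  obtain Y where Y: "open Y" "0 \<in> Y" "\<And>y. y \<in> Y \<Longrightarrow> g 0 \<le> g (0, y)"
    using min unfolding eventually_nhds by auto
  obtain d1 where d1: "d1 > 0" "ball 0 d1 \<subseteq> S" using S openE by blast
  obtain d2 where d2: "d2 > 0" "ball 0 d2 \<subseteq> Y" using Y openE by blast
  define d where "d = min d1 d2"
  have d: "d > 0" using d1 d2 by (simp add: d_def)
  have inS: "0 + s *\<^sub>R ?v \<in> S" if "\<bar>s\<bar> < d" for s
  proof -
    have "norm (s *\<^sub>R ?v) < d1" using that by (simp add: d_def norm_prod_def)
    then show ?thesis using d1 by auto
  qed
  have inY: "s *\<^sub>R axis i 1 \<in> Y" if "\<bar>s\<bar> < d" for s :: real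
  proof -
    have "norm (s *\<^sub>R axis i 1 :: real^'n) < d2" using that by (simp add: d_def)
    then show ?thesis using d2 by auto
  qed
  have g': "smooth_on S g'" unfolding g'_def by (rule smooth_on_frechet_derivative[OF S(3,1)])
  have "frechet_derivative g' (at (0 + 0 *\<^sub>R ?v)) ?v \<ge> 0"
  proof (rule local_min_second_derivative[OF _ d])
    show "((\<lambda>s. g (0 + s *\<^sub>R ?v)) has_real_derivative g' (0 + s *\<^sub>R ?v)) (at s)" if "\<bar>s\<bar> < d" for s
      unfolding g'_def by (rule has_derivative_along_line[OF S(3,1) inS[OF that]])
    show "((\<lambda>s. g' (0 + s *\<^sub>R ?v)) has_real_derivative frechet_derivative g' (at (0 + 0 *\<^sub>R ?v)) ?v) (at 0)"
      by (rule has_derivative_along_line[OF g' S(1) inS]) (use d in simp)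
    show "g (0 + 0 *\<^sub>R ?v) \<le> g (0 + s *\<^sub>R ?v)" if "\<bar>s\<bar> < d" for s
      using Y(3)[OF inY[OF that]] by (simp add: zero_prod_def)
  qed
  then show ?thesis
    using has_germ_ev[OF has_germ_D[OF has_germ_D[OF g]], of ?v ?v] by (simp add: g'_def[abs_def] zero_prod_def)
qed

section \<open>The flow in one chart\<close>

text \<open>
  The time set \<open>T\<close> may have end points: the continuity of the curvature at the initial time is an
  instance of \<open>smooth_gen_scalar_curv\<close>.
\<close>

locale chart_metric =
  fixes T :: "real set" and U :: "(real^'n::finite) set" and G :: "real \<Rightarrow> real^'n \<Rightarrow> real^'n^'n"
  assumes U: "open U"
    and smooth_G: "smooth_on (T \<times> U) (\<lambda>z. G (fst z) (snd z))"
    and sym_G: "t \<in> T \<Longrightarrow> x \<in> U \<Longrightarrow> transpose (G t x) = G t x"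
    and pos_G: "t \<in> T \<Longrightarrow> x \<in> U \<Longrightarrow> v \<noteq> 0 \<Longrightarrow> v \<bullet> (G t x *v v) > 0"
begin

lemma det_G:
  assumes tx: "t \<in> T" "x \<in> U"
  shows "det (G t x) \<noteq> 0"
proof -
  have "inj ((*v) (G t x))"
  proof (rule injI)
    fix v w assume "G t x *v v = G t x *v w"
    then have "(v - w) \<bullet> (G t x *v (v - w)) = 0" by (simp add: matrix_vector_mult_diff_distrib)
    then show "v = w" using pos_G[OF tx, of "v - w"] by auto
  qed
  then have "invertible (G t x)"
    by (simp add: invertible_left_inverse matrix_left_invertible_injective)
  then show ?thesis by (simp add: invertible_det_nz)
qed

lemma smooth_G_entry: "smooth_on (T \<times> U) (\<lambda>z. G (fst z) (snd z) $ i $ j)"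
  by (intro smooth_on_nth smooth_G)

lemma smooth_ginv: "smooth_on (T \<times> U) (\<lambda>z. ginv (G (fst z)) (snd z) i j)"
  unfolding ginv_def by (rule smooth_on_matrix_inv[OF smooth_G_entry]) (auto simp: det_G)

lemma smooth_gen_scalar_curv:
  assumes H: "smooth_on (T \<times> U) (\<lambda>z. H (fst z) (snd z))" and f: "smooth_on (T \<times> U) (\<lambda>z. f (fst z) (snd z))"
  shows "smooth_on (T \<times> U) (\<lambda>z. gen_scalar_curv_local (G (fst z)) (H (fst z)) (f (fst z)) (snd z))"
  by (rule function_calculus.Q_gen_scalar_curv[OF smooth_calculus[OF U]])
    (intro smooth_G_entry smooth_ginv smooth_on_nth H f)+

end

locale open_chart_metric = chart_metric T U G
  for T :: "real set" and U :: "(real^'n::finite) set" and G :: "real \<Rightarrow> real^'n \<Rightarrow> real^'n^'n" +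
  assumes T: "open T"
begin

abbreviation "gG z i j \<equiv> germ_at z (\<lambda>t x. G t x $ i $ j)"
abbreviation "gGi z i j \<equiv> germ_at z (\<lambda>t x. ginv (G t) x i j)"

lemmas germ_G = family_germ_at[OF smooth_G_entry T U]
lemmas germ_Gi = family_germ_at[OF smooth_ginv T U]

lemma germ_eq_on:
  assumes "family_germ z f a" "family_germ z g b" "z \<in> T \<times> U"
    and "\<And>t x. t \<in> T \<Longrightarrow> x \<in> U \<Longrightarrow> f t x = g t x"
  shows "a = b"
proof (rule germ_eqI[OF assms(1)[unfolded family_germ_def] assms(2)[unfolded family_germ_def]])
  have "\<forall>\<^sub>F w in nhds z. w \<in> T \<times> U" using assms(3) open_Times[OF T U] eventually_nhds by blast
  then show "\<forall>\<^sub>F w in nhds z. f (fst w) (snd w) = g (fst w) (snd w)"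
    by (rule eventually_mono) (auto simp: assms(4))
qed

lemma germ_metric:
  assumes z: "z \<in> T \<times> U"
  shows "germ_metric (gG z) (gGi z)"
proof
  fix i j a b :: 'n and v :: "real^'n"
  interpret q: function_calculus "family_germ z" by (rule family_germ_calculus)
  show "gG z i j = gG z j i"
  proof (rule germ_eq_on[OF germ_G[OF z] germ_G[OF z] z])
    fix t x assume "t \<in> T" "x \<in> U"
    from arg_cong[OF sym_G[OF this], of "\<lambda>M. M $ j $ i"]
    show "G t x $ i $ j = G t x $ j $ i" by (simp add: transpose_def)
  qed
  have c: "family_germ z (\<lambda>t x. if a = b then 1 else 0) (if a = b then 1 else 0)"
    by (simp add: family_germ_def has_germ_0 has_germ_1)
  show "(\<Sum>\<^sub>U j. gGi z a j * gG z j b) = (if a = b then 1 else 0)"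
  proof (rule germ_eq_on[OF q.Q_sum[OF q.Q_mult[OF germ_Gi[OF z] germ_G[OF z]]] c z])
    fix t x assume "t \<in> T" "x \<in> U"
    then have "(matrix_inv (G t x) ** G t x) $ a $ b = mat 1 $ a $ b"
      by (simp add: matrix_inv_mult det_G)
    then show "(\<Sum>\<^sub>U k. ginv (G t) x a k * G t x $ k $ b) = (if a = b then 1 else 0)"
      by (simp add: ginv_def matrix_matrix_mult_def mat_def)
  qed
  assume "v \<noteq> 0"
  then have "v \<bullet> (G (fst z) (snd z) *v v) > 0" using z by (intro pos_G) auto
  then show "0 < (\<Sum>\<^sub>U a b. v $ a * v $ b * germ_ev (gG z a b))"
    by (simp add: family_germ_ev[OF germ_G[OF z]] inner_vec_def matrix_vector_mult_def sum_distrib_left mult_ac)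
qed

end

locale chart_flow = open_chart_metric T U G
  for T :: "real set" and U :: "(real^'n::finite) set" and G :: "real \<Rightarrow> real^'n \<Rightarrow> real^'n^'n" +
  fixes H :: "real \<Rightarrow> real^'n \<Rightarrow> real^'n^'n^'n" and b :: "real \<Rightarrow> real^'n \<Rightarrow> real^'n^'n"
    and H0 :: "real^'n \<Rightarrow> real^'n^'n^'n" and f :: "real \<Rightarrow> real^'n \<Rightarrow> real"
  assumes smooth_H: "smooth_on (T \<times> U) (\<lambda>z. H (fst z) (snd z))"
    and smooth_b: "smooth_on (T \<times> U) (\<lambda>z. b (fst z) (snd z))"
    and smooth_f: "smooth_on (T \<times> U) (\<lambda>z. f (fst z) (snd z))"
    and skew_H: "t \<in> T \<Longrightarrow> x \<in> U \<Longrightarrow> H t x $ i $ j $ k = - H t x $ j $ i $ k"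
      "t \<in> T \<Longrightarrow> x \<in> U \<Longrightarrow> H t x $ i $ j $ k = - H t x $ i $ k $ j"
    and closed_H: "t \<in> T \<Longrightarrow> x \<in> U \<Longrightarrow> ext_deriv3 (H t) x = 0"
    and H_b: "t \<in> T \<Longrightarrow> x \<in> U \<Longrightarrow> H t x = H0 x + ext_deriv2 (b t) x"
    and flow_G: "t \<in> T \<Longrightarrow> x \<in> U \<Longrightarrow> ((\<lambda>s. G s x) has_vector_derivative
        (-2) *\<^sub>R ricci (G t) x + (1/2) *\<^sub>R form_sq (G t) (H t) x) (at t)"
    and flow_b: "t \<in> T \<Longrightarrow> x \<in> U \<Longrightarrow> ((\<lambda>s. b s x) has_vector_derivative - codiff3 (G t) (H t) x) (at t)"
    and flow_f: "t \<in> T \<Longrightarrow> x \<in> U \<Longrightarrow> ((\<lambda>s. f s x) has_real_derivative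
        laplacian (G t) (f t) x + 1/6 * form_norm_sq (G t) (H t) x) (at t)"
begin

abbreviation "gH z i j k \<equiv> germ_at z (\<lambda>t x. H t x $ i $ j $ k)"
abbreviation "gb z i j \<equiv> germ_at z (\<lambda>t x. b t x $ i $ j)"
abbreviation "gf z \<equiv> germ_at z f"

lemma smooth_entries:
  "smooth_on (T \<times> U) (\<lambda>z. H (fst z) (snd z) $ i $ j $ k)"
  "smooth_on (T \<times> U) (\<lambda>z. b (fst z) (snd z) $ i $ j)"
  by (intro smooth_on_nth smooth_H smooth_b)+

lemmas germ_H = family_germ_at[OF smooth_entries(1) T U]
lemmas germ_b = family_germ_at[OF smooth_entries(2) T U]
lemmas germ_f = family_germ_at[OF smooth_f T U]

lemma derivative_entry:
  assumes "((\<lambda>s. X s) has_vector_derivative D) F"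
  shows "((\<lambda>s. X s $ i) has_vector_derivative (D $ i)) F"
  using bounded_linear.has_vector_derivative[OF bounded_linear_vec_nth assms] .

text \<open>
  Both identities are known at each point from normal coordinates around it.
\<close>

lemma coherent_identities:
  assumes z: "z \<in> T \<times> U"
  defines "Cz \<equiv> Chr space_D (gG z) (gGi z)"
  shows "Div2 space_D Cz (gGi z) (Ric space_D Cz) j = (1/2) *\<^sub>R space_D j (Contr (gGi z) (Ric space_D Cz))"
    and "(\<And>z. z \<in> T \<times> U \<Longrightarrow> (\<forall>i j k. gH z i j k = - gH z j i k) \<and> (\<forall>i j k. gH z i j k = - gH z i k j)
          \<and> (\<forall>i j k l. Ext3 space_D (gH z) i j k l = 0)) \<Longrightarrow>
       Div2 space_D Cz (gGi z) (FormSq (gGi z) (gH z)) j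
       = - FormPair (gGi z) (Codiff space_D Cz (gGi z) (gH z)) (gH z) j
         + (1/6) *\<^sub>R space_D j (Contr (gGi z) (FormSq (gGi z) (gH z)))"
proof -
  note defs = Div2_def Contr_def Cov2_def Ric_def Riem_def Chr_def FormPair_def FormSq_def Codiff_def Cov3_def
  note W = open_Times[OF T U]
  note rules = coherent_intros coherent_D[OF _ W] coherent_germ_at[OF smooth_G_entry T U]
    coherent_germ_at[OF smooth_ginv T U] coherent_germ_at[OF smooth_entries(1) T U]
  have "Div2 space_D Cz (gGi z) (Ric space_D Cz) j - (1/2) *\<^sub>R space_D j (Contr (gGi z) (Ric space_D Cz)) = 0"
    unfolding Cz_def
  proof (rule coherent_zero[OF _ W _ z])
    show "coherent (T \<times> U) (\<lambda>z. Div2 space_D (Chr space_D (gG z) (gGi z)) (gGi z) (Ric space_D (Chr space_D (gG z) (gGi z))) j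
       - (1/2) *\<^sub>R space_D j (Contr (gGi z) (Ric space_D (Chr space_D (gG z) (gGi z)))))"
      unfolding defs by (intro rules)
  qed (rule germ_metric.contracted_Bianchi[OF germ_metric])
  then show "Div2 space_D Cz (gGi z) (Ric space_D Cz) j = (1/2) *\<^sub>R space_D j (Contr (gGi z) (Ric space_D Cz))"
    by simp
  assume form: "\<And>z. z \<in> T \<times> U \<Longrightarrow> (\<forall>i j k. gH z i j k = - gH z j i k) \<and> (\<forall>i j k. gH z i j k = - gH z i k j)
          \<and> (\<forall>i j k l. Ext3 space_D (gH z) i j k l = 0)"
  have "Div2 space_D Cz (gGi z) (FormSq (gGi z) (gH z)) j
       + FormPair (gGi z) (Codiff space_D Cz (gGi z) (gH z)) (gH z) j
       - (1/6) *\<^sub>R space_D j (Contr (gGi z) (FormSq (gGi z) (gH z))) = 0"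
    unfolding Cz_def
  proof (rule coherent_zero[OF _ W _ z])
    show "coherent (T \<times> U) (\<lambda>z. Div2 space_D (Chr space_D (gG z) (gGi z)) (gGi z) (FormSq (gGi z) (gH z)) j
       + FormPair (gGi z) (Codiff space_D (Chr space_D (gG z) (gGi z)) (gGi z) (gH z)) (gH z) j
       - (1/6) *\<^sub>R space_D j (Contr (gGi z) (FormSq (gGi z) (gH z))))"
      unfolding defs by (intro rules)
  next
    fix w assume w: "w \<in> T \<times> U"
    show "germ_ev (Div2 space_D (Chr space_D (gG w) (gGi w)) (gGi w) (FormSq (gGi w) (gH w)) j
       + FormPair (gGi w) (Codiff space_D (Chr space_D (gG w) (gGi w)) (gGi w) (gH w)) (gH w) j
       - (1/6) *\<^sub>R space_D j (Contr (gGi w) (FormSq (gGi w) (gH w)))) = 0"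
      by (rule germ_metric.Div_FormSq[OF germ_metric[OF w]]) (use form[OF w] in blast)+
  qed
  then show "Div2 space_D Cz (gGi z) (FormSq (gGi z) (gH z)) j
       = - FormPair (gGi z) (Codiff space_D Cz (gGi z) (gH z)) (gH z) j
         + (1/6) *\<^sub>R space_D j (Contr (gGi z) (FormSq (gGi z) (gH z)))"
    by (simp add: algebra_simps)
qed

lemma germ_three_form:
  assumes z: "z \<in> T \<times> U"
  shows "(\<forall>i j k. gH z i j k = - gH z j i k) \<and> (\<forall>i j k. gH z i j k = - gH z i k j)
          \<and> (\<forall>i j k l. Ext3 space_D (gH z) i j k l = 0)"
proof (intro conjI allI)
  fix i j k l
  interpret q: function_calculus "family_germ z" by (rule family_germ_calculus)
  show "gH z i j k = - gH z j i k"
    by (rule germ_eq_on[OF germ_H[OF z] q.Q_minus[OF germ_H[OF z]] z]) (rule skew_H)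
  show "gH z i j k = - gH z i k j"
    by (rule germ_eq_on[OF germ_H[OF z] q.Q_minus[OF germ_H[OF z]] z]) (rule skew_H)
  have "family_germ z (\<lambda>t x. 0) 0" by (simp add: family_germ_def has_germ_0)
  then show "Ext3 space_D (gH z) i j k l = 0"
    by (rule germ_eq_on[OF q.Q_ext_deriv3[OF germ_H[OF z]] _ z]) (simp add: closed_H)
qed

lemma germ_flow:
  assumes z: "z \<in> T \<times> U"
  shows "germ_flow (gG z) (gGi z) (gH z) (gf z)"
proof (intro germ_flow.intro germ_metric[OF z] germ_flow_axioms.intro)
  fix i j k l
  interpret q: function_calculus "family_germ z" by (rule family_germ_calculus)
  note W = open_Times[OF T U]
  let ?C = "Chr space_D (gG z) (gGi z)"
  show "gH z i j k = - gH z j i k" "gH z i j k = - gH z i k j" "Ext3 space_D (gH z) i j k l = 0"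
    using germ_three_form[OF z] by blast+
  show "time_D (gG z i j) = (- 2) *\<^sub>R Ric space_D ?C i j + (1/2) *\<^sub>R FormSq (gGi z) (gH z) i j"
  proof (rule time_derivative_germ[OF germ_G[OF z] q.Q_add[OF q.Q_scaleR[OF q.Q_ricci] q.Q_scaleR[OF q.Q_form_sq]] W z])
    fix w assume "w \<in> T \<times> U"
    then have w: "fst w \<in> T" "snd w \<in> U" by auto
    show "((\<lambda>s. G s (snd w) $ i $ j) has_real_derivative
       - 2 * ricci (G (fst w)) (snd w) $ i $ j + 1/2 * form_sq (G (fst w)) (H (fst w)) (snd w) $ i $ j) (at (fst w))"
      using derivative_entry[OF derivative_entry[OF flow_G[OF w]], of i j]
      by (simp add: has_real_derivative_iff_has_vector_derivative)
  qed (rule germ_G[OF z] germ_Gi[OF z] germ_H[OF z])+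
  show "time_D (gH z i j k) = - Ext2 space_D (Codiff space_D ?C (gGi z) (gH z)) i j k"
  proof -
    have b: "time_D (gb z i j) = - Codiff space_D ?C (gGi z) (gH z) i j" for i j
    proof (rule time_derivative_germ[OF germ_b[OF z] q.Q_minus[OF q.Q_codiff3] W z])
      fix w assume "w \<in> T \<times> U"
      then have w: "fst w \<in> T" "snd w \<in> U" by auto
      show "((\<lambda>s. b s (snd w) $ i $ j) has_real_derivative
         - codiff3 (G (fst w)) (H (fst w)) (snd w) $ i $ j) (at (fst w))"
        using derivative_entry[OF derivative_entry[OF flow_b[OF w]], of i j]
        by (simp add: has_real_derivative_iff_has_vector_derivative)
    qed (rule germ_G[OF z] germ_Gi[OF z] germ_H[OF z])+
    have 0: "family_germ z (\<lambda>t x. 0) 0" by (simp add: family_germ_def has_germ_0)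
    \<comment> \<open>The difference of \<open>H\<close> and \<open>db\<close> is the initial form, so \<open>H\<close> moves with velocity \<open>d(\<partial>\<^sub>t b)\<close>.\<close>
    have "time_D (gH z i j k - Ext2 space_D (gb z) i j k) = 0"
    proof (rule time_derivative_germ[OF q.Q_diff[OF germ_H[OF z] q.Q_ext_deriv2[OF germ_b[OF z]]] 0 W z])
      fix w assume "w \<in> T \<times> U"
      then have w: "fst w \<in> T" "snd w \<in> U" by auto
      have "((\<lambda>s. H0 (snd w) $ i $ j $ k) has_real_derivative 0) (at (fst w))" by simp
      then show "((\<lambda>s. H s (snd w) $ i $ j $ k - ext_deriv2 (b s) (snd w) $ i $ j $ k) has_real_derivative 0) (at (fst w))"
        by (rule has_field_derivative_transform_within_open[OF _ T w(1)]) (simp add: H_b w)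
    qed
    moreover have diff: "time_D (x - y) = time_D x - time_D y" for x y :: "'n germ"
      using germ_D_add[of "(1, 0)" "x - y" y] by simp
    have "time_D (Ext2 space_D (gb z) i j k) = - Ext2 space_D (Codiff space_D ?C (gGi z) (gH z)) i j k"
    proof -
      have "space_D i (- x) = - space_D i x" for i and x :: "'n germ"
        using germ_D_scaleR[of "(0, axis i 1)" "-1" x] by simp
      then show ?thesis
        by (simp add: Ext2_def diff germ_D_add germ_D_commute[of "(1, 0)"] b)
    qed
    ultimately show ?thesis by (simp add: diff eq_neg_iff_add_eq_0)
  qed
  show "time_D (gf z) = Contr (gGi z) (Hess space_D ?C (gf z)) + (1/6) *\<^sub>R Contr (gGi z) (FormSq (gGi z) (gH z))"
  proof (rule time_derivative_germ[OF germ_f[OF z] q.Q_add[OF q.Q_laplacian q.Q_scaleR[OF q.Q_form_norm_sq]] W z])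
    fix w assume "w \<in> T \<times> U"
    then have w: "fst w \<in> T" "snd w \<in> U" by auto
    show "((\<lambda>s. f s (snd w)) has_real_derivative
        laplacian (G (fst w)) (f (fst w)) (snd w) + 1/6 * form_norm_sq (G (fst w)) (H (fst w)) (snd w)) (at (fst w))"
      by (rule flow_f[OF w])
  qed (rule germ_G[OF z] germ_Gi[OF z] germ_H[OF z] germ_f[OF z])+
  show "Div2 space_D ?C (gGi z) (Ric space_D ?C) j = (1/2) *\<^sub>R space_D j (Contr (gGi z) (Ric space_D ?C))"
    by (rule coherent_identities(1)[OF z])
  show "Div2 space_D ?C (gGi z) (FormSq (gGi z) (gH z)) j
       = - FormPair (gGi z) (Codiff space_D ?C (gGi z) (gH z)) (gH z) j
         + (1/6) *\<^sub>R space_D j (Contr (gGi z) (FormSq (gGi z) (gH z)))"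
    by (rule coherent_identities(2)[OF z germ_three_form])
qed

definition "u t x = gen_scalar_curv_local (G t) (H t) (f t) x"

text \<open>
  A spatial minimum is one in normal coordinates too, so the pure second derivatives there are
  nonnegative, and by \<open>supersolution\<close> the time derivative is at least their sum.
\<close>

theorem time_derivative_at_spatial_min:
  assumes tx: "t \<in> T" "x \<in> U" and min: "\<forall>\<^sub>F y in nhds x. u t x \<le> u t y"
  shows "\<exists>d \<ge> 0. ((\<lambda>s. u s x) has_real_derivative d) (at t)"
proof -
  define z where "z = (t, x)"
  have z: "z \<in> T \<times> U" using tx by (simp add: z_def)
  interpret q: function_calculus "family_germ z" by (rule family_germ_calculus)
  interpret F: germ_flow "gG z" "gGi z" "gH z" "gf z" by (rule germ_flow[OF z])
  let ?F = "\<lambda>z. u (fst z) (snd z)"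
  have "family_germ z u F.u"
    unfolding u_def[abs_def] by (rule q.Q_gen_scalar_curv) (rule germ_G[OF z] germ_Gi[OF z] germ_H[OF z] germ_f[OF z])+
  then have F: "has_germ z ?F F.u" by (simp add: family_germ_def)
  obtain p P where sm: "space_map p P"
    and le: "(\<Sum>\<^sub>U i. germ_ev (space_D i (space_D i (germ_pull p F.u)))) \<le> germ_ev (time_D F.u)"
    using F.supersolution by blast
  interpret sm: space_map p P by (rule sm)
  have pull: "has_germ 0 (\<lambda>w. ?F (z + (fst w, p (snd w)))) (germ_pull p F.u)"
    by (rule sm.hpull[OF has_germ_shift[OF F]])
  have "filterlim (\<lambda>y. x + p y) (nhds x) (nhds 0)"
  proof -
    have "isCont p 0" using has_derivative_continuous[OF smooth_at_has_derivative[OF sm.smooth_p]] .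
    then have "filterlim p (nhds 0) (nhds 0)"
      using sm.p_0 tendsto_at_iff_tendsto_nhds[of p 0] by (simp add: isCont_def)
    then show ?thesis using tendsto_add[OF tendsto_const, of p 0 "nhds 0" x] by simp
  qed
  with min have "\<forall>\<^sub>F y in nhds 0. u t x \<le> u t (x + p y)" by (rule eventually_compose_filterlim)
  then have "\<forall>\<^sub>F y in nhds 0. ?F (z + (fst 0, p (snd 0))) \<le> ?F (z + (fst (0, y), p (snd (0::real, y))))"
    by (simp add: z_def sm.p_0)
  then have "germ_ev (space_D i (space_D i (germ_pull p F.u))) \<ge> 0" for i
    by (rule spatial_min_second_derivative[OF pull])
  then have d: "0 \<le> germ_ev (time_D F.u)" using le by (meson order_trans sum_nonneg)
  have "((\<lambda>s. ?F (s, snd z)) has_real_derivative frechet_derivative ?F (at z) (1, 0)) (at (fst z))"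
    using F by (intro time_slice_derivative) (simp add: has_germ_def)
  then have "((\<lambda>s. u s x) has_real_derivative germ_ev (time_D F.u)) (at t)"
    using has_germ_ev[OF has_germ_D[OF F], of "(1, 0)"] by (simp add: z_def)
  then show ?thesis using d by blast
qed

end

section \<open>Independence of the chart\<close>

text \<open>
  With both points translated to the origin and all data regarded as constant in time, the
  transition map is a \<open>space_map\<close> and \<open>GenScal_map\<close> applies. Its Jacobian matrix is invertible
  because the pulled-back metric \<open>Gc\<close> is nondegenerate.
\<close>

lemma gen_scalar_curv_transform:
  fixes \<tau> :: "real^'n::finite \<Rightarrow> real^'n"
  assumes c: "open_chart_metric UNIV Uc (\<lambda>_. Gc)" and d: "open_chart_metric UNIV Ud (\<lambda>_. Gd)"
    and smooth_H: "smooth_on Uc Hc" "smooth_on Ud Hd" and smooth_f: "smooth_on Uc fc" "smooth_on Ud fd"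
    and \<tau>: "smooth_on Uc \<tau>" "\<tau> ` Uc \<subseteq> Ud"
    and G: "\<And>y i j. y \<in> Uc \<Longrightarrow> Gc y $ i $ j = (\<Sum>\<^sub>U a b. jacobian \<tau> (at y) $ a $ i * jacobian \<tau> (at y) $ b $ j * Gd (\<tau> y) $ a $ b)"
    and H: "\<And>y i j k. y \<in> Uc \<Longrightarrow> Hc y $ i $ j $ k = (\<Sum>\<^sub>U a b e. jacobian \<tau> (at y) $ a $ i * jacobian \<tau> (at y) $ b $ j * jacobian \<tau> (at y) $ e $ k * Hd (\<tau> y) $ a $ b $ e)"
    and f: "\<And>y. y \<in> Uc \<Longrightarrow> fc y = fd (\<tau> y)"
    and x: "x \<in> Uc"
  shows "gen_scalar_curv_local Gc Hc fc x = gen_scalar_curv_local Gd Hd fd (\<tau> x)"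
proof -
  interpret c: open_chart_metric UNIV Uc "\<lambda>_. Gc" by (rule c)
  interpret d: open_chart_metric UNIV Ud "\<lambda>_. Gd" by (rule d)
  define z w where "z = (0::real, x)" and "w = (0::real, \<tau> x)"
  have z: "z \<in> UNIV \<times> Uc" and w: "w \<in> UNIV \<times> Ud" using x \<tau> by (auto simp: z_def w_def)
  define p where "p y = \<tau> (x + y) - \<tau> x" for y
  define V where "V = (\<lambda>y. x + y) -` Uc"
  have V: "open V" "0 \<in> V" using x c.U by (auto simp: V_def intro!: open_vimage continuous_intros)
  have shift: "smooth_on V (\<lambda>y. x + y)"
    by (rule smooth_on_add[OF smooth_on_const smooth_on_bounded_linear[OF bounded_linear_ident]])
  have smooth_p: "smooth_on V p"
  proof (rule smooth_on_euclidean)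
    fix b :: "real^'n"
    have "smooth_on V (\<lambda>y. \<tau> (x + y) \<bullet> b - \<tau> x \<bullet> b)"
      by (rule smooth_on_diff[OF smooth_on_compose[OF smooth_on_linear[OF bounded_linear_inner_left \<tau>(1)] shift] smooth_on_const])
        (auto simp: V_def)
    then show "smooth_on V (\<lambda>y. p y \<bullet> b)" by (simp add: p_def inner_diff_left)
  qed
  have smooth_p0: "smooth_at 0 p" by (rule smooth_atI[OF smooth_p V])
  have smooth_pk: "smooth_on ((UNIV :: real set) \<times> V) (\<lambda>z. p (snd z) $ k)" for k
    by (intro smooth_on_nth smooth_on_snd smooth_p)
  define P where "P k = germ_at (0 :: 'n spacetime) (\<lambda>t y. p y $ k)" for k
  have P: "has_germ 0 (\<lambda>z. p (snd z) $ k) (P k)" for k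
    using family_germ_at[OF smooth_pk open_UNIV V(1), of 0] V unfolding P_def family_germ_def by (simp add: zero_prod_def)
  have sm: "space_map p P" by (intro space_map.intro smooth_p0 P) (simp add: p_def)
  interpret sm: space_map p P by (rule sm)
  have evV: "\<forall>\<^sub>F v in nhds (0 :: 'n spacetime). v \<in> UNIV \<times> V"
    using open_Times[OF open_UNIV V(1)] V(2) unfolding eventually_nhds
    by (intro exI[of _ "UNIV \<times> V"]) (auto simp: zero_prod_def)
  have jac: "jacobian \<tau> (at (x + y)) $ a $ i = frechet_derivative (\<lambda>z. p (snd z) $ a) (at (t, y)) (0, axis i 1)"
    if y: "y \<in> V" for y a i and t :: real
  proof -
    have "smooth_at (t, y) (\<lambda>z. p (snd z) $ a)"
      by (rule smooth_atI[OF smooth_pk]) (use V y in \<open>auto intro: open_Times\<close>)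
    from pderiv_slice[OF this, of i]
    have "frechet_derivative (\<lambda>z. p (snd z) $ a) (at (t, y)) (0, axis i 1) = frechet_derivative (\<lambda>y. p y $ a) (at y) (axis i 1)"
      by (simp add: pderiv_at_def)
    also have "\<dots> = frechet_derivative \<tau> (at (x + y)) (axis i 1) $ a"
    proof -
      have "(\<tau> has_derivative frechet_derivative \<tau> (at (x + y))) (at (x + y))"
        using has_derivative_frechet[OF \<tau>(1) c.U, of "x + y"] y by (simp add: V_def)
      then have "((\<lambda>y. \<tau> (x + y)) has_derivative frechet_derivative \<tau> (at (x + y))) (at y)"
        by (intro has_derivative_compose[of "\<lambda>y. x + y" "\<lambda>v. v" y UNIV \<tau>]) (auto intro!: derivative_eq_intros)
      then have "(p has_derivative frechet_derivative \<tau> (at (x + y))) (at y)"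
        unfolding p_def[abs_def] by (auto intro!: derivative_eq_intros)
      from bounded_linear.has_derivative[OF bounded_linear_vec_nth this, of a] show ?thesis
        by (simp add: frechet_derivative_at[symmetric])
    qed
    finally show ?thesis by (simp add: jacobian_def matrix_def)
  qed
  have jac_germ: "has_germ 0 (\<lambda>v. jacobian \<tau> (at (x + snd v)) $ a $ i) (space_D i (P a))" for a i
    by (rule has_germ_cong[OF has_germ_D[OF P]], rule eventually_mono[OF evV]) (auto simp: jac)
  have germ_z: "has_germ 0 (\<lambda>v. g (x + snd v)) a" if "family_germ z (\<lambda>t. g) a" for g a
    using has_germ_shift[OF that[unfolded family_germ_def]] by (simp add: z_def)
  have germ_w: "has_germ 0 (\<lambda>v. g (\<tau> x + p (snd v))) (germ_pull p a)" if "family_germ w (\<lambda>t. g) a" for g a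
    using sm.hpull[OF has_germ_shift[OF that[unfolded family_germ_def]]] by (simp add: w_def)
  have \<tau>p: "\<tau> x + p y = \<tau> (x + y)" for y by (simp add: p_def)
  define hc hd where "hc i j k = germ_at z (\<lambda>t x. Hc x $ i $ j $ k)" and "hd i j k = germ_at w (\<lambda>t x. Hd x $ i $ j $ k)" for i j k
  define kc kd where "kc = germ_at z (\<lambda>t. fc)" and "kd = germ_at w (\<lambda>t. fd)"
  have sm_snd: "smooth_on (UNIV \<times> W) (\<lambda>z :: 'n spacetime. g (snd z))" if "smooth_on W g" for W and g :: "real^'n \<Rightarrow> real"
    by (rule smooth_on_snd[OF that])
  have hc: "family_germ z (\<lambda>t x. Hc x $ i $ j $ k) (hc i j k)" for i j k
    unfolding hc_def by (rule family_germ_at[OF sm_snd open_UNIV c.U z]) (intro smooth_on_nth smooth_H)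
  have hd: "family_germ w (\<lambda>t x. Hd x $ i $ j $ k) (hd i j k)" for i j k
    unfolding hd_def by (rule family_germ_at[OF sm_snd open_UNIV d.U w]) (intro smooth_on_nth smooth_H)
  have kc: "family_germ z (\<lambda>t. fc) kc"
    unfolding kc_def by (rule family_germ_at[OF sm_snd open_UNIV c.U z]) (rule smooth_f)
  have kd: "family_germ w (\<lambda>t. fd) kd"
    unfolding kd_def by (rule family_germ_at[OF sm_snd open_UNIV d.U w]) (rule smooth_f)
  let ?J = "jacobian \<tau> (at x)"
  have "Gc x = transpose ?J ** (Gd (\<tau> x) ** ?J)"
    by (simp add: vec_eq_iff G[OF x] matrix_matrix_mult_def transpose_def sum_distrib_left mult_ac)
  then have "det (Gc x) = det ?J * (det (Gd (\<tau> x)) * det ?J)" by (simp add: det_mul)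
  then have "det ?J \<noteq> 0" using c.det_G[of 0 x] x by auto
  moreover have "(\<chi> a i. germ_ev (space_D i (P a))) = ?J"
    using has_germ_ev[OF jac_germ] by (simp add: vec_eq_iff)
  ultimately have "det (\<chi> a i. germ_ev (space_D i (P a))) \<noteq> 0" by simp
  from germ_matrix_inverse[OF this] obtain K
    where K: "\<And>a b. (\<Sum>\<^sub>U i. space_D i (P a) * K i b) = (if a = b then 1 else 0)"
    "\<And>i j. (\<Sum>\<^sub>U a. K i a * space_D j (P a)) = (if i = j then 1 else 0)" by blast
  interpret F: frame_map space_D space_D "germ_pull p" "\<lambda>a i. space_D i (P a)" K
    by (rule sm.frame_map) (use K in auto)
  interpret gc: germ_metric "c.gG z" "c.gGi z" by (rule c.germ_metric[OF z])
  interpret gd: germ_metric "d.gG w" "d.gGi w" by (rule d.germ_metric[OF w])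
  have G_pb: "c.gG z i j = F.pb i (\<lambda>a. F.pb j (\<lambda>b. germ_pull p (d.gG w a b)))" for i j
    unfolding F.pb_def
  proof (rule germ_eqI[OF germ_z[OF c.germ_G[OF z]]
        has_germ_sum[OF has_germ_mult[OF jac_germ has_germ_sum[OF has_germ_mult[OF jac_germ germ_w[OF d.germ_G[OF w]]]]]]],
      rule eventually_mono[OF evV])
    fix v :: "'n spacetime" assume "v \<in> UNIV \<times> V"
    then show "Gc (x + snd v) $ i $ j = (\<Sum>\<^sub>U a. jacobian \<tau> (at (x + snd v)) $ a $ i *
        (\<Sum>\<^sub>U b. jacobian \<tau> (at (x + snd v)) $ b $ j * Gd (\<tau> x + p (snd v)) $ a $ b))"
      by (simp add: \<tau>p G V_def mem_Times_iff sum_distrib_left mult.assoc)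
  qed
  have H_pb: "hc i j k = F.pb i (\<lambda>a. F.pb j (\<lambda>b. F.pb k (\<lambda>e. germ_pull p (hd a b e))))" for i j k
    unfolding F.pb_def
  proof (rule germ_eqI[OF germ_z[OF hc] has_germ_sum[OF has_germ_mult[OF jac_germ has_germ_sum[OF has_germ_mult[OF jac_germ
         has_germ_sum[OF has_germ_mult[OF jac_germ germ_w[OF hd]]]]]]]],
      rule eventually_mono[OF evV])
    fix v :: "'n spacetime" assume "v \<in> UNIV \<times> V"
    then show "Hc (x + snd v) $ i $ j $ k = (\<Sum>\<^sub>U a. jacobian \<tau> (at (x + snd v)) $ a $ i *
        (\<Sum>\<^sub>U b. jacobian \<tau> (at (x + snd v)) $ b $ j *
        (\<Sum>\<^sub>U e. jacobian \<tau> (at (x + snd v)) $ e $ k * Hd (\<tau> x + p (snd v)) $ a $ b $ e)))"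
      by (simp add: \<tau>p H V_def mem_Times_iff sum_distrib_left mult.assoc)
  qed
  have f_pb: "kc = germ_pull p kd"
    by (rule germ_eqI[OF germ_z[OF kc] germ_w[OF kd]], rule eventually_mono[OF evV])
      (auto simp: \<tau>p f V_def)
  have gc_inv: "(\<Sum>\<^sub>U j. c.gG z i j * c.gGi z j k) = (if i = k then 1 else 0)" for i k
  proof -
    interpret q: function_calculus "family_germ z" by (rule family_germ_calculus)
    have one: "family_germ z (\<lambda>t x. if i = k then 1 else 0) (if i = k then 1 else 0)"
      by (simp add: family_germ_def has_germ_0 has_germ_1)
    show ?thesis
    proof (rule c.germ_eq_on[OF q.Q_sum[OF q.Q_mult[OF c.germ_G[OF z] c.germ_Gi[OF z]]] one z])
      fix t :: real and y assume "y \<in> Uc"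
      then have "(Gc y ** matrix_inv (Gc y)) $ i $ k = mat 1 $ i $ k"
        using c.det_G[of 0 y] by (simp add: matrix_inv_mult)
      then show "(\<Sum>\<^sub>U j. Gc y $ i $ j * ginv Gc y j k) = (if i = k then 1 else 0)"
        by (simp add: ginv_def matrix_matrix_mult_def mat_def)
    qed
  qed
  interpret M: metric_map space_D space_D "germ_pull p" "\<lambda>a i. space_D i (P a)" K "c.gG z" "c.gGi z" "d.gG w" "d.gGi w"
    by (intro metric_map.intro metric_map_axioms.intro F.frame_map_axioms) (rule G_pb gd.G_sym gc_inv gd.Gi_inv)+
  interpret qz: function_calculus "family_germ z" by (rule family_germ_calculus)
  interpret qw: function_calculus "family_germ w" by (rule family_germ_calculus)
  have uc: "family_germ z (\<lambda>t x. gen_scalar_curv_local Gc Hc fc x) (GenScal space_D (c.gG z) (c.gGi z) hc kc)"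
    by (rule qz.Q_gen_scalar_curv) (rule c.germ_G[OF z] c.germ_Gi[OF z] hc kc)+
  have ud: "family_germ w (\<lambda>t x. gen_scalar_curv_local Gd Hd fd x) (GenScal space_D (d.gG w) (d.gGi w) hd kd)"
    by (rule qw.Q_gen_scalar_curv) (rule d.germ_G[OF w] d.germ_Gi[OF w] hd kd)+
  have "GenScal space_D (c.gG z) (c.gGi z) hc kc = germ_pull p (GenScal space_D (d.gG w) (d.gGi w) hd kd)"
    unfolding f_pb by (rule M.GenScal_map) (rule H_pb)
  then show ?thesis
    using family_germ_ev[OF uc] family_germ_ev[OF ud] by (simp add: z_def w_def sm.germ_pull_simps)
qed

section \<open>The maximum principle on the manifold\<close>

locale manifold_flow =
  fixes X :: "'a topology"
    and A :: "('a, 'n::finite) chart set"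
    and I :: "real set"
    and g :: "real \<Rightarrow> ('a, 'n) field2"
    and H :: "real \<Rightarrow> ('a, 'n) field3"
    and \<phi> :: "real \<Rightarrow> 'a \<Rightarrow> real"
  assumes manifold: "smooth_manifold X A" and compact: "compact_space X"
    and interval: "is_interval I" and I0: "0 \<in> I" and I_pos: "I \<subseteq> {0..}"
    and flow: "generalized_ricci_flow A I g H"
    and dilaton: "dilaton_flow A I g H \<phi>"
begin

lemma
  assumes c: "c \<in> A"
  shows open_dom: "openin X (chart_dom c)" and open_im: "open (chart_im c)"
    and homeo: "homeomorphic_map (subtopology X (chart_dom c)) (top_of_set (chart_im c)) (chart_map c)"
    and dom_subset: "chart_dom c \<subseteq> topspace X"
  using manifold c openin_subset unfolding smooth_manifold_def is_chart_def by auto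

lemma inj_chart: "c \<in> A \<Longrightarrow> inj_on (chart_map c) (chart_dom c)"
  using homeomorphic_imp_injective_map[OF homeo, of c] dom_subset[of c] by (simp add: Int_absorb1)

lemma chart_inv_map: "c \<in> A \<Longrightarrow> p \<in> chart_dom c \<Longrightarrow> chart_inv c (chart_map c p) = p"
  unfolding chart_inv_def by (intro inv_into_f_f inj_chart)

lemma map_in_im: "p \<in> chart_dom c \<Longrightarrow> chart_map c p \<in> chart_im c"
  unfolding chart_im_def by blast

lemma chart_around: "p \<in> topspace X \<Longrightarrow> \<exists>c\<in>A. p \<in> chart_dom c"
  using manifold unfolding smooth_manifold_def by blast

lemma open_overlap:
  assumes "c \<in> A" "d \<in> A" shows "open (overlap c d)"
proof -
  have "openin (subtopology X (chart_dom c)) (chart_dom c \<inter> chart_dom d)"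
    using open_dom[OF assms(2)] by (simp add: openin_subtopology_Int2)
  then have "openin (top_of_set (chart_im c)) (overlap c d)"
    using homeomorphic_imp_open_map[OF homeo[OF assms(1)]] unfolding overlap_def open_map_def by blast
  then show ?thesis using open_im[OF assms(1)] openin_open_eq by blast
qed

definition u where "u c t x = gen_scalar_curv_local (g t c) (H t c) (local_rep (\<phi> t) c) x"

lemma smooth_data:
  assumes c: "c \<in> A"
  shows "smooth_on (I \<times> chart_im c) (\<lambda>z. g (fst z) c (snd z))"
    and "smooth_on (I \<times> chart_im c) (\<lambda>z. H (fst z) c (snd z))"
    and "smooth_on (I \<times> chart_im c) (\<lambda>z. local_rep (\<phi> (fst z)) c (snd z))"
  using flow dilaton c
  unfolding generalized_ricci_flow_def dilaton_flow_def smooth_family_def split_def by auto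

lemma metric:
  assumes "c \<in> A" "t \<in> I" "x \<in> chart_im c"
  shows "transpose (g t c x) = g t c x" "v \<noteq> 0 \<Longrightarrow> v \<bullet> (g t c x *v v) > 0"
  using flow assms unfolding generalized_ricci_flow_def riemannian_metric_def by auto

lemma chart_metric: "c \<in> A \<Longrightarrow> chart_metric I (chart_im c) (\<lambda>t. g t c)"
  by (rule chart_metric.intro) (auto intro: open_im smooth_data metric)

lemma fixed_time_metric:
  assumes "c \<in> A" "t \<in> I" "open U" "U \<subseteq> chart_im c"
  shows "open_chart_metric UNIV U (\<lambda>_. g t c)"
proof (intro open_chart_metric.intro chart_metric.intro open_chart_metric_axioms.intro)
  show "smooth_on ((UNIV :: real set) \<times> U) (\<lambda>z. g t c (snd z))"
    by (rule smooth_on_snd[OF smooth_on_subset[OF smooth_on_slice[OF smooth_data(1)[OF assms(1)] assms(2)] assms(4)]])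
qed (use assms metric[OF assms(1,2)] in auto)

lemma chart_independent:
  assumes c: "c \<in> A" and d: "d \<in> A" and t: "t \<in> I" and p: "p \<in> chart_dom c" "p \<in> chart_dom d"
  shows "u c t (chart_map c p) = u d t (chart_map d p)"
proof -
  let ?\<tau> = "transition c d"
  have tr: "?\<tau> (chart_map c q) = chart_map d q" if "q \<in> chart_dom c" for q
    by (simp add: transition_def chart_inv_map[OF c that])
  have sub: "overlap c d \<subseteq> chart_im c" unfolding overlap_def chart_im_def by blast
  have im: "?\<tau> ` overlap c d \<subseteq> chart_im d" unfolding overlap_def chart_im_def by (auto simp: tr)
  have x: "chart_map c p \<in> overlap c d" using p unfolding overlap_def by blast
  have "gen_scalar_curv_local (g t c) (H t c) (local_rep (\<phi> t) c) (chart_map c p)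
      = gen_scalar_curv_local (g t d) (H t d) (local_rep (\<phi> t) d) (?\<tau> (chart_map c p))"
  proof (rule gen_scalar_curv_transform[OF fixed_time_metric[OF c t open_overlap[OF c d] sub]
        fixed_time_metric[OF d t open_im[OF d] order_refl] _ _ _ _ _ im _ _ _ x])
    show "smooth_on (overlap c d) (H t c)" "smooth_on (overlap c d) (local_rep (\<phi> t) c)"
      using smooth_on_subset[OF smooth_on_slice[OF smooth_data(2)[OF c] t] sub]
        smooth_on_subset[OF smooth_on_slice[OF smooth_data(3)[OF c] t] sub] by auto
    show "smooth_on (chart_im d) (H t d)" "smooth_on (chart_im d) (local_rep (\<phi> t) d)"
      using smooth_on_slice[OF smooth_data(2)[OF d] t] smooth_on_slice[OF smooth_data(3)[OF d] t] by auto
    show "smooth_on (overlap c d) ?\<tau>" using manifold c d unfolding smooth_manifold_def by auto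
    show "g t c y $ i $ j = (\<Sum>\<^sub>U a b. jacobian ?\<tau> (at y) $ a $ i * jacobian ?\<tau> (at y) $ b $ j * g t d (?\<tau> y) $ a $ b)" if "y \<in> overlap c d" for y i j
      using flow t c d that unfolding generalized_ricci_flow_def riemannian_metric_def tensor2_def Let_def by blast
    show "H t c y $ i $ j $ k = (\<Sum>\<^sub>U a b e. jacobian ?\<tau> (at y) $ a $ i * jacobian ?\<tau> (at y) $ b $ j * jacobian ?\<tau> (at y) $ e $ k
          * H t d (?\<tau> y) $ a $ b $ e)" if "y \<in> overlap c d" for y i j k
      using flow t c d that
      unfolding generalized_ricci_flow_def closed_three_form_def three_form_def tensor3_def Let_def by blast
    show "local_rep (\<phi> t) c y = local_rep (\<phi> t) d (?\<tau> y)" if "y \<in> overlap c d" for y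
      using that by (auto simp: overlap_def local_rep_def tr chart_inv_map c d)
  qed
  then show ?thesis using p by (simp add: u_def tr)
qed

abbreviation "R t p \<equiv> gen_scalar_curv A (g t) (H t) (\<phi> t) p"

text \<open>
  The definition of \<open>gen_scalar_curv\<close> selects a chart that may change from point to point. Continuity
  and differentiation require that a fixed chart may be used instead.
\<close>

lemma R_chart:
  assumes "c \<in> A" "t \<in> I" "p \<in> chart_dom c"
  shows "R t p = u c t (chart_map c p)"
proof -
  define d where "d = (SOME c. c \<in> A \<and> p \<in> chart_dom c)"
  have d: "d \<in> A \<and> p \<in> chart_dom d"
    unfolding d_def by (rule someI[of _ c]) (use assms in simp)
  have "R t p = u d t (chart_map d p)"
    unfolding gen_scalar_curv_def d_def[symmetric] u_def by simp
  then show ?thesis using chart_independent[of d c t p] d assms by simp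
qed

lemma continuous_u:
  assumes "c \<in> A"
  shows "continuous_on (I \<times> chart_im c) (\<lambda>z. u c (fst z) (snd z))"
  unfolding u_def
  by (intro smooth_on_imp_continuous_on chart_metric.smooth_gen_scalar_curv[OF chart_metric] smooth_data assms)

lemma interval_subset: "T \<in> I \<Longrightarrow> {0..T} \<subseteq> I"
  using interval I0 unfolding is_interval_1 by (meson atLeastAtMost_iff subsetI)

lemma continuous_R:
  assumes T: "T \<in> I"
  shows "continuous_map (prod_topology (top_of_set {0..T}) X) euclideanreal (\<lambda>(t, p). R t p)"
proof (rule pasting_lemma[where I = A and T = "\<lambda>c. {0..T} \<times> chart_dom c" and f = "\<lambda>c (t, p). u c t (chart_map c p)"])
  fix c assume c: "c \<in> A"
  show "openin (prod_topology (top_of_set {0..T}) X) ({0..T} \<times> chart_dom c)"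
    by (simp add: openin_prod_Times_iff open_dom[OF c])
  have sub: "subtopology (prod_topology (top_of_set {0..T}) X) ({0..T} \<times> chart_dom c)
      = prod_topology (top_of_set {0..T}) (subtopology X (chart_dom c))"
    by (simp add: subtopology_Times subtopology_subtopology)
  have "continuous_map (prod_topology (top_of_set {0..T}) (subtopology X (chart_dom c)))
      (prod_topology (top_of_set {0..T}) (top_of_set (chart_im c))) (\<lambda>(t, p). (t, chart_map c p))"
    using homeomorphic_imp_continuous_map[OF homeo[OF c]]
    unfolding continuous_map_prod_top by auto
  moreover have "continuous_map (prod_topology (top_of_set {0..T}) (top_of_set (chart_im c))) euclideanreal
      (\<lambda>z. u c (fst z) (snd z))"
    using continuous_on_subset[OF continuous_u[OF c], of "{0..T} \<times> chart_im c"] interval_subset[OF T]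
    by (simp add: prod_topology_subtopology_eu Sigma_mono)
  ultimately have "continuous_map (prod_topology (top_of_set {0..T}) (subtopology X (chart_dom c))) euclideanreal
      ((\<lambda>z. u c (fst z) (snd z)) \<circ> (\<lambda>(t, p). (t, chart_map c p)))"
    by (rule continuous_map_compose)
  then show "continuous_map (subtopology (prod_topology (top_of_set {0..T}) X) ({0..T} \<times> chart_dom c)) euclideanreal
      (\<lambda>(t, p). u c t (chart_map c p))"
    unfolding sub by (simp add: comp_def split_def)
next
  fix c d z
  assume "c \<in> A" "d \<in> A"
    "z \<in> topspace (prod_topology (top_of_set {0..T}) X) \<inter> {0..T} \<times> chart_dom c \<inter> {0..T} \<times> chart_dom d"
  then show "(case z of (t, p) \<Rightarrow> u c t (chart_map c p)) = (case z of (t, p) \<Rightarrow> u d t (chart_map d p))"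
    using interval_subset[OF T] by (auto intro!: chart_independent)
next
  fix z assume "z \<in> topspace (prod_topology (top_of_set {0..T}) X)"
  then obtain t p where z: "z = (t, p)" "t \<in> {0..T}" "p \<in> topspace X" by auto
  then obtain c where c: "c \<in> A" "p \<in> chart_dom c" using chart_around by blast
  have "R t p = u c t (chart_map c p)" using R_chart[of c t p] c z interval_subset[OF T] by auto
  then show "\<exists>c. c \<in> A \<and> z \<in> {0..T} \<times> chart_dom c \<and> (case z of (t, p) \<Rightarrow> R t p) = (case z of (t, p) \<Rightarrow> u c t (chart_map c p))"
    using z c by (intro exI[of _ c]) auto
qed

lemma interior_chart_flow:
  assumes c: "c \<in> A" and T: "T \<in> I"
  obtains b where "chart_flow {0<..<T} (chart_im c) (\<lambda>t. g t c) (\<lambda>t. H t c) b (H 0 c) (\<lambda>t. local_rep (\<phi> t) c)"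
proof -
  have sub: "{0<..<T} \<subseteq> I" using interval_subset[OF T] by auto
  have at: "(at t within {0<..<T}) = at t" if "t \<in> {0<..<T}" for t
    by (rule at_within_open[OF that open_greaterThanLessThan])
  obtain b where b: "smooth_family A I b" "\<forall>t\<in>I. \<forall>c\<in>A. \<forall>x\<in>chart_im c.
           H t c x = H 0 c x + ext_deriv2 (b t c) x \<and>
           ((\<lambda>s. b s c x) has_vector_derivative - codiff3 (g t c) (H t c) x) (at t within I)"
    using flow unfolding generalized_ricci_flow_def by auto
  have sm: "smooth_on ({0<..<T} \<times> chart_im c) f" if "smooth_on (I \<times> chart_im c) f" for f :: "_ \<Rightarrow> 'b::real_normed_vector"
    by (rule smooth_on_subset[OF that]) (use sub in auto)
  have vd: "(f has_vector_derivative D) (at t)"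
    if "(f has_vector_derivative D) (at t within I)" "t \<in> {0<..<T}" for f :: "real \<Rightarrow> 'b::real_normed_vector" and D t
    using has_vector_derivative_within_subset[OF that(1) sub] at[OF that(2)] by simp
  have rd: "(f has_real_derivative D) (at t)"
    if "(f has_real_derivative D) (at t within I)" "t \<in> {0<..<T}" for f D t
    using has_field_derivative_subset[OF that(1) sub] at[OF that(2)] by simp
  have "chart_flow {0<..<T} (chart_im c) (\<lambda>t. g t c) (\<lambda>t. H t c) (\<lambda>t. b t c) (H 0 c) (\<lambda>t. local_rep (\<phi> t) c)"
  proof (intro chart_flow.intro open_chart_metric.intro chart_metric.intro open_chart_metric_axioms.intro
      chart_flow_axioms.intro sm)
    show "smooth_on (I \<times> chart_im c) (\<lambda>z. b (fst z) c (snd z))"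
      using b(1) c unfolding smooth_family_def split_def by auto
  next
    fix t x i j k assume t: "t \<in> {0<..<T}" and x: "x \<in> chart_im c"
    then have tI: "t \<in> I" using sub by blast
    have form: "closed_three_form A (H t)" using flow tI unfolding generalized_ricci_flow_def by auto
    show "H t c x $ i $ j $ k = - H t c x $ j $ i $ k" "H t c x $ i $ j $ k = - H t c x $ i $ k $ j"
      "ext_deriv3 (H t c) x = 0"
      using form c x unfolding closed_three_form_def three_form_def by blast+
    show "H t c x = H 0 c x + ext_deriv2 (b t c) x" using b(2) tI c x by blast
    show "((\<lambda>s. g s c x) has_vector_derivative
        (-2) *\<^sub>R ricci (g t c) x + (1/2) *\<^sub>R form_sq (g t c) (H t c) x) (at t)"
      using flow tI c x t unfolding generalized_ricci_flow_def by (intro vd) blast+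
    show "((\<lambda>s. b s c x) has_vector_derivative - codiff3 (g t c) (H t c) x) (at t)"
      using b(2) tI c x t by (intro vd) blast+
    show "((\<lambda>s. local_rep (\<phi> s) c x) has_real_derivative
        laplacian (g t c) (local_rep (\<phi> t) c) x + 1/6 * form_norm_sq (g t c) (H t c) x) (at t)"
      using dilaton tI c x t unfolding dilaton_flow_def by (intro rd) blast+
  qed (use sub in \<open>auto intro: open_im[OF c] smooth_data[OF c] metric[OF c]\<close>)
  then show ?thesis by (rule that)
qed

text \<open>
  The weak maximum principle. At a minimum of \<open>R t p + e * t\<close> with \<open>t > 0\<close> the time derivative of \<open>R\<close>
  is nonnegative, so that of the sum is positive and the sum was smaller just before. The bound
  \<open>T < T'\<close> keeps such a time in the interior of \<open>I\<close>, where time derivatives are two-sided.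
\<close>

lemma minimum_at_initial_time:
  assumes T: "T' \<in> I" "0 \<le> T" "T < T'" and e: "e > 0" and ne: "topspace X \<noteq> {}"
  shows "\<exists>q\<in>topspace X. \<forall>t\<in>{0..T}. \<forall>p\<in>topspace X. R 0 q \<le> R t p + e * t"
proof -
  have TI: "T \<in> I" using interval_subset[OF T(1)] T by auto
  let ?Y = "prod_topology (top_of_set {0..T}) X"
  let ?w = "\<lambda>z. (case z of (t, p) \<Rightarrow> R t p) + e * fst z"
  have "continuous_map ?Y (top_of_set {0..T}) fst" by (rule continuous_map_fst)
  then have "continuous_map ?Y euclideanreal fst" by (rule continuous_map_into_fulltopology)
  then have w: "continuous_map ?Y euclideanreal ?w"
    by (intro continuous_map_add continuous_map_real_mult_left continuous_R[OF TI])
  have "compact_space ?Y" using compact by (simp add: compact_space_prod_topology compact_space_subtopology)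
  then have "compactin euclideanreal (?w ` topspace ?Y)"
    using image_compactin[OF _ w] unfolding compact_space_def by blast
  then have cmp: "compact (?w ` ({0..T} \<times> topspace X))" by simp
  have "?w ` ({0..T} \<times> topspace X) \<noteq> {}" using ne T by auto
  from compact_attains_inf[OF cmp this] obtain m
    where m: "m \<in> ?w ` ({0..T} \<times> topspace X)" "\<forall>y\<in>?w ` ({0..T} \<times> topspace X). m \<le> y"
    by (elim bexE)
  then obtain t0 q where tq: "t0 \<in> {0..T}" "q \<in> topspace X" "m = R t0 q + e * t0" by auto
  have min: "R t0 q + e * t0 \<le> R t p + e * t" if "t \<in> {0..T}" "p \<in> topspace X" for t p
    using m(2) that unfolding tq(3) by force
  have "t0 = 0"
  proof (rule ccontr)
    assume "t0 \<noteq> 0"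
    then have t0: "t0 \<in> {0<..<T'}" "0 < t0" using tq T by auto
    obtain c where c: "c \<in> A" "q \<in> chart_dom c" using chart_around tq by blast
    obtain b where b: "chart_flow {0<..<T'} (chart_im c) (\<lambda>t. g t c) (\<lambda>t. H t c) b (H 0 c) (\<lambda>t. local_rep (\<phi> t) c)"
      by (rule interior_chart_flow[OF c(1) T(1)])
    interpret F: chart_flow "{0<..<T'}" "chart_im c" "\<lambda>t. g t c" "\<lambda>t. H t c" b "H 0 c" "\<lambda>t. local_rep (\<phi> t) c" by (rule b)
    have Fu: "F.u = u c" by (simp add: fun_eq_iff F.u_def u_def)
    have I: "{0..T} \<subseteq> I" by (rule interval_subset[OF TI])
    have t0I: "t0 \<in> I" using I tq(1) by blast
    let ?x = "chart_map c q"
    have x: "?x \<in> chart_im c" by (rule map_in_im[OF c(2)])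
    have "\<forall>\<^sub>F y in nhds ?x. y \<in> chart_im c" using open_im[OF c(1)] x eventually_nhds by blast
    then have "\<forall>\<^sub>F y in nhds ?x. u c t0 ?x \<le> u c t0 y"
    proof (rule eventually_mono)
      fix y assume "y \<in> chart_im c"
      then obtain p where p: "p \<in> chart_dom c" "y = chart_map c p" unfolding chart_im_def by blast
      then show "u c t0 ?x \<le> u c t0 y"
        using min[OF tq(1) subsetD[OF dom_subset[OF c(1)] p(1)]]
        by (simp add: R_chart[OF c(1) t0I p(1)] R_chart[OF c(1) t0I c(2)])
    qed
    then obtain d where d: "d \<ge> 0" "((\<lambda>s. u c s ?x) has_real_derivative d) (at t0)"
      using F.time_derivative_at_spatial_min[OF t0(1) x] unfolding Fu by blast
    have "((\<lambda>s. u c s ?x + e * s) has_real_derivative d + e) (at t0)"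
      by (auto intro!: derivative_eq_intros d(2))
    from DERIV_pos_inc_left[OF this] d(1) e obtain r where r: "r > 0"
      "\<And>s. 0 < s \<Longrightarrow> s < r \<Longrightarrow> u c (t0 - s) ?x + e * (t0 - s) < u c t0 ?x + e * t0" by auto
    define s where "s = min (r / 2) t0"
    have s: "0 < s" "s < r" "t0 - s \<in> {0..T}" using r(1) t0 tq(1) by (auto simp: s_def)
    have "R (t0 - s) q + e * (t0 - s) < R t0 q + e * t0"
      using r(2)[OF s(1,2)] subsetD[OF I s(3)] by (simp add: R_chart[OF c(1) _ c(2)] t0I)
    then show False using min[OF s(3) tq(2)] by simp
  qed
  then show ?thesis using min tq(2) by (intro bexI[of _ q] ballI) auto
qed

lemma bdd_below_R:
  assumes "T' \<in> I" "0 < T'" and ne: "topspace X \<noteq> {}"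
  shows "bdd_below (R 0 ` topspace X)"
proof -
  obtain q where "\<forall>t\<in>{0..0}. \<forall>p\<in>topspace X. R 0 q \<le> R t p + 1 * t"
    using minimum_at_initial_time[OF assms(1) order_refl assms(2) zero_less_one ne] by blast
  then show ?thesis by (auto intro!: bdd_belowI[of _ "R 0 q"])
qed

lemma INF_le_R_before:
  assumes T: "T' \<in> I" "0 \<le> T" "T < T'" and p: "p \<in> topspace X"
  shows "(INF q\<in>topspace X. R 0 q) \<le> R T p"
proof (rule field_le_epsilon)
  fix e :: real assume e: "e > 0"
  have ne: "topspace X \<noteq> {}" using p by auto
  define e' where "e' = e / (T + 1)"
  have e': "e' > 0" "e' * T \<le> e" using e T by (auto simp: e'_def field_simps)
  obtain q where q: "q \<in> topspace X" "\<forall>t\<in>{0..T}. \<forall>p\<in>topspace X. R 0 q \<le> R t p + e' * t"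
    using minimum_at_initial_time[OF T e'(1) ne] by blast
  have "(INF q\<in>topspace X. R 0 q) \<le> R 0 q"
    using T by (intro cINF_lower bdd_below_R[of T'] q ne) auto
  also have "\<dots> \<le> R T p + e' * T" using q(2) T p by auto
  also have "\<dots> \<le> R T p + e" using e' by simp
  finally show "(INF q\<in>topspace X. R 0 q) \<le> R T p + e" .
qed

text \<open>
  The last time of \<open>I\<close>, if there is one, is reached by continuity.
\<close>

lemma INF_le_R:
  assumes t: "t \<in> I" "0 < t" and p: "p \<in> topspace X"
  shows "(INF q\<in>topspace X. R 0 q) \<le> R t p"
proof -
  obtain c where c: "c \<in> A" "p \<in> chart_dom c" using chart_around p by blast
  let ?f = "\<lambda>s. u c s (chart_map c p)"
  have I: "{0..t} \<subseteq> I" by (rule interval_subset[OF t(1)])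
  have R: "R s p = ?f s" if "s \<in> {0..t}" for s using R_chart[OF c(1) _ c(2)] that I by blast
  have "continuous_on {0..t} ((\<lambda>z. u c (fst z) (snd z)) \<circ> (\<lambda>s. (s, chart_map c p)))"
    by (rule continuous_on_compose)
      (use I map_in_im[OF c(2)] in \<open>auto intro!: continuous_intros continuous_on_subset[OF continuous_u[OF c(1)]]\<close>)
  then have cont: "continuous_on (closure {0..<t}) ?f" using t by (simp add: comp_def)
  have "?f t \<ge> (INF q\<in>topspace X. R 0 q)"
  proof (rule continuous_ge_on_closure[OF cont])
    show "t \<in> closure {0..<t}" using t by simp
    fix s assume s: "s \<in> {0..<t}"
    then show "(INF q\<in>topspace X. R 0 q) \<le> ?f s"
      using INF_le_R_before[OF t(1) _ _ p, of s] R[of s] by auto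
  qed
  then show ?thesis using R[of t] t by simp
qed

end

theorem corollary2p5:
  fixes X :: "'a topology"
    and A :: "('a, 'n::finite) chart set"
    and I :: "real set"
    and g :: "real \<Rightarrow> ('a, 'n) field2"
    and H :: "real \<Rightarrow> ('a, 'n) field3"
    and \<phi> :: "real \<Rightarrow> 'a \<Rightarrow> real"
  assumes "smooth_manifold X A" and "compact_space X"
    and "is_interval I" and "0 \<in> I" and "I \<subseteq> {0..}"
    and "generalized_ricci_flow A I g H"
    and "dilaton_flow A I g H \<phi>"
    and "t \<in> I"
  shows "(INF p\<in>topspace X. gen_scalar_curv A (g t) (H t) (\<phi> t) p)
       \<ge> (INF p\<in>topspace X. gen_scalar_curv A (g 0) (H 0) (\<phi> 0) p)"
proof (cases "t = 0 \<or> topspace X = {}")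
  case True
  then show ?thesis by auto
next
  case False
  interpret manifold_flow X A I g H \<phi> by (rule manifold_flow.intro) (fact assms)+
  have "t > 0" using False assms by auto
  then show ?thesis using False INF_le_R[OF \<open>t \<in> I\<close>] by (intro cINF_greatest) auto
qed

end
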